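(* Let $\mathcal{Q}$ be a quotient module of $H^2(\mathbb{D}^n)$ with $\mathcal{Q}\ne H^2(\mathbb{D}^n)$. Then $\mathcal{Q}$ is doubly commuting if and only if there exist an integer $m\in\{1,\dots,n\}$, indices $1\le i_1<\cdots<i_m\le n$, and inner functions $\Theta_{i_1},\dots,\Theta_{i_m}\in H^\infty(\mathbb{D})$ such that $$\mathcal{Q}=H^2(\mathbb{D}^n)/[\tilde\Theta_{i_1}H^2(\mathbb{D}^n)+\cdots+\tilde\Theta_{i_m}H^2(\mathbb{D}^n)],$$ where $\tilde\Theta_{i_j}(\boldsymbol{z})=\Theta_{i_j}(z_{i_j})$ for all $\boldsymbol{z}\in\mathbb{D}^n$.
   Context: $H^2(\mathbb{D}^n)$ is the Hardy space over the polydisc with coordinate multiplication operators $M_{z_1},\dots,M_{z_n}$. A quotient module $\mathcal{Q}$ of $H^2(\mathbb{D}^n)$ is a closed subspace invariant under $M_{z_1}^*,\dots,M_{z_n}^*$, equipped with $C_{z_i}=P_{\mathcal{Q}}M_{z_i}|_{\mathcal{Q}}$; it is doubly commuting if $C_{z_i}C_{z_j}^*=C_{z_j}^*C_{z_i}$ for all $1\le i<j\le n$. For a submodule (closed jointly invariant subspace) $\mathcal{S}$, the quotient $H^2(\mathbb{D}^n)/\mathcal{S}$ is identified with $\mathcal{S}^\perp$. A function in $H^\infty(\mathbb{D})$ is inner if its boundary values have modulus $1$ a.e. on the unit circle. *)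

theory Defs
  imports "HOL-Analysis.Analysis"
begin

text \<open>The index type \<open>'n\<close>, finite and linearly ordered, plays the role of \<open>{1,\<dots>,n}\<close>.\<close>

definition polydisc :: "(complex ^ 'n) set" where
  "polydisc = {z. \<forall>i. norm (z $ i) < 1}"

definition monomial :: "('n::finite \<Rightarrow> nat) \<Rightarrow> complex ^ 'n \<Rightarrow> complex" where
  "monomial k z = (\<Prod>i\<in>UNIV. (z $ i) ^ k i)"

definition hardy_expansion :: "(('n::finite \<Rightarrow> nat) \<Rightarrow> complex) \<Rightarrow> (complex ^ 'n \<Rightarrow> complex) \<Rightarrow> bool" where
  "hardy_expansion a f \<longleftrightarrow>
     (\<lambda>k. (norm (a k))\<^sup>2) summable_on UNIV \<and>
     (\<forall>z\<in>polydisc. ((\<lambda>k. a k * monomial k z) has_sum f z) UNIV)"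

text \<open>\<open>H\<^sup>2(D\<^sup>n)\<close>: the functions on the polydisc given by a power series with square-summable
  coefficients. HOL functions are total, so elements are normalised to vanish off the polydisc;
  in this way equality of functions means equality on the polydisc.\<close>

definition hardy :: "(complex ^ 'n::finite \<Rightarrow> complex) set" where
  "hardy = {f. (\<forall>z. z \<notin> polydisc \<longrightarrow> f z = 0) \<and> (\<exists>a. hardy_expansion a f)}"

definition hardy_coeff :: "(complex ^ 'n::finite \<Rightarrow> complex) \<Rightarrow> ('n \<Rightarrow> nat) \<Rightarrow> complex" where
  "hardy_coeff f = (THE a. hardy_expansion a f)"

definition hardy_inner :: "(complex ^ 'n::finite \<Rightarrow> complex) \<Rightarrow> (complex ^ 'n \<Rightarrow> complex) \<Rightarrow> complex" where
  "hardy_inner f g = (\<Sum>\<^sub>\<infinity>k. hardy_coeff f k * cnj (hardy_coeff g k))"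

definition hardy_norm :: "(complex ^ 'n::finite \<Rightarrow> complex) \<Rightarrow> real" where
  "hardy_norm f = sqrt (Re (hardy_inner f f))"

definition closed_subspace :: "(complex ^ 'n::finite \<Rightarrow> complex) set \<Rightarrow> bool" where
  "closed_subspace S \<longleftrightarrow>
     S \<subseteq> hardy \<and> (\<lambda>z. 0) \<in> S \<and>
     (\<forall>f\<in>S. \<forall>g\<in>S. (\<lambda>z. f z + g z) \<in> S) \<and>
     (\<forall>c. \<forall>f\<in>S. (\<lambda>z. c * f z) \<in> S) \<and>
     (\<forall>F f. (\<forall>k::nat. F k \<in> S) \<longrightarrow> f \<in> hardy \<longrightarrow>
        (\<lambda>k. hardy_norm (\<lambda>z. F k z - f z)) \<longlonglongrightarrow> 0 \<longrightarrow> f \<in> S)"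

definition mult_coord :: "'n::finite \<Rightarrow> (complex ^ 'n \<Rightarrow> complex) \<Rightarrow> (complex ^ 'n \<Rightarrow> complex)" where
  "mult_coord i f = (\<lambda>z. z $ i * f z)"

text \<open>\<open>hardy_adjoint H T\<close> is the Hilbert space adjoint of a bounded operator \<open>T\<close> on the
  closed subspace \<open>H\<close>; \<open>hardy_proj H\<close> is the orthogonal projection onto \<open>H\<close>.\<close>

definition hardy_adjoint ::
  "(complex ^ 'n::finite \<Rightarrow> complex) set \<Rightarrow> ((complex ^ 'n \<Rightarrow> complex) \<Rightarrow> (complex ^ 'n \<Rightarrow> complex))
    \<Rightarrow> (complex ^ 'n \<Rightarrow> complex) \<Rightarrow> (complex ^ 'n \<Rightarrow> complex)" where
  "hardy_adjoint H T g = (THE h. h \<in> H \<and> (\<forall>f\<in>H. hardy_inner (T f) g = hardy_inner f h))"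

definition hardy_proj ::
  "(complex ^ 'n::finite \<Rightarrow> complex) set \<Rightarrow> (complex ^ 'n \<Rightarrow> complex) \<Rightarrow> (complex ^ 'n \<Rightarrow> complex)" where
  "hardy_proj H f = (THE g. g \<in> H \<and> (\<forall>h\<in>H. hardy_inner (\<lambda>z. f z - g z) h = 0))"

definition submodule :: "(complex ^ 'n::finite \<Rightarrow> complex) set \<Rightarrow> bool" where
  "submodule S \<longleftrightarrow> closed_subspace S \<and> (\<forall>i. \<forall>f\<in>S. mult_coord i f \<in> S)"

definition quotient_module :: "(complex ^ 'n::finite \<Rightarrow> complex) set \<Rightarrow> bool" where
  "quotient_module Q \<longleftrightarrow>
     closed_subspace Q \<and> (\<forall>i. \<forall>f\<in>Q. hardy_adjoint hardy (mult_coord i) f \<in> Q)"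

definition compression ::
  "(complex ^ 'n::finite \<Rightarrow> complex) set \<Rightarrow> 'n \<Rightarrow> (complex ^ 'n \<Rightarrow> complex) \<Rightarrow> (complex ^ 'n \<Rightarrow> complex)" where
  "compression Q i f = hardy_proj Q (mult_coord i f)"

definition doubly_commuting :: "(complex ^ 'n::{finite,linorder} \<Rightarrow> complex) set \<Rightarrow> bool" where
  "doubly_commuting Q \<longleftrightarrow>
     (\<forall>i j. i < j \<longrightarrow> (\<forall>f\<in>Q.
        compression Q i (hardy_adjoint Q (compression Q j) f) =
        hardy_adjoint Q (compression Q j) (compression Q i f)))"

text \<open>\<open>H\<^sup>2(D\<^sup>n)/S\<close>, realised as the orthogonal complement of the submodule \<open>S\<close>.\<close>

definition hardy_quotient :: "(complex ^ 'n::finite \<Rightarrow> complex) set \<Rightarrow> (complex ^ 'n \<Rightarrow> complex) set" where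
  "hardy_quotient S = {f \<in> hardy. \<forall>g\<in>S. hardy_inner f g = 0}"

text \<open>The boundary value at \<open>cis t\<close> is the radial limit. Only the restriction of \<open>\<theta>\<close> to the
  open unit disc matters.\<close>

definition inner_function :: "(complex \<Rightarrow> complex) \<Rightarrow> bool" where
  "inner_function \<theta> \<longleftrightarrow>
     \<theta> holomorphic_on ball 0 1 \<and> bounded (\<theta> ` ball 0 1) \<and>
     (AE t in lebesgue_on {0..2 * pi}.
        \<exists>b. ((\<lambda>r. \<theta> (of_real r * cis t)) \<longlongrightarrow> b) (at_left 1) \<and> norm b = 1)"

text \<open>The algebraic sum of the spaces \<open>\<Theta>\<^sub>i(z\<^sub>i) H\<^sup>2(D\<^sup>n)\<close> over \<open>i = idx 1, \<dots>, idx m\<close>.\<close>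

definition inner_sum ::
  "nat \<Rightarrow> (nat \<Rightarrow> 'n::finite) \<Rightarrow> ('n \<Rightarrow> complex \<Rightarrow> complex) \<Rightarrow> (complex ^ 'n \<Rightarrow> complex) set" where
  "inner_sum m idx \<Theta> =
     {(\<lambda>z. \<Sum>j=1..m. \<Theta> (idx j) (z $ idx j) * F j z) | F. \<forall>j\<in>{1..m}. F j \<in> hardy}"

end

theory Submission
  imports Defs "HOL-Complex_Analysis.Complex_Analysis"
begin

text \<open>
  Taking coefficients identifies \<open>H\<^sup>2(D\<^sup>n)\<close> with square-summable families over multi-indices. Let
  \<open>S\<close> be the orthogonal complement of \<open>Q\<close> and \<open>P\<close> the projection onto \<open>Q\<close>. Double commutativity
  means that the defects \<open>z\<^sub>i f - P(z\<^sub>i f)\<close> and \<open>z\<^sub>j g - P(z\<^sub>j g)\<close> with \<open>f, g \<in> Q\<close> and \<open>i \<noteq> j\<close> are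
  orthogonal. If this holds, the defects of index \<open>i\<close> are stable under the adjoints of the other
  shifts, which forces their \<open>z\<^sub>i\<close>-slices into the space of one-variable functions \<open>a\<close> with
  \<open>a(z\<^sub>i) \<in> S\<close>; by Beurling's theorem this space is \<open>0\<close> or \<open>\<theta>\<^sub>i H\<^sup>2(D)\<close>. An element of \<open>S\<close>
  orthogonal to all \<open>\<theta>\<^sub>i(z\<^sub>i) H\<^sup>2(D\<^sup>n)\<close> is then orthogonal to all defects, hence the adjoint
  shifts keep it in \<open>S\<close>, and it must be \<open>0\<close>. Conversely, multiplications by inner functions
  of different variables doubly commute, so that any function is the sum of elements of the
  \<open>\<theta>\<^sub>i(z\<^sub>i) H\<^sup>2(D\<^sup>n)\<close> and a function orthogonal to all of them; this gives closedness of the sum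
  and the orthogonality of the defects.

  Inner functions correspond to sequences with orthonormal shifts: in one direction by Parseval's
  identity and dominated convergence, in the other by Fatou's theorem on radial limits.
\<close>

text \<open>Two obstacles shape the proof: sums of closed subspaces need not be closed, and products
  of \<open>H^2\<close> functions need not lie in \<open>H^2\<close>. Both are met by multiplying
  only by inner functions. These multiplications are isometries built from orthonormal families, so
  their ranges are closed; and as those of different variables doubly commute, removing the
  component in one range keeps orthogonality to the others. Defects enter as follows. For
  coinvariant \<open>Q\<close> the adjoint of \<open>C_j\<close> is the restriction of
  \<open>M_j^*\<close>, and the commutator of \<open>C_i\<close> and \<open>C_j^*\<close> at
  \<open>f\<close> is \<open>P M_j^* D_i f\<close>, with \<open>D_i f\<close> the defect. Pairing
  with \<open>g\<close> in \<open>Q\<close> gives the inner product of \<open>D_i f\<close> with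
  \<open>M_j g\<close>, of which only the defect \<open>D_j g\<close> counts. Boundary values occur
  only in the passage between inner functions and sequences. Mean convergence of dilations yields
  pointwise limits just along a subsequence, while the definition asks for full radial limits; these
  come from Lebesgue differentiation of a primitive of the boundary function.\<close>

no_notation Infinite_Set_Sum.abs_summable_on (infix "abs'_summable'_on" 50)
no_notation fps_nth (infixl "$" 75)

section \<open>The Hilbert space of square-summable families\<close>

typedef 'a ell2 = "{f :: 'a \<Rightarrow> complex. (\<lambda>k. (norm (f k))\<^sup>2) summable_on UNIV}"
  morphisms coord Ell2
  by (rule exI[of _ "\<lambda>_. 0"]) simp

setup_lifting type_definition_ell2

lemma ell2_eqI: "(\<And>k. coord x k = coord y k) \<Longrightarrow> x = y"
  by (metis coord_inject ext)

lemma coord_summable: "(\<lambda>k. (norm (coord x k))\<^sup>2) summable_on UNIV"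
  using coord[of x] by simp

lemma square_summable_add:
  fixes f g :: "'a \<Rightarrow> complex"
  assumes "(\<lambda>k. (norm (f k))\<^sup>2) summable_on A" "(\<lambda>k. (norm (g k))\<^sup>2) summable_on A"
  shows "(\<lambda>k. (norm (f k + g k))\<^sup>2) summable_on A"
proof (rule summable_on_comparison_test)
  show "(\<lambda>k. 2 * (norm (f k))\<^sup>2 + 2 * (norm (g k))\<^sup>2) summable_on A"
    by (intro summable_on_add summable_on_cmult_right assms)
  fix k
  have "(norm (f k + g k))\<^sup>2 \<le> (norm (f k) + norm (g k))\<^sup>2"
    by (intro power_mono norm_triangle_ineq) auto
  also have "\<dots> \<le> 2 * (norm (f k))\<^sup>2 + 2 * (norm (g k))\<^sup>2"
    using sum_squares_bound[of "norm (f k)" "norm (g k)"] by (simp add: power2_sum)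
  finally show "(norm (f k + g k))\<^sup>2 \<le> 2 * (norm (f k))\<^sup>2 + 2 * (norm (g k))\<^sup>2" .
qed auto

lemma square_summable_cmult:
  fixes f :: "'a \<Rightarrow> complex"
  assumes "(\<lambda>k. (norm (f k))\<^sup>2) summable_on A"
  shows "(\<lambda>k. (norm (c * f k))\<^sup>2) summable_on A"
  using summable_on_cmult_right[OF assms, of "(norm c)\<^sup>2"] by (simp add: norm_mult power_mult_distrib)

lemma square_summable_mult:
  fixes f g :: "'a \<Rightarrow> complex"
  assumes "(\<lambda>k. (norm (f k))\<^sup>2) summable_on A" "(\<lambda>k. (norm (g k))\<^sup>2) summable_on A"
  shows "(\<lambda>k. f k * g k) abs_summable_on A"
  by (rule abs_summable_product) (use assms in \<open>simp_all only: norm_mult power2_eq_square\<close>)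

instantiation ell2 :: (type) ab_group_add
begin
lift_definition zero_ell2 :: "'a ell2" is "\<lambda>_. 0" by simp
lift_definition plus_ell2 :: "'a ell2 \<Rightarrow> 'a ell2 \<Rightarrow> 'a ell2" is "\<lambda>f g k. f k + g k"
  using square_summable_add by auto
lift_definition uminus_ell2 :: "'a ell2 \<Rightarrow> 'a ell2" is "\<lambda>f k. - f k" by simp
lift_definition minus_ell2 :: "'a ell2 \<Rightarrow> 'a ell2 \<Rightarrow> 'a ell2" is "\<lambda>f g k. f k - g k"
  subgoal for f g using square_summable_add[of f UNIV "\<lambda>k. - g k"] by simp done
instance by standard (transfer; simp add: fun_eq_iff)+
end

lift_definition cscale :: "complex \<Rightarrow> 'a ell2 \<Rightarrow> 'a ell2" is "\<lambda>c f k. c * f k"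
  using square_summable_cmult by auto

lemma coord_zero [simp]: "coord 0 k = 0" by transfer simp
lemma coord_add [simp]: "coord (x + y) k = coord x k + coord y k" by transfer simp
lemma coord_minus [simp]: "coord (- x) k = - coord x k" by transfer simp
lemma coord_diff [simp]: "coord (x - y) k = coord x k - coord y k" by transfer simp
lemma coord_cscale [simp]: "coord (cscale c x) k = c * coord x k" by transfer simp

definition cinner :: "'a ell2 \<Rightarrow> 'a ell2 \<Rightarrow> complex" where
  "cinner x y = (\<Sum>\<^sub>\<infinity>k. coord x k * cnj (coord y k))"

lemma cinner_abs_summable: "(\<lambda>k. coord x k * cnj (coord y k)) abs_summable_on UNIV"
  by (rule square_summable_mult[OF coord_summable]) (simp only: complex_mod_cnj coord_summable)

lemma cinner_summable: "(\<lambda>k. coord x k * cnj (coord y k)) summable_on UNIV"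
  by (rule abs_summable_summable[OF cinner_abs_summable])

lemma cinner_has_sum: "((\<lambda>k. coord x k * cnj (coord y k)) has_sum cinner x y) UNIV"
  unfolding cinner_def using cinner_summable by (rule has_sum_infsum)

lemma cinner_add_left: "cinner (x + y) z = cinner x z + cinner y z"
  unfolding cinner_def using infsum_add[OF cinner_summable cinner_summable, of x z y z]
  by (simp add: algebra_simps)

lemma cinner_cscale_left [simp]: "cinner (cscale c x) y = c * cinner x y"
  unfolding cinner_def by (simp add: mult.assoc infsum_cmult_right')

lemma cinner_commute: "cinner x y = cnj (cinner y x)"
  unfolding cinner_def by (simp flip: infsum_cnj add: mult.commute)

lemma cinner_cscale_right [simp]: "cinner x (cscale c y) = cnj c * cinner x y"
  by (metis cinner_commute cinner_cscale_left complex_cnj_mult)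

lemma cinner_add_right: "cinner x (y + z) = cinner x y + cinner x z"
  by (metis cinner_add_left cinner_commute complex_cnj_add)

lemma cinner_self: "cinner x x = complex_of_real (\<Sum>\<^sub>\<infinity>k. (norm (coord x k))\<^sup>2)"
proof -
  have "((\<lambda>k. complex_of_real ((norm (coord x k))\<^sup>2)) has_sum complex_of_real (\<Sum>\<^sub>\<infinity>k. (norm (coord x k))\<^sup>2)) UNIV"
    by (intro has_sum_of_real has_sum_infsum coord_summable)
  then have "((\<lambda>k. coord x k * cnj (coord x k)) has_sum complex_of_real (\<Sum>\<^sub>\<infinity>k. (norm (coord x k))\<^sup>2)) UNIV"
    by (simp only: complex_norm_square)
  then show ?thesis using has_sum_unique[OF cinner_has_sum] by blast
qed

instantiation ell2 :: (type) real_vector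
begin
definition scaleR_ell2 :: "real \<Rightarrow> 'a ell2 \<Rightarrow> 'a ell2" where "scaleR_ell2 r = cscale (complex_of_real r)"
instance
  by standard (rule ell2_eqI; simp add: scaleR_ell2_def algebra_simps)+
end

text \<open>Taking the real part of \<open>cinner\<close> lets norm, limits, closedness and
  completeness come from the type classes; complex statements are regained through
  \<open>cinner_Re_i\<close>.\<close>

instantiation ell2 :: (type) real_inner
begin
definition inner_ell2 :: "'a ell2 \<Rightarrow> 'a ell2 \<Rightarrow> real" where "inner_ell2 x y = Re (cinner x y)"
definition norm_ell2 :: "'a ell2 \<Rightarrow> real" where "norm_ell2 x = sqrt (inner x x)"
definition sgn_ell2 :: "'a ell2 \<Rightarrow> 'a ell2" where "sgn_ell2 x = x /\<^sub>R norm x"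
definition dist_ell2 :: "'a ell2 \<Rightarrow> 'a ell2 \<Rightarrow> real" where "dist_ell2 x y = norm (x - y)"
definition uniformity_ell2 :: "('a ell2 \<times> 'a ell2) filter" where
  "uniformity_ell2 = (INF e\<in>{0 <..}. principal {(x, y). dist x y < e})"
definition open_ell2 :: "'a ell2 set \<Rightarrow> bool" where
  "open_ell2 U \<longleftrightarrow> (\<forall>x\<in>U. eventually (\<lambda>(x', y). x' = x \<longrightarrow> y \<in> U) uniformity)"
instance
proof
  fix x y z :: "'a ell2" and r s :: real
  show "inner x y = inner y x"
    unfolding inner_ell2_def by (subst cinner_commute) simp
  show "inner (x + y) z = inner x z + inner y z" by (simp add: inner_ell2_def cinner_add_left)
  show "inner (r *\<^sub>R x) y = r * inner x y" by (simp add: inner_ell2_def scaleR_ell2_def)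
  show "0 \<le> inner x x" by (simp add: inner_ell2_def cinner_self infsum_nonneg)
  show "inner x x = 0 \<longleftrightarrow> x = 0"
  proof
    assume "inner x x = 0"
    then have "(\<Sum>\<^sub>\<infinity>k. (norm (coord x k))\<^sup>2) \<le> 0" by (simp add: inner_ell2_def cinner_self)
    then have "(norm (coord x k))\<^sup>2 = 0" for k
      by (rule nonneg_infsum_le_0D) (use coord_summable in auto)
    then show "x = 0" by (intro ell2_eqI) simp
  qed (simp add: inner_ell2_def cinner_def)
qed (simp_all add: norm_ell2_def sgn_ell2_def dist_ell2_def uniformity_ell2_def open_ell2_def)
end

lemma scaleR_cscale: "r *\<^sub>R x = cscale (complex_of_real r) x" for x :: "'a ell2"
  by (simp add: scaleR_ell2_def)

lemma coord_scaleR [simp]: "coord (r *\<^sub>R x) k = complex_of_real r * coord x k"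
  by (simp add: scaleR_cscale)

lemma norm_ell2_sq: "(norm x)\<^sup>2 = (\<Sum>\<^sub>\<infinity>k. (norm (coord x k))\<^sup>2)" for x :: "'a ell2"
  by (simp add: power2_norm_eq_inner inner_ell2_def cinner_self)

lemma cinner_self_norm: "cinner x x = complex_of_real ((norm x)\<^sup>2)"
  by (simp add: norm_ell2_sq cinner_self)

lemma cinner_zero_left [simp]: "cinner 0 x = 0" and cinner_zero_right [simp]: "cinner x 0 = 0"
  by (simp_all add: cinner_def)

lemma cinner_minus_left [simp]: "cinner (- x) y = - cinner x y"
  by (metis cinner_add_left cinner_zero_left add.right_inverse add_eq_0_iff)

lemma cinner_diff_left: "cinner (x - y) z = cinner x z - cinner y z"
  by (metis cinner_add_left cinner_minus_left diff_conv_add_uminus)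

lemma cinner_diff_right: "cinner x (y - z) = cinner x y - cinner x z"
  by (metis cinner_commute cinner_diff_left complex_cnj_diff)

lemma cinner_eq_0_commute: "cinner x y = 0 \<longleftrightarrow> cinner y x = 0"
  by (metis cinner_commute complex_cnj_zero)

lemma cscale_1 [simp]: "cscale 1 x = x" by (rule ell2_eqI) simp
lemma cscale_0 [simp]: "cscale 0 x = 0" by (rule ell2_eqI) simp
lemma cscale_zero [simp]: "cscale c 0 = 0" by (rule ell2_eqI) simp
lemma cscale_cscale [simp]: "cscale c (cscale d x) = cscale (c * d) x" by (rule ell2_eqI) simp
lemma cscale_add_right: "cscale c (x + y) = cscale c x + cscale c y"
  by (rule ell2_eqI) (simp add: algebra_simps)

lemma norm_cscale [simp]: "norm (cscale c x) = norm c * norm x"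
proof (rule power2_eq_imp_eq)
  show "(norm (cscale c x))\<^sup>2 = (norm c * norm x)\<^sup>2"
    by (simp add: norm_ell2_sq norm_mult power_mult_distrib infsum_cmult_right')
qed auto

text \<open>The real inner products against \<open>y\<close> and against \<i> times \<open>y\<close>
  determine the complex one: this carries projections and continuity over from the real
  setting.\<close>

lemma cinner_Re_i: "cinner x y = complex_of_real (inner x y) + \<i> * complex_of_real (inner x (cscale \<i> y))"
  by (simp add: inner_ell2_def complex_eq_iff)

lemma Cauchy_Schwarz_cinner: "norm (cinner x y) \<le> norm x * norm y"
proof (cases "cinner x y = 0")
  case False
  \<comment> \<open>A unimodular factor that turns the inner product into its modulus, so that the
    real Cauchy-Schwarz inequality applies.\<close>
  define u where "u = cnj (cinner x y) / complex_of_real (norm (cinner x y))"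
  have u: "norm u = 1" using False by (simp add: u_def norm_divide)
  have "u * cinner x y = complex_of_real (norm (cinner x y)) * complex_of_real (norm (cinner x y)) / complex_of_real (norm (cinner x y))"
    using complex_norm_square[of "cinner x y"] by (simp add: u_def power2_eq_square mult.commute)
  then have "u * cinner x y = complex_of_real (norm (cinner x y))" using False by simp
  then have "norm (cinner x y) = inner (cscale u x) y" by (simp add: inner_ell2_def)
  also have "\<dots> \<le> norm (cscale u x) * norm y" by (rule norm_cauchy_schwarz)
  finally show ?thesis using u by simp
qed simp

lemma norm_coord_le: "norm (coord x k) \<le> norm x"
proof (rule power2_le_imp_le)
  show "(norm (coord x k))\<^sup>2 \<le> (norm x)\<^sup>2"
    using finite_sum_le_infsum[OF coord_summable[of x], of "{k}"] by (simp add: norm_ell2_sq)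
qed auto

lemma bounded_linear_cinner_left: "bounded_linear (\<lambda>x. cinner x y)"
  by (rule bounded_linear_intro[of _ "norm y"])
    (simp_all add: cinner_add_left scaleR_cscale Cauchy_Schwarz_cinner scaleR_conv_of_real)

lemma bounded_linear_coord: "bounded_linear (\<lambda>x. coord x k)"
  by (rule bounded_linear_intro[of _ 1]) (simp_all add: scaleR_conv_of_real norm_coord_le)

lemma bounded_linear_cscale: "bounded_linear (cscale c)"
  by (rule bounded_linear_intro[of _ "norm c"])
    (simp_all add: cscale_add_right scaleR_cscale mult.commute)

lemma coord_Ell2 [simp]: "(\<lambda>k. (norm (f k))\<^sup>2) summable_on UNIV \<Longrightarrow> coord (Ell2 f) = f"
  by (simp add: Ell2_inverse)

text \<open>Bounded partial sums give membership and the norm bound at once; this produces limits of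
  Cauchy sequences and, later, the coefficients of a bounded holomorphic function.\<close>

lemma ell2_bounded:
  fixes f :: "'a \<Rightarrow> complex"
  assumes "\<And>F. finite F \<Longrightarrow> (\<Sum>k\<in>F. (norm (f k))\<^sup>2) \<le> b\<^sup>2" "0 \<le> b"
  obtains x where "coord x = f" "norm x \<le> b"
proof -
  have s: "(\<lambda>k. (norm (f k))\<^sup>2) summable_on UNIV"
    by (rule nonneg_bdd_above_summable_on) (auto intro!: bdd_aboveI[of _ "b\<^sup>2"] assms)
  have "(norm (Ell2 f))\<^sup>2 \<le> b\<^sup>2"
    unfolding norm_ell2_sq coord_Ell2[OF s] by (rule infsum_le_finite_sums[OF s]) (use assms in auto)
  then have "norm (Ell2 f) \<le> b" using assms(2) power2_le_imp_le by blast
  then show thesis using that[of "Ell2 f"] s by simp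
qed

lemma sum_coord_le_norm:
  assumes "finite F" shows "(\<Sum>k\<in>F. (norm (coord x k))\<^sup>2) \<le> (norm x)\<^sup>2"
  unfolding norm_ell2_sq by (rule finite_sum_le_infsum[OF coord_summable]) (use assms in auto)

instance ell2 :: (type) complete_space
proof
  fix X :: "nat \<Rightarrow> 'a ell2" assume C: "Cauchy X"
  have "Cauchy (\<lambda>n. coord (X n) k)" for k
    using bounded_linear.Cauchy[OF bounded_linear_coord C] .
  then have "\<exists>l. (\<lambda>n. coord (X n) k) \<longlonglongrightarrow> l" for k
    using Cauchy_convergent_iff convergent_def by blast
  then obtain f where f: "(\<lambda>n. coord (X n) k) \<longlonglongrightarrow> f k" for k by metis
  \<comment> \<open>Stated for an arbitrary centre \<open>y\<close>: with \<open>y = 0\<close> it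
    puts the coordinatewise limit into the space, with \<open>y = X n\<close> it yields convergence
    in norm.\<close>
  have bound: "(\<Sum>k\<in>F. (norm (f k - coord y k))\<^sup>2) \<le> b\<^sup>2"
    if "finite F" "\<forall>\<^sub>F n in sequentially. norm (X n - y) \<le> b" for F y b
  proof (rule tendsto_upperbound)
    show "(\<lambda>n. \<Sum>k\<in>F. (norm (coord (X n) k - coord y k))\<^sup>2) \<longlonglongrightarrow> (\<Sum>k\<in>F. (norm (f k - coord y k))\<^sup>2)"
      by (intro tendsto_intros f)
    show "\<forall>\<^sub>F n in sequentially. (\<Sum>k\<in>F. (norm (coord (X n) k - coord y k))\<^sup>2) \<le> b\<^sup>2"
      using that(2)
    proof eventually_elim
      case (elim n)
      have "(\<Sum>k\<in>F. (norm (coord (X n) k - coord y k))\<^sup>2) \<le> (norm (X n - y))\<^sup>2"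
        using sum_coord_le_norm[OF that(1), of "X n - y"] by simp
      also have "\<dots> \<le> b\<^sup>2" using elim by (intro power_mono) auto
      finally show ?case .
    qed
  qed simp
  obtain B where B: "\<And>n. norm (X n) \<le> B" "0 < B"
    using cauchy_imp_bounded[OF C] unfolding bounded_pos by auto
  obtain x where x: "coord x = f"
    by (rule ell2_bounded[of f B]) (use bound[of _ 0 B] B in auto)
  have "X \<longlonglongrightarrow> x"
  proof (rule metric_LIMSEQ_I)
    fix r :: real assume r: "0 < r"
    then obtain M where M: "\<And>m n. m \<ge> M \<Longrightarrow> n \<ge> M \<Longrightarrow> dist (X m) (X n) < r / 2"
      using C unfolding Cauchy_def by (meson half_gt_zero)
    have "dist (X n) x < r" if n: "n \<ge> M" for n
    proof -
      have ev: "\<forall>\<^sub>F m in sequentially. norm (X m - X n) \<le> r / 2"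
        using M n by (auto simp: eventually_sequentially dist_norm intro!: exI[of _ M] less_imp_le)
      obtain z where z: "coord z = (\<lambda>k. f k - coord (X n) k)" "norm z \<le> r / 2"
        by (rule ell2_bounded[of "\<lambda>k. f k - coord (X n) k" "r/2"]) (use bound[OF _ ev] r in auto)
      have "z = x - X n" by (rule ell2_eqI) (simp add: z x)
      then show ?thesis using z r by (simp add: dist_norm norm_minus_commute)
    qed
    then show "\<exists>no. \<forall>n\<ge>no. dist (X n) x < r" by blast
  qed
  then show "convergent X" by (auto simp: convergent_def)
qed

instance ell2 :: (type) banach ..

section \<open>Orthogonal series and projections\<close>

lemma norm_sum_orthogonal:
  fixes v :: "'a \<Rightarrow> 'b::real_inner"
  assumes "\<And>k l. k \<noteq> l \<Longrightarrow> inner (v k) (v l) = 0" "finite F"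
  shows "(norm (\<Sum>k\<in>F. v k))\<^sup>2 = (\<Sum>k\<in>F. (norm (v k))\<^sup>2)"
  using assms(2)
proof (induction F)
  case (insert k F)
  have "inner (v k) (\<Sum>l\<in>F. v l) = 0"
    unfolding inner_sum_right using insert by (intro sum.neutral) (auto intro!: assms(1))
  then show ?case using insert
    by (simp add: power2_norm_eq_inner inner_add_left inner_add_right inner_commute)
qed simp

text \<open>By Pythagoras the squared norm of a finite block of vectors is the corresponding block
  of the scalar series, so the Cauchy criterion transfers.\<close>

lemma orthogonal_summable_on:
  fixes v :: "'a \<Rightarrow> 'b::{real_inner, banach}"
  assumes orth: "\<And>k l. k \<noteq> l \<Longrightarrow> inner (v k) (v l) = 0" and s: "(\<lambda>k. (norm (v k))\<^sup>2) summable_on A"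
  shows "v summable_on A"
proof -
  from s obtain L where L: "(sum (\<lambda>k. (norm (v k))\<^sup>2) \<longlongrightarrow> L) (finite_subsets_at_top A)"
    unfolding has_sum_def summable_on_def by blast
  have "\<exists>P. eventually P (finite_subsets_at_top A) \<and> (\<forall>F F'. P F \<and> P F' \<longrightarrow> dist (sum v F) (sum v F') < e)"
    if "e > 0" for e
  proof -
    \<comment> \<open>Scalar partial sums containing \<open>F0\<close> are within \<open>d\<close>
      of the limit, so two of them differ by less than \<open>2 * d\<close>, the square of
      \<open>e / 2\<close>.\<close>
    define d where "d = (e / 2)\<^sup>2 / 2"
    have d: "d > 0" using that by (simp add: d_def)
    have "\<forall>\<^sub>F F in finite_subsets_at_top A. dist (sum (\<lambda>k. (norm (v k))\<^sup>2) F) L < d"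
      using tendstoD[OF L d] .
    then have "\<exists>F0. finite F0 \<and> F0 \<subseteq> A \<and> (\<forall>F. finite F \<and> F0 \<subseteq> F \<and> F \<subseteq> A \<longrightarrow> dist (sum (\<lambda>k. (norm (v k))\<^sup>2) F) L < d)"
      unfolding eventually_finite_subsets_at_top .
    then obtain F0 where F0: "finite F0" "F0 \<subseteq> A"
      and F1: "\<forall>F. finite F \<and> F0 \<subseteq> F \<and> F \<subseteq> A \<longrightarrow> dist (sum (\<lambda>k. (norm (v k))\<^sup>2) F) L < d"
      by (elim exE conjE)
    have F2: "dist (sum (\<lambda>k. (norm (v k))\<^sup>2) F) L < d" if "finite F" "F0 \<subseteq> F" "F \<subseteq> A" for F
      using F1 that by simp
    have near: "dist (sum v F) (sum v F0) < e / 2" if F: "finite F" "F0 \<subseteq> F" "F \<subseteq> A" for F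
    proof -
      have "(dist (sum v F) (sum v F0))\<^sup>2 = (norm (sum v (F - F0)))\<^sup>2"
        using F by (simp add: dist_norm sum_diff)
      also have "\<dots> = (\<Sum>k\<in>F-F0. (norm (v k))\<^sup>2)"
        by (rule norm_sum_orthogonal[OF orth]) (use F in auto)
      also have "\<dots> = (\<Sum>k\<in>F. (norm (v k))\<^sup>2) - (\<Sum>k\<in>F0. (norm (v k))\<^sup>2)"
        using F by (simp add: sum_diff)
      also have "\<dots> < 2 * d"
        using F2[OF F] F2[OF F0(1) order_refl F0(2)] unfolding dist_norm real_norm_def by linarith
      also have "2 * d = (e / 2)\<^sup>2" by (simp add: d_def)
      finally show ?thesis using \<open>e > 0\<close> by (intro power2_less_imp_less[of _ "e / 2"]) auto
    qed
    show ?thesis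
    proof (intro exI conjI allI impI)
      show "\<forall>\<^sub>F F in finite_subsets_at_top A. finite F \<and> F0 \<subseteq> F \<and> F \<subseteq> A"
        unfolding eventually_finite_subsets_at_top by (rule exI[of _ F0]) (simp add: F0(1,2))
      fix F F' assume F: "(finite F \<and> F0 \<subseteq> F \<and> F \<subseteq> A) \<and> (finite F' \<and> F0 \<subseteq> F' \<and> F' \<subseteq> A)"
      have "dist (sum v F) (sum v F0) < e / 2" "dist (sum v F') (sum v F0) < e / 2"
        using F by (auto simp del: less_divide_eq_numeral1 intro: near)
      then show "dist (sum v F) (sum v F') < e" by (rule dist_triangle_half_l)
    qed
  qed
  then have c: "cauchy_filter (filtermap (sum v) (finite_subsets_at_top A))"
    by (simp add: cauchy_filter_metric_filtermap)
  have "\<exists>L'. filtermap (sum v) (finite_subsets_at_top A) \<le> nhds L'"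
    by (rule cauchy_filter_complete_converges[OF c complete_UNIV]) (simp_all add: filtermap_bot_iff)
  then obtain L' where "(sum v \<longlongrightarrow> L') (finite_subsets_at_top A)"
    unfolding filterlim_def by blast
  then show ?thesis using summable_on_def has_sum_def by blast
qed

lemma orthogonal_projection_exists:
  fixes V :: "'b::{real_inner, complete_space} set"
  assumes V: "closed V" "subspace V"
  shows "\<exists>p\<in>V. \<forall>v\<in>V. inner (x - p) v = 0"
proof -
  define d where "d = infdist x V"
  have ne: "V \<noteq> {}" using V subspace_0 by blast
  have d0: "d \<ge> 0" by (simp add: d_def infdist_nonneg)
  have dle: "d \<le> norm (x - v)" if "v \<in> V" for v
    using infdist_le[OF that, of x] by (simp add: d_def dist_norm)
  have "\<exists>v\<in>V. norm (x - v) < d + 1 / Suc n" for n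
  proof (rule ccontr)
    assume "\<not> ?thesis"
    then have "d + 1 / Suc n \<le> d"
      unfolding d_def infdist_notempty[OF ne] using ne
      by (intro cINF_greatest) (auto simp: dist_norm not_less)
    then show False by (simp add: field_simps)
  qed
  then obtain v where v: "\<And>n. v n \<in> V" "\<And>n. norm (x - v n) < d + 1 / Suc n" by metis
  \<comment> \<open>Parallelogram law for \<open>x - v m\<close> and \<open>x - v n\<close>; the
    midpoint lies in \<open>V\<close> and hence has distance at least \<open>d\<close> from
    \<open>x\<close>.\<close>
  have par: "(norm (v m - v n))\<^sup>2 \<le> 2 * (norm (x - v m))\<^sup>2 + 2 * (norm (x - v n))\<^sup>2 - 4 * d\<^sup>2" for m n
  proof -
    have "(1/2) *\<^sub>R (v m + v n) \<in> V" using V v by (intro subspace_scale subspace_add) auto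
    then have "d\<^sup>2 \<le> (norm (x - (1/2) *\<^sub>R (v m + v n)))\<^sup>2" using dle d0 by (intro power_mono) auto
    moreover have "(norm (v m - v n))\<^sup>2 = 2 * (norm (x - v m))\<^sup>2 + 2 * (norm (x - v n))\<^sup>2
       - 4 * (norm (x - (1/2) *\<^sub>R (v m + v n)))\<^sup>2"
      unfolding power2_norm_eq_inner
      by (simp add: inner_diff_left inner_diff_right inner_add_left inner_add_right inner_commute algebra_simps)
    ultimately show ?thesis by linarith
  qed
  have lim: "(\<lambda>n. norm (x - v n)) \<longlonglongrightarrow> d"
  proof (rule tendsto_sandwich[of "\<lambda>_. d" _ _ "\<lambda>n. d + 1 / Suc n"])
    show "(\<lambda>n. d + 1 / Suc n) \<longlonglongrightarrow> d"
      using tendsto_add[OF tendsto_const LIMSEQ_inverse_real_of_nat, of d] by (simp add: inverse_eq_divide)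
  qed (use v dle in \<open>auto intro!: always_eventually less_imp_le\<close>)
  have "Cauchy v"
  proof (rule metric_CauchyI)
    fix e :: real assume e: "e > 0"
    have "(\<lambda>n. (norm (x - v n))\<^sup>2) \<longlonglongrightarrow> d\<^sup>2" by (intro tendsto_intros lim)
    moreover have "d\<^sup>2 < d\<^sup>2 + e\<^sup>2 / 4" using e by simp
    ultimately have "\<forall>\<^sub>F n in sequentially. (norm (x - v n))\<^sup>2 < d\<^sup>2 + e\<^sup>2 / 4" by (rule order_tendstoD)
    then obtain M where M: "\<And>n. n \<ge> M \<Longrightarrow> (norm (x - v n))\<^sup>2 < d\<^sup>2 + e\<^sup>2 / 4"
      by (auto simp: eventually_sequentially)
    have "dist (v m) (v n) < e" if "m \<ge> M" "n \<ge> M" for m n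
    proof -
      have "(norm (v m - v n))\<^sup>2 < e\<^sup>2" using par[of m n] M[OF that(1)] M[OF that(2)] by linarith
      then show ?thesis using e by (simp add: dist_norm power2_less_imp_less)
    qed
    then show "\<exists>M. \<forall>m\<ge>M. \<forall>n\<ge>M. dist (v m) (v n) < e" by blast
  qed
  then obtain p where p: "v \<longlonglongrightarrow> p" using Cauchy_convergent_iff convergent_def by blast
  have pV: "p \<in> V" using closed_sequentially[OF V(1) _ p] v by blast
  have "(\<lambda>n. norm (x - v n)) \<longlonglongrightarrow> norm (x - p)" by (intro tendsto_intros p)
  then have nd: "norm (x - p) = d" using lim LIMSEQ_unique by blast
  have "inner (x - p) w = 0" if w: "w \<in> V" for w
  proof (cases "w = 0")
    case False
    \<comment> \<open>This \<open>t\<close> minimises the quadratic polynomial in the next estimate;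
      minimality of \<open>p\<close> then forces its linear coefficient to vanish.\<close>
    define t where "t = inner (x - p) w / inner w w"
    have ww: "inner w w > 0" using False by simp
    have "p + t *\<^sub>R w \<in> V" using V pV w by (intro subspace_add subspace_scale) auto
    then have "(norm (x - p))\<^sup>2 \<le> (norm (x - (p + t *\<^sub>R w)))\<^sup>2"
      unfolding nd using d0 dle by (intro power_mono) auto
    also have "\<dots> = (norm (x - p))\<^sup>2 - 2 * t * inner (x - p) w + t\<^sup>2 * inner w w"
      unfolding power2_norm_eq_inner
      by (simp add: inner_diff_left inner_diff_right inner_add_left inner_add_right inner_commute
          algebra_simps power2_eq_square)
    also have "\<dots> = (norm (x - p))\<^sup>2 - (inner (x - p) w)\<^sup>2 / inner w w"
      using ww by (simp add: t_def power2_eq_square field_simps)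
    finally have "(inner (x - p) w)\<^sup>2 / inner w w \<le> 0" by simp
    then show ?thesis using ww
      by (metis divide_le_0_iff not_less power2_less_eq_zero_iff)
  qed simp
  then show ?thesis using pV by blast
qed

definition hilbert_subspace :: "'a ell2 set \<Rightarrow> bool" where
  "hilbert_subspace V \<longleftrightarrow> closed V \<and> 0 \<in> V \<and> (\<forall>x\<in>V. \<forall>y\<in>V. x + y \<in> V) \<and> (\<forall>c. \<forall>x\<in>V. cscale c x \<in> V)"

lemma hilbert_subspaceD:
  assumes "hilbert_subspace V"
  shows "closed V" "0 \<in> V" "x \<in> V \<Longrightarrow> y \<in> V \<Longrightarrow> x + y \<in> V" "x \<in> V \<Longrightarrow> cscale c x \<in> V"
    "x \<in> V \<Longrightarrow> y \<in> V \<Longrightarrow> x - y \<in> V" "subspace V"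
proof -
  show s: "closed V" "0 \<in> V" "x \<in> V \<Longrightarrow> y \<in> V \<Longrightarrow> x + y \<in> V" "x \<in> V \<Longrightarrow> cscale c x \<in> V" for x y c
    using assms by (auto simp: hilbert_subspace_def)
  show v: "subspace V" unfolding subspace_def using s by (auto simp: scaleR_cscale)
  show "x \<in> V \<Longrightarrow> y \<in> V \<Longrightarrow> x - y \<in> V" using v subspace_diff by blast
qed

definition proj :: "'a ell2 set \<Rightarrow> 'a ell2 \<Rightarrow> 'a ell2" where
  "proj V x = (THE p. p \<in> V \<and> (\<forall>v\<in>V. cinner (x - p) v = 0))"

lemma proj_unique:
  assumes "hilbert_subspace V" "p \<in> V" "\<And>v. v \<in> V \<Longrightarrow> cinner (x - p) v = 0"
    "q \<in> V" "\<And>v. v \<in> V \<Longrightarrow> cinner (x - q) v = 0"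
  shows "p = q"
proof -
  have "p - q \<in> V" using assms hilbert_subspaceD(5) by blast
  then have "cinner (x - q) (p - q) - cinner (x - p) (p - q) = 0" using assms by simp
  then have "cinner (p - q) (p - q) = 0" by (simp add: cinner_diff_left)
  then show ?thesis by (simp add: cinner_self_norm)
qed

lemma proj:
  assumes V: "hilbert_subspace V"
  shows proj_in: "proj V x \<in> V" and proj_orth: "v \<in> V \<Longrightarrow> cinner (x - proj V x) v = 0"
proof -
  obtain p where p: "p \<in> V" "\<And>v. v \<in> V \<Longrightarrow> inner (x - p) v = 0"
    using orthogonal_projection_exists[OF hilbert_subspaceD(1)[OF V] hilbert_subspaceD(6)[OF V]] by blast
  \<comment> \<open>\<open>V\<close> is closed under multiplication by \<i>, so real orthogonality
    to \<open>V\<close> is complex orthogonality.\<close>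
  have "cinner (x - p) v = 0" if "v \<in> V" for v
    using p(2)[OF that] p(2)[OF hilbert_subspaceD(4)[OF V that, of \<i>]] by (simp add: cinner_Re_i)
  then have "\<exists>!p. p \<in> V \<and> (\<forall>v\<in>V. cinner (x - p) v = 0)"
    using p(1) proj_unique[OF V] by blast
  then have "proj V x \<in> V \<and> (\<forall>v\<in>V. cinner (x - proj V x) v = 0)"
    unfolding proj_def by (rule theI')
  then show "proj V x \<in> V" "v \<in> V \<Longrightarrow> cinner (x - proj V x) v = 0" by auto
qed

lemma proj_eqI:
  assumes "hilbert_subspace V" "p \<in> V" "\<And>v. v \<in> V \<Longrightarrow> cinner (x - p) v = 0"
  shows "proj V x = p"
  using proj_unique[OF assms(1) proj_in[OF assms(1)] proj_orth[OF assms(1)] assms(2,3)] .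

definition orthocomp :: "'a ell2 set \<Rightarrow> 'a ell2 set" where
  "orthocomp A = {x. \<forall>y\<in>A. cinner x y = 0}"

lemma orthocompI: "(\<And>y. y \<in> A \<Longrightarrow> cinner x y = 0) \<Longrightarrow> x \<in> orthocomp A"
  and orthocompD: "x \<in> orthocomp A \<Longrightarrow> y \<in> A \<Longrightarrow> cinner x y = 0"
  and orthocompD': "x \<in> orthocomp A \<Longrightarrow> y \<in> A \<Longrightarrow> cinner y x = 0"
  by (auto simp: orthocomp_def cinner_eq_0_commute)

lemma cinner_eq_0D: "cinner x y = 0 \<Longrightarrow> cinner y x = 0"
  by (simp add: cinner_eq_0_commute)

lemma hilbert_subspace_orthocomp: "hilbert_subspace (orthocomp A)"
proof -
  have "orthocomp A = (\<Inter>y\<in>A. {x. cinner x y = 0})" by (auto simp: orthocomp_def)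
  also have "closed \<dots>"
    by (intro closed_INT ballI closed_Collect_eq continuous_on_const
        bounded_linear.continuous_on[OF bounded_linear_cinner_left] continuous_on_id)
  finally show ?thesis by (auto simp: hilbert_subspace_def orthocomp_def cinner_add_left)
qed

lemma orthocomp_orthocomp:
  assumes V: "hilbert_subspace V"
  shows "orthocomp (orthocomp V) = V"
proof
  show "orthocomp (orthocomp V) \<subseteq> V"
  proof
    fix x assume x: "x \<in> orthocomp (orthocomp V)"
    have o: "x - proj V x \<in> orthocomp V" using proj_orth[OF V] by (intro orthocompI)
    have "cinner x (x - proj V x) = 0" using x o by (rule orthocompD)
    moreover have "cinner (proj V x) (x - proj V x) = 0" using o proj_in[OF V] by (rule orthocompD')
    ultimately have "cinner (x - proj V x) (x - proj V x) = 0" by (simp add: cinner_diff_left)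
    then have "x = proj V x" by (simp add: cinner_self_norm)
    then show "x \<in> V" using proj_in[OF V] by metis
  qed
qed (auto simp: orthocomp_def cinner_eq_0_commute)

section \<open>Complex-linear bounded operators and orthonormal expansions\<close>

definition delta :: "'a \<Rightarrow> 'a ell2" where "delta k = Ell2 (\<lambda>l. if l = k then 1 else 0)"

lemma coord_delta: "coord (delta k) l = (if l = k then 1 else 0)"
proof -
  have "(\<lambda>l. (norm (if l = k then 1 else 0::complex))\<^sup>2) summable_on UNIV"
    by (rule finite_nonzero_values_imp_summable_on) (simp add: if_distrib[of norm] if_distrib[of "\<lambda>x. x\<^sup>2"] cong: if_cong)
  then show ?thesis unfolding delta_def by simp
qed

lemma cinner_delta_right: "cinner x (delta k) = coord x k"
proof -
  have "((\<lambda>l. coord x l * cnj (coord (delta k) l)) has_sum coord x k) UNIV"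
    by (rule has_sum_finite_neutralI[of "{k}"]) (auto simp: coord_delta)
  then show ?thesis by (rule has_sum_unique[OF cinner_has_sum])
qed

lemma cinner_delta_left: "cinner (delta k) x = cnj (coord x k)"
  by (metis cinner_commute cinner_delta_right)

definition orthonormal :: "('a \<Rightarrow> 'b ell2) \<Rightarrow> bool" where
  "orthonormal e \<longleftrightarrow> (\<forall>k l. cinner (e k) (e l) = (if k = l then 1 else 0))"

lemma orthonormal_delta: "inj \<pi> \<Longrightarrow> orthonormal (\<lambda>k. delta (\<pi> k))"
  by (auto simp: orthonormal_def cinner_delta_right coord_delta inj_def)

text \<open>For orthonormal \<open>e\<close>, the isometry that sends the unit vectors
  \<open>delta k\<close> to \<open>e k\<close>. Coordinate shifts, inclusions of slices and
  multiplications by inner functions are all instances.\<close>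

definition ortho_ext :: "('a \<Rightarrow> 'b ell2) \<Rightarrow> 'a ell2 \<Rightarrow> 'b ell2" where
  "ortho_ext e x = (\<Sum>\<^sub>\<infinity>k. cscale (coord x k) (e k))"

lemma norm_eq_1_cinner: "cinner x x = 1 \<Longrightarrow> norm x = 1"
  by (simp add: norm_eq_sqrt_inner inner_ell2_def)

lemma orthonormal_norm: "orthonormal e \<Longrightarrow> norm (e k) = 1"
  by (rule norm_eq_1_cinner) (simp add: orthonormal_def)

lemma ortho_ext_has_sum:
  assumes e: "orthonormal e"
  shows "((\<lambda>k. cscale (coord x k) (e k)) has_sum ortho_ext e x) UNIV"
  unfolding ortho_ext_def
proof (rule has_sum_infsum, rule orthogonal_summable_on)
  show "inner (cscale (coord x k) (e k)) (cscale (coord x l) (e l)) = 0" if "k \<noteq> l" for k l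
    using e that by (simp add: inner_ell2_def orthonormal_def)
  show "(\<lambda>k. (norm (cscale (coord x k) (e k)))\<^sup>2) summable_on UNIV"
    using coord_summable[of x] orthonormal_norm[OF e] by simp
qed

lemma ortho_ext_cinner_left:
  assumes e: "orthonormal e"
  shows "((\<lambda>k. coord x k * cinner (e k) y) has_sum cinner (ortho_ext e x) y) UNIV"
  using has_sum_bounded_linear[OF bounded_linear_cinner_left[of y] ortho_ext_has_sum[OF e]] by simp

lemma cinner_ortho_ext_e:
  assumes e: "orthonormal e"
  shows "cinner (ortho_ext e x) (e l) = coord x l"
proof -
  have "((\<lambda>k. coord x k * cinner (e k) (e l)) has_sum coord x l) UNIV"
    by (rule has_sum_finite_neutralI[of "{l}"]) (use e in \<open>auto simp: orthonormal_def\<close>)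
  then show ?thesis by (rule has_sum_unique[OF ortho_ext_cinner_left[OF e]])
qed

lemma cinner_ortho_ext:
  assumes e: "orthonormal e"
  shows "cinner (ortho_ext e x) (ortho_ext e y) = cinner x y"
proof -
  have "cinner (e k) (ortho_ext e y) = cnj (coord y k)" for k
    by (metis cinner_commute cinner_ortho_ext_e[OF e])
  then have "((\<lambda>k. coord x k * cnj (coord y k)) has_sum cinner (ortho_ext e x) (ortho_ext e y)) UNIV"
    using ortho_ext_cinner_left[OF e, of x "ortho_ext e y"] by simp
  then show ?thesis by (rule has_sum_unique[OF _ cinner_has_sum])
qed

lemma norm_ortho_ext:
  assumes "orthonormal e" shows "norm (ortho_ext e x) = norm x"
  by (simp add: norm_eq_sqrt_inner inner_ell2_def cinner_ortho_ext[OF assms])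

definition cblin :: "('a ell2 \<Rightarrow> 'b ell2) \<Rightarrow> bool" where
  "cblin U \<longleftrightarrow> bounded_linear U \<and> (\<forall>c x. U (cscale c x) = cscale c (U x))"

lemma cblinD:
  assumes "cblin U"
  shows "bounded_linear U" "U (cscale c x) = cscale c (U x)" "U (x + y) = U x + U y"
    "U (x - y) = U x - U y" "U 0 = 0"
  using assms linear_add linear_diff linear_0
  by (auto simp: cblin_def dest!: bounded_linear.linear)

lemma cblin_ortho_ext:
  assumes e: "orthonormal e" shows "cblin (ortho_ext e)"
proof -
  have sc: "ortho_ext e (cscale c x) = cscale c (ortho_ext e x)" for c x
  proof (rule has_sum_unique[OF ortho_ext_has_sum[OF e]])
    show "((\<lambda>k. cscale (coord (cscale c x) k) (e k)) has_sum cscale c (ortho_ext e x)) UNIV"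
      using has_sum_bounded_linear[OF bounded_linear_cscale[of c] ortho_ext_has_sum[OF e, of x]] by simp
  qed
  have ad: "ortho_ext e (x + y) = ortho_ext e x + ortho_ext e y" for x y
  proof (rule has_sum_unique[OF ortho_ext_has_sum[OF e]])
    have "cscale (a + b) v = cscale a v + cscale b v" for a b and v :: "'b ell2"
      by (rule ell2_eqI) (simp add: algebra_simps)
    then show "((\<lambda>k. cscale (coord (x + y) k) (e k)) has_sum ortho_ext e x + ortho_ext e y) UNIV"
      using has_sum_add[OF ortho_ext_has_sum[OF e, of x] ortho_ext_has_sum[OF e, of y]] by simp
  qed
  have "bounded_linear (ortho_ext e)"
    by (rule bounded_linear_intro[of _ 1]) (simp_all add: ad sc scaleR_cscale norm_ortho_ext[OF e])
  then show ?thesis using sc by (simp add: cblin_def)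
qed

lemma ortho_ext_delta:
  assumes e: "orthonormal e" shows "ortho_ext e (delta k) = e k"
proof -
  have "((\<lambda>l. cscale (coord (delta k) l) (e l)) has_sum e k) UNIV"
    by (rule has_sum_finite_neutralI[of "{k}"]) (auto simp: coord_delta)
  then show ?thesis by (rule has_sum_unique[OF ortho_ext_has_sum[OF e]])
qed

lemma delta_expansion: "((\<lambda>k. cscale (coord x k) (delta k)) has_sum x) UNIV"
proof -
  have o: "orthonormal delta" using orthonormal_delta[of id] by simp
  have "coord (ortho_ext delta x) k = coord x k" for k
    using cinner_ortho_ext_e[OF o] by (simp add: cinner_delta_right)
  then have "ortho_ext delta x = x" by (rule ell2_eqI)
  then show ?thesis using ortho_ext_has_sum[OF o, of x] by simp
qed

lemma cblin_expansion:
  assumes "cblin U" shows "((\<lambda>k. cscale (coord x k) (U (delta k))) has_sum U x) UNIV"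
  using has_sum_bounded_linear[OF cblinD(1)[OF assms] delta_expansion[of x]] cblinD(2)[OF assms] by simp

lemma cblin_eqI:
  assumes "cblin U" "cblin V" "\<And>k. U (delta k) = V (delta k)"
  shows "U x = V x"
  using cblin_expansion[OF assms(1), of x] cblin_expansion[OF assms(2), of x] unfolding assms(3)
  by (rule has_sum_unique)

text \<open>Both inner products are sums of series in the values at unit vectors, so adjoint
  identities and evaluation formulas need checking on \<open>delta k\<close> only.\<close>

lemma cblin_cinner_eqI:
  assumes "cblin U" "cblin V" "\<And>k. cinner (U (delta k)) y = cinner (V (delta k)) z"
  shows "cinner (U x) y = cinner (V x) z"
proof -
  have "((\<lambda>k. coord x k * cinner (U (delta k)) y) has_sum cinner (U x) y) UNIV"
    "((\<lambda>k. coord x k * cinner (V (delta k)) z) has_sum cinner (V x) z) UNIV"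
    using has_sum_bounded_linear[OF bounded_linear_cinner_left cblin_expansion[OF assms(1)]]
      has_sum_bounded_linear[OF bounded_linear_cinner_left cblin_expansion[OF assms(2)]] by simp_all
  then show ?thesis unfolding assms(3) by (rule has_sum_unique)
qed

lemma cblin_zero: "cblin (\<lambda>_. 0)" by (simp add: cblin_def)

lemma cblin_cinner_0:
  assumes "cblin U" "\<And>k. cinner (U (delta k)) y = 0"
  shows "cinner (U x) y = 0"
  using cblin_cinner_eqI[OF assms(1) cblin_zero, of y] assms(2) by simp

lemma cblin_compose: "cblin U \<Longrightarrow> cblin V \<Longrightarrow> cblin (\<lambda>x. U (V x))"
  using bounded_linear_compose by (auto simp: cblin_def)

text \<open>Passing to the double orthogonal complement turns membership into vanishing inner
  products, which are decided on unit vectors.\<close>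

lemma cblin_in_subspace:
  assumes U: "cblin U" and V: "hilbert_subspace V" and "\<And>k. U (delta k) \<in> V"
  shows "U x \<in> V"
proof -
  have "U x \<in> orthocomp (orthocomp V)"
    by (rule orthocompI, rule cblin_cinner_0[OF U]) (erule orthocompD'[OF _ assms(3)])
  then show ?thesis using orthocomp_orthocomp[OF V] by simp
qed

lemma hilbert_subspace_isometric_image:
  assumes U: "cblin U" "\<And>x. norm (U x) = norm x" and V: "hilbert_subspace V"
  shows "hilbert_subspace (U ` V)"
proof -
  have "complete (U ` V)"
    by (rule complete_isometric_image[of 1, OF _ hilbert_subspaceD(6)[OF V] cblinD(1)[OF U(1)]])
      (simp_all add: U(2) complete_eq_closed hilbert_subspaceD(1)[OF V])
  then have "closed (U ` V)" by (rule complete_imp_closed)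
  moreover have "0 \<in> U ` V" using hilbert_subspaceD(2)[OF V] cblinD(5)[OF U(1)] by (metis image_eqI)
  moreover have "U x + U y \<in> U ` V" if "x \<in> V" "y \<in> V" for x y
    using hilbert_subspaceD(3)[OF V that] cblinD(3)[OF U(1)] by (metis image_eqI)
  moreover have "cscale c (U x) \<in> U ` V" if "x \<in> V" for x c
    using hilbert_subspaceD(4)[OF V that] cblinD(2)[OF U(1)] by (metis image_eqI)
  ultimately show ?thesis by (auto simp: hilbert_subspace_def)
qed

lemma hilbert_subspace_UNIV: "hilbert_subspace UNIV" by (simp add: hilbert_subspace_def)

section \<open>Relabelling of coordinates\<close>

text \<open>For injective \<open>\<pi>\<close> the coefficient at \<open>k\<close> is moved to
  \<open>\<pi> k\<close>, with zeros off the range; \<open>pull\<close> is the adjoint. Identities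
  between shifts and slices thus become identities between index maps.\<close>

definition push :: "('a \<Rightarrow> 'b) \<Rightarrow> 'a ell2 \<Rightarrow> 'b ell2" where "push \<pi> = ortho_ext (\<lambda>k. delta (\<pi> k))"

definition pull :: "('a \<Rightarrow> 'b) \<Rightarrow> 'b ell2 \<Rightarrow> 'a ell2" where "pull \<pi> y = Ell2 (\<lambda>k. coord y (\<pi> k))"

context
  fixes \<pi> :: "'a \<Rightarrow> 'b" assumes \<pi>: "inj \<pi>"
begin

lemma coord_pull [simp]: "coord (pull \<pi> y) k = coord y (\<pi> k)"
proof -
  have "(\<lambda>k. (norm (coord y k))\<^sup>2) summable_on \<pi> ` UNIV"
    by (rule summable_on_subset_banach[OF coord_summable]) simp
  then have "(\<lambda>k. (norm (coord y (\<pi> k)))\<^sup>2) summable_on UNIV"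
    by (subst (asm) summable_on_reindex[OF \<pi>]) (simp add: o_def)
  then show ?thesis by (simp add: pull_def)
qed

lemma cblin_push: "cblin (push \<pi>)"
  unfolding push_def by (rule cblin_ortho_ext[OF orthonormal_delta[OF \<pi>]])

lemma push_delta [simp]: "push \<pi> (delta k) = delta (\<pi> k)"
  unfolding push_def by (rule ortho_ext_delta[OF orthonormal_delta[OF \<pi>]])

lemma cinner_push_push [simp]: "cinner (push \<pi> x) (push \<pi> y) = cinner x y"
  unfolding push_def by (rule cinner_ortho_ext[OF orthonormal_delta[OF \<pi>]])

lemma norm_push [simp]: "norm (push \<pi> x) = norm x"
  unfolding push_def by (rule norm_ortho_ext[OF orthonormal_delta[OF \<pi>]])

lemma coord_push [simp]: "coord (push \<pi> x) (\<pi> k) = coord x k"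
  using cinner_ortho_ext_e[OF orthonormal_delta[OF \<pi>], of x k] by (simp add: cinner_delta_right push_def)

lemma coord_push_notin: "l \<notin> range \<pi> \<Longrightarrow> coord (push \<pi> x) l = 0"
  unfolding cinner_delta_right[symmetric]
  by (rule cblin_cinner_0[OF cblin_push]) (auto simp: cinner_delta_right coord_delta)

lemma pull_push [simp]: "pull \<pi> (push \<pi> x) = x"
  by (rule ell2_eqI) simp

lemma cinner_push_left: "cinner (push \<pi> x) y = cinner x (pull \<pi> y)"
proof -
  have "cblin (\<lambda>x. x)" by (simp add: cblin_def bounded_linear_ident)
  from cblin_cinner_eqI[OF cblin_push this, of y "pull \<pi> y" x] show ?thesis
    by (simp add: cinner_delta_left)
qed

lemma cinner_push_right: "cinner y (push \<pi> x) = cinner (pull \<pi> y) x"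
  by (metis cinner_commute cinner_push_left)

lemma pull_diff: "pull \<pi> (x - y) = pull \<pi> x - pull \<pi> y"
  by (rule ell2_eqI) simp

end

lemma push_push:
  assumes "inj \<pi>" "inj \<sigma>" shows "push \<pi> (push \<sigma> x) = push (\<lambda>k. \<pi> (\<sigma> k)) x"
proof -
  have i: "inj (\<lambda>k. \<pi> (\<sigma> k))" using assms by (auto simp: inj_def)
  show ?thesis
    by (rule cblin_eqI[OF cblin_compose[OF cblin_push[OF assms(1)] cblin_push[OF assms(2)]] cblin_push[OF i]])
      (simp add: assms i)
qed

lemma pull_pull:
  assumes "inj \<pi>" "inj \<sigma>" shows "pull \<sigma> (pull \<pi> y) = pull (\<lambda>k. \<pi> (\<sigma> k)) y"
proof -
  have i: "inj (\<lambda>k. \<pi> (\<sigma> k))" using assms by (auto simp: inj_def)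
  show ?thesis by (rule ell2_eqI) (simp add: assms i)
qed

section \<open>Beurling's theorem for one variable\<close>

abbreviation shift :: "nat \<Rightarrow> nat ell2 \<Rightarrow> nat ell2" where "shift k \<equiv> push ((+) k)"

lemma inj_plus_nat [simp]: "inj ((+) (k::nat))" by (simp add: inj_def)

text \<open>The inner product of two shifts of \<open>\<theta>\<close> is a Fourier coefficient of
  the squared boundary modulus, so orthonormality expresses unimodular boundary values by
  coefficients alone.\<close>

definition inner_seq :: "nat ell2 \<Rightarrow> bool" where "inner_seq \<theta> \<longleftrightarrow> orthonormal (\<lambda>k. shift k \<theta>)"

lemma shift_shift: "shift k (shift l x) = shift (k + l) x"
proof -
  have "(+) (k + l) = (\<lambda>n. k + (l + n))" by (rule ext) simp
  then show ?thesis by (simp add: push_push)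
qed

lemma shift_Suc: "shift (Suc k) x = push Suc (shift k x)"
proof -
  have "(+) (Suc k) = (\<lambda>n. Suc (k + n))" by (rule ext) simp
  then show ?thesis by (simp add: push_push)
qed

lemma shift_0 [simp]: "shift 0 x = x"
  by (rule cblin_eqI[OF cblin_push]) (simp_all add: cblin_def bounded_linear_ident)

lemma inner_seqI:
  assumes "norm \<theta> = 1" "\<And>k. cinner (shift (Suc k) \<theta>) \<theta> = 0"
  shows "inner_seq \<theta>"
proof -
  have lt: "cinner (shift l \<theta>) (shift k \<theta>) = 0" if kl: "k < l" for k l
  proof -
    obtain m where l: "l = k + Suc m" using less_imp_Suc_add[OF kl] by auto
    show ?thesis using assms(2)[of m] unfolding l shift_shift[symmetric] by simp
  qed
  have "cinner (shift k \<theta>) (shift l \<theta>) = (if k = l then 1 else 0)" for k l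
  proof (cases k l rule: linorder_cases)
    case less then show ?thesis using lt cinner_eq_0_commute by auto
  next
    case equal then show ?thesis using assms(1) by (simp add: cinner_self_norm)
  next
    case greater then show ?thesis using lt by auto
  qed
  then show ?thesis by (simp add: inner_seq_def orthonormal_def)
qed

text \<open>The product of \<open>\<theta>\<close> and its argument. For inner
  \<open>\<theta>\<close> it is isometric and stays square-summable, which a convolution of
  arbitrary square-summable sequences need not.\<close>

definition conv :: "nat ell2 \<Rightarrow> nat ell2 \<Rightarrow> nat ell2" where "conv \<theta> = ortho_ext (\<lambda>k. shift k \<theta>)"

lemma coord_shift: "coord (shift k x) n = (if k \<le> n then coord x (n - k) else 0)"
proof (cases "k \<le> n")
  case True
  then show ?thesis using coord_push[OF inj_plus_nat, of k x "n - k"] by simp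
next
  case False
  then show ?thesis by (auto intro!: coord_push_notin)
qed

lemma coord_conv:
  assumes "inner_seq \<theta>" shows "coord (conv \<theta> x) n = (\<Sum>k\<le>n. coord x k * coord \<theta> (n - k))"
proof -
  have "((\<lambda>k. coord x k * coord (shift k \<theta>) n) has_sum coord (conv \<theta> x) n) UNIV"
    using has_sum_bounded_linear[OF bounded_linear_coord ortho_ext_has_sum[OF assms[unfolded inner_seq_def]]]
    by (simp add: conv_def)
  moreover have "((\<lambda>k. coord x k * coord (shift k \<theta>) n) has_sum (\<Sum>k\<le>n. coord x k * coord \<theta> (n - k))) UNIV"
    by (rule has_sum_finite_neutralI[of "{..n}"]) (auto simp: coord_shift)
  ultimately show ?thesis by (rule has_sum_unique)
qed

lemma conv_commute:
  assumes "inner_seq f" "inner_seq g" shows "conv f g = conv g f"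
proof (rule ell2_eqI)
  fix n
  show "coord (conv f g) n = coord (conv g f) n"
    unfolding coord_conv[OF assms(1)] coord_conv[OF assms(2)]
    by (rule sum.reindex_bij_witness[of _ "\<lambda>k. n - k" "\<lambda>k. n - k"]) (auto simp: mult.commute)
qed

text \<open>The conclusion is the dual form of \<open>S = \<theta> H\<close>: whatever is orthogonal
  to all shifts of \<open>\<theta>\<close> is orthogonal to \<open>S\<close>. This is the form in
  which slices are tested later.\<close>

theorem beurling:
  fixes S :: "nat ell2 set"
  assumes S: "hilbert_subspace S" "\<And>x. x \<in> S \<Longrightarrow> push Suc x \<in> S" and ne: "S \<noteq> {0}"
  obtains \<theta> where "\<theta> \<in> S" "inner_seq \<theta>"
    "\<And>x y. x \<in> S \<Longrightarrow> (\<And>k. cinner (shift k \<theta>) y = 0) \<Longrightarrow> cinner x y = 0"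
proof -
  define S1 where "S1 = push Suc ` S"
  have S1: "hilbert_subspace S1"
    unfolding S1_def by (rule hilbert_subspace_isometric_image[OF cblin_push _ S(1)]) simp_all
  have S1S: "S1 \<subseteq> S" using S(2) by (auto simp: S1_def)
  note sub = hilbert_subspaceD[OF S(1)]
  have shS: "shift k x \<in> S" if "x \<in> S" for k x
    using that by (induction k) (simp_all add: shift_Suc S(2))
  have shS1: "shift (Suc k) x \<in> S1" if "x \<in> S" for k x
    using shS[OF that] by (simp add: shift_Suc S1_def)
  \<comment> \<open>An element of such a \<open>T\<close> is divisible by every power of the
    variable, so all its coefficients vanish.\<close>
  have zero: "x = 0" if "x \<in> T" "\<And>x. x \<in> T \<Longrightarrow> \<exists>x'\<in>T. x = push Suc x'" for x T
  proof (rule ell2_eqI)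
    fix n
    have "\<forall>x\<in>T. coord x n = 0"
    proof (induction n)
      case 0
      show ?case using that(2) by (metis coord_push_notin[OF inj_Suc] imageE nat.distinct(1))
    next
      case (Suc n)
      show ?case using that(2) Suc by (metis coord_push[OF inj_Suc])
    qed
    then show "coord x n = coord 0 n" using that(1) by simp
  qed
  \<comment> \<open>A vector of \<open>S\<close> orthogonal to \<open>S1\<close> is orthogonal to
    all its own proper shifts, since these lie in \<open>S1\<close>.\<close>
  have unit: "inner_seq (cscale (1 / complex_of_real (norm w)) w)"
    if w: "w \<in> S" "\<And>v. v \<in> S1 \<Longrightarrow> cinner w v = 0" "w \<noteq> 0" for w
  proof (rule inner_seqI)
    fix k
    have "cscale (1 / complex_of_real (norm w)) w \<in> S" using w sub(4) by blast
    from shS1[OF this] show "cinner (shift (Suc k) (cscale (1 / complex_of_real (norm w)) w))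
        (cscale (1 / complex_of_real (norm w)) w) = 0"
      using w(2) cinner_eq_0_commute by (metis cinner_cscale_right mult_zero_right)
  qed (use w in \<open>simp add: norm_divide\<close>)
  have "\<exists>w\<in>S. (\<forall>v\<in>S1. cinner w v = 0) \<and> w \<noteq> 0"
  proof (rule ccontr)
    assume no: "\<not> ?thesis"
    have "\<exists>x'\<in>S. x = push Suc x'" if "x \<in> S" for x
    proof -
      have "x - proj S1 x \<in> S" using that proj_in[OF S1] S1S sub(5) by blast
      then have "x = proj S1 x" using no proj_orth[OF S1] by fastforce
      then show ?thesis using proj_in[OF S1, of x] by (auto simp: S1_def)
    qed
    then have "S \<subseteq> {0}" using zero[of _ S] by blast
    then show False using ne sub(2) by blast
  qed
  then obtain w where w: "w \<in> S" "\<And>v. v \<in> S1 \<Longrightarrow> cinner w v = 0" "w \<noteq> 0" by blast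
  define \<theta> where "\<theta> = cscale (1 / complex_of_real (norm w)) w"
  have \<theta>: "\<theta> \<in> S" "inner_seq \<theta>" "\<And>v. v \<in> S1 \<Longrightarrow> cinner \<theta> v = 0"
    using w sub(4) unit[OF w] by (auto simp: \<theta>_def)
  \<comment> \<open>The wandering subspace is one-dimensional: for inner \<open>f\<close>, \<open>g\<close> with orthogonal shifts the
    product \<open>f g = g f\<close> lies in both of the orthogonal ranges \<open>f H\<close>, \<open>g H\<close>.\<close>
  have wand: "g = 0" if g: "g \<in> S" "\<And>v. v \<in> S1 \<Longrightarrow> cinner g v = 0" "cinner g \<theta> = 0" for g
  proof (rule ccontr)
    assume g0: "g \<noteq> 0"
    define f where "f = cscale (1 / complex_of_real (norm g)) g"
    have f: "f \<in> S" "inner_seq f" "\<And>v. v \<in> S1 \<Longrightarrow> cinner f v = 0" "cinner f \<theta> = 0" "norm f = 1"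
      using g sub(4) unit[OF g(1,2) g0] g0 by (auto simp: f_def norm_divide)
    have orth: "cinner (shift k \<theta>) (shift l f) = 0" for k l
    proof (cases k l rule: linorder_cases)
      case less
      then obtain m where l: "l = k + Suc m" by (auto dest: less_imp_Suc_add)
      show ?thesis using \<theta>(3)[OF shS1[OF f(1)], of m] unfolding l shift_shift[symmetric] by simp
    next
      case equal then show ?thesis using cinner_eq_0D[OF f(4)] by simp
    next
      case greater
      then obtain m where k: "k = l + Suc m" by (auto dest: less_imp_Suc_add)
      show ?thesis using cinner_eq_0D[OF f(3)[OF shS1[OF \<theta>(1)], of m]]
        unfolding k shift_shift[symmetric] by simp
    qed
    note o = \<theta>(2)[unfolded inner_seq_def] f(2)[unfolded inner_seq_def]
    have "cinner (conv \<theta> x) (conv f y) = 0" for x y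
      unfolding conv_def
    proof (rule cblin_cinner_0[OF cblin_ortho_ext[OF o(1)]])
      fix k
      have "cinner (ortho_ext (\<lambda>k. shift k f) y) (shift k \<theta>) = 0"
        by (rule cblin_cinner_0[OF cblin_ortho_ext[OF o(2)]])
          (simp add: ortho_ext_delta[OF o(2)] cinner_eq_0D[OF orth])
      from cinner_eq_0D[OF this]
      show "cinner (ortho_ext (\<lambda>k. shift k \<theta>) (delta k)) (ortho_ext (\<lambda>k. shift k f) y) = 0"
        by (simp add: ortho_ext_delta[OF o(1)])
    qed
    from this[of f \<theta>] have "cinner (conv \<theta> f) (conv \<theta> f) = 0"
      unfolding conv_commute[OF f(2) \<theta>(2)] .
    then have "norm (conv \<theta> f) = 0" by (simp add: cinner_self_norm)
    then show False using norm_ortho_ext[OF o(1), of f] f(5) by (simp add: conv_def)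
  qed
  have "cinner x y = 0" if x: "x \<in> S" and y: "\<And>k. cinner (shift k \<theta>) y = 0" for x y
  proof -
    note o = \<theta>(2)[unfolded inner_seq_def]
    define V where "V = range (conv \<theta>)"
    have V: "hilbert_subspace V" unfolding V_def conv_def
      by (rule hilbert_subspace_isometric_image[OF cblin_ortho_ext[OF o] norm_ortho_ext[OF o] hilbert_subspace_UNIV])
    have VS: "V \<subseteq> S" unfolding V_def conv_def
      using cblin_in_subspace[OF cblin_ortho_ext[OF o] S(1)] shS[OF \<theta>(1)] ortho_ext_delta[OF o] by auto
    have shV: "shift k \<theta> \<in> V" for k
      unfolding V_def conv_def by (metis ortho_ext_delta[OF o] rangeI)
    \<comment> \<open>The part of \<open>S\<close> orthogonal to all shifts of
      \<open>\<theta>\<close>. By \<open>wand\<close> its elements lie in \<open>S1\<close>, and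
      division by the variable stays in \<open>T\<close>, so \<open>zero\<close> makes it
      trivial.\<close>
    define T where "T = {r\<in>S. \<forall>k. cinner r (shift k \<theta>) = 0}"
    have T: "\<exists>r'\<in>T. r = push Suc r'" if r: "r \<in> T" for r
    proof -
      have rS: "r \<in> S" "\<And>k. cinner r (shift k \<theta>) = 0" using r by (auto simp: T_def)
      have "r - proj S1 r = 0"
      proof (rule wand)
        show "r - proj S1 r \<in> S" using rS proj_in[OF S1] S1S sub(5) by blast
        show "cinner (r - proj S1 r) v = 0" if "v \<in> S1" for v using proj_orth[OF S1 that] .
        have "cinner (proj S1 r) \<theta> = 0" using \<theta>(3) proj_in[OF S1] cinner_eq_0_commute by blast
        then show "cinner (r - proj S1 r) \<theta> = 0" using rS(2)[of 0] by (simp add: cinner_diff_left)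
      qed
      then have "r \<in> S1" using proj_in[OF S1, of r] by simp
      then obtain r' where r': "r' \<in> S" "r = push Suc r'" by (auto simp: S1_def)
      have "cinner r' (shift k \<theta>) = 0" for k
        using rS(2)[of "Suc k"] unfolding r'(2) shift_Suc by simp
      then show ?thesis using r' by (auto simp: T_def)
    qed
    have "x - proj V x \<in> T"
      using x proj_in[OF V] VS sub(5) proj_orth[OF V shV] by (auto simp: T_def)
    then have "x - proj V x = 0" using T by (rule zero)
    then obtain u where u: "x = conv \<theta> u" using proj_in[OF V, of x] by (auto simp: V_def)
    show ?thesis unfolding u conv_def
      by (rule cblin_cinner_0[OF cblin_ortho_ext[OF o]]) (simp add: ortho_ext_delta[OF o] y)
  qed
  then show thesis using that \<theta> by blast
qed

section \<open>Coordinate shifts and slices in several variables\<close>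

definition up :: "'n \<Rightarrow> ('n \<Rightarrow> nat) \<Rightarrow> 'n \<Rightarrow> nat" where "up i k = k(i := Suc (k i))"

definition line :: "'n \<Rightarrow> ('n \<Rightarrow> nat) \<Rightarrow> nat \<Rightarrow> 'n \<Rightarrow> nat" where "line i k m = k(i := m)"

abbreviation mul :: "'n \<Rightarrow> ('n \<Rightarrow> nat) ell2 \<Rightarrow> ('n \<Rightarrow> nat) ell2" where "mul i \<equiv> push (up i)"
abbreviation mul_adj :: "'n \<Rightarrow> ('n \<Rightarrow> nat) ell2 \<Rightarrow> ('n \<Rightarrow> nat) ell2" where "mul_adj i \<equiv> pull (up i)"
text \<open>Grouping a power series by the other variables writes it as a sum of monomials in those
  times functions of \<open>z_i\<close>; the slices are these functions. The entry
  \<open>k i\<close> has no influence, because \<open>line\<close> overwrites it.\<close>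

abbreviation slice :: "'n \<Rightarrow> ('n \<Rightarrow> nat) \<Rightarrow> ('n \<Rightarrow> nat) ell2 \<Rightarrow> nat ell2" where "slice i k \<equiv> pull (line i k)"
abbreviation unslice :: "'n \<Rightarrow> ('n \<Rightarrow> nat) \<Rightarrow> nat ell2 \<Rightarrow> ('n \<Rightarrow> nat) ell2" where "unslice i k \<equiv> push (line i k)"

lemma inj_up [simp]: "inj (up i)"
  by (rule injI) (metis fun_upd_apply fun_upd_triv fun_upd_upd nat.inject up_def)

lemma inj_line [simp]: "inj (line i k)"
  by (rule injI) (metis fun_upd_same line_def)

lemma line_apply: "line i k m j = (if j = i then m else k j)" by (simp add: line_def)

lemma up_line_same: "up i (line i k m) = line i k (Suc m)"
  and up_line: "j \<noteq> i \<Longrightarrow> up j (line i k m) = line i (up j k) m"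
  and line_up_same: "line i (up i k) = line i k"
  and line_self: "line i k (k i) = k"
  and line_line: "line i (line i k a) = line i k"
  by (auto simp: up_def line_def fun_eq_iff)

lemma multi_index_induct:
  fixes k :: "'n::finite \<Rightarrow> nat"
  assumes "\<And>j. j \<notin> A \<Longrightarrow> k j = 0" "P (\<lambda>_. 0)" "\<And>k j. j \<in> A \<Longrightarrow> P k \<Longrightarrow> P (up j k)"
  shows "P k"
  using assms(1)
proof (induction "sum k UNIV" arbitrary: k)
  case 0
  then have "k = (\<lambda>_. 0)" by auto
  then show ?case using assms(2) by simp
next
  case (Suc n)
  have "\<exists>j. k j \<noteq> 0"
  proof (rule ccontr)
    assume "\<not> ?thesis"
    then show False using Suc.hyps(2) by simp
  qed
  then obtain j where j: "k j \<noteq> 0" ..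
  then have jA: "j \<in> A" using Suc.prems by metis
  define k' where "k' = k(j := k j - 1)"
  have k: "k = up j k'" using j by (auto simp: k'_def up_def)
  have "sum k UNIV = Suc (sum k' UNIV)"
    unfolding k by (subst (1 2) sum.remove[of _ j]) (simp_all add: up_def)
  then have n: "n = sum k' UNIV" using Suc.hyps(2) by simp
  have "P k'" by (rule Suc.hyps(1)[OF n]) (use jA Suc.prems in \<open>auto simp: k'_def\<close>)
  then show ?case unfolding k using jA assms(3) by blast
qed

lemma not_range_up: "k i = 0 \<Longrightarrow> k \<notin> range (up i)"
  by (auto simp: up_def)

lemma mul_adj_mul_commute:
  assumes "i \<noteq> j" shows "mul_adj j (mul i x) = mul i (mul_adj j x)"
proof (rule ell2_eqI)
  fix k
  show "coord (mul_adj j (mul i x)) k = coord (mul i (mul_adj j x)) k"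
  proof (cases "k i")
    case 0
    then have "up j k i = 0" using assms by (simp add: up_def)
    with 0 have "k \<notin> range (up i)" "up j k \<notin> range (up i)" by (simp_all only: not_range_up not_False_eq_True)
    then show ?thesis by (simp add: coord_push_notin)
  next
    case (Suc m)
    have 1: "k = up i (k(i := m))" using Suc by (auto simp: up_def)
    have 2: "up j (up i (k(i := m))) = up i (up j (k(i := m)))" using assms by (auto simp: up_def fun_eq_iff)
    show ?thesis by (subst (1 2) 1) (simp add: 2)
  qed
qed

text \<open>The lines in direction \<open>i\<close> partition the multi-indices, with the points
  \<open>k i = 0\<close> as representatives, so the inner product is the sum of the inner products
  of slices.\<close>

lemma slices_orthogonal:
  fixes x y :: "('n::finite \<Rightarrow> nat) ell2"
  assumes "\<And>k. cinner (slice i k x) (slice i k y) = 0"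
  shows "cinner x y = 0"
proof -
  let ?f = "\<lambda>k. coord x k * cnj (coord y k)"
  have "bij_betw (\<lambda>(k, m). line i k m) ({k. k i = 0} \<times> UNIV) UNIV"
    by (rule bij_betw_byWitness[of _ "\<lambda>k. (k(i := 0), k i)"]) (auto simp: line_def fun_eq_iff)
  then have "((\<lambda>p. ?f (case p of (k, m) \<Rightarrow> line i k m)) has_sum cinner x y) ({k. k i = 0} \<times> UNIV)"
    using has_sum_reindex_bij_betw[of "\<lambda>(k, m). line i k m" _ UNIV ?f] cinner_has_sum[of x y] by blast
  then have "((\<lambda>_. 0) has_sum cinner x y) {k::'n \<Rightarrow> nat. k i = 0}"
  proof (rule has_sum_SigmaD[where B = "\<lambda>_. UNIV"])
    fix k
    show "((\<lambda>m. ?f (case (k, m) of (k, m) \<Rightarrow> line i k m)) has_sum 0) UNIV"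
      using cinner_has_sum[of "slice i k x" "slice i k y"] assms[of k] by simp
  qed
  from has_sum_unique[OF this has_sum_0_simp] show ?thesis .
qed

section \<open>Multiplication by an inner function of one variable\<close>

text \<open>\<open>wave \<theta> i k\<close> is the coefficient family of \<open>z\<^sup>k \<theta>(z\<^sub>i)\<close>.\<close>

definition wave :: "nat ell2 \<Rightarrow> 'n \<Rightarrow> ('n \<Rightarrow> nat) \<Rightarrow> ('n \<Rightarrow> nat) ell2" where
  "wave \<theta> i k = unslice i k (shift (k i) \<theta>)"

definition imul :: "nat ell2 \<Rightarrow> 'n \<Rightarrow> ('n \<Rightarrow> nat) ell2 \<Rightarrow> ('n \<Rightarrow> nat) ell2" where
  "imul \<theta> i = ortho_ext (wave \<theta> i)"

lemma wave_up: "mul j (wave \<theta> i k) = wave \<theta> i (up j k)"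
proof (cases "j = i")
  case True
  have "mul i (unslice i k z) = unslice i k (push Suc z)" for z
    by (simp add: push_push up_line_same)
  then show ?thesis using True by (simp add: wave_def line_up_same shift_Suc[symmetric]) (simp add: up_def)
next
  case False
  have "(\<lambda>m. up j (line i k m)) = line i (up j k)" using False by (simp add: up_line fun_eq_iff)
  then have "mul j (unslice i k z) = unslice i (up j k) z" for z
    by (simp add: push_push)
  then show ?thesis using False by (simp add: wave_def) (simp add: up_def)
qed

lemma cinner_wave: "cinner x (wave \<theta> i k) = cinner (slice i k x) (shift (k i) \<theta>)"
  by (simp add: wave_def cinner_push_right)

text \<open>Two waves along the same line are shifts of \<open>\<theta>\<close>; along different
  lines they have disjoint supports.\<close>

lemma orthonormal_wave:
  assumes \<theta>: "inner_seq \<theta>" shows "orthonormal (wave \<theta> i)"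
  unfolding orthonormal_def
proof (intro allI)
  fix k l :: "'a \<Rightarrow> nat"
  show "cinner (wave \<theta> i k) (wave \<theta> i l) = (if k = l then 1 else 0)"
  proof (cases "\<forall>j. j \<noteq> i \<longrightarrow> k j = l j")
    case True
    then have "line i k = line i l" "k = l \<longleftrightarrow> k i = l i" by (auto simp: line_def fun_eq_iff)
    then show ?thesis using \<theta> by (simp add: wave_def inner_seq_def orthonormal_def)
  next
    case False
    then obtain j where j: "j \<noteq> i" "k j \<noteq> l j" by auto
    have "slice i l (wave \<theta> i k) = 0"
    proof (rule ell2_eqI)
      fix m
      have "line i l m \<notin> range (line i k)"
      proof
        assume "line i l m \<in> range (line i k)"
        then obtain m' where "line i l m = line i k m'" by blast
        from fun_cong[OF this, of j] j show False by (simp add: line_def)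
      qed
      then show "coord (slice i l (wave \<theta> i k)) m = coord 0 m"
        by (simp add: wave_def coord_push_notin)
    qed
    then show ?thesis using j unfolding cinner_wave by auto
  qed
qed

lemma cblin_imul: "inner_seq \<theta> \<Longrightarrow> cblin (imul \<theta> i)"
  and imul_delta: "inner_seq \<theta> \<Longrightarrow> imul \<theta> i (delta k) = wave \<theta> i k"
  and cinner_imul_imul: "inner_seq \<theta> \<Longrightarrow> cinner (imul \<theta> i x) (imul \<theta> i y) = cinner x y"
  and norm_imul: "inner_seq \<theta> \<Longrightarrow> norm (imul \<theta> i x) = norm x"
  unfolding imul_def
  by (auto intro: cblin_ortho_ext ortho_ext_delta cinner_ortho_ext norm_ortho_ext orthonormal_wave)

text \<open>Only waves based on the line through \<open>l\<close>, at or below \<open>l\<close>,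
  reach the coefficient at \<open>l\<close>. The value is a finite Cauchy product, so commutation
  becomes a rearrangement of finite sums.\<close>

lemma coord_imul:
  assumes \<theta>: "inner_seq \<theta>"
  shows "coord (imul \<theta> i x) l = (\<Sum>m\<le>l i. coord x (line i l m) * coord \<theta> (l i - m))"
proof -
  have inj: "inj_on (line i l) {..l i}" by (rule inj_on_subset[OF inj_line]) simp
  have "((\<lambda>k. coord x k * coord (wave \<theta> i k) l) has_sum coord (imul \<theta> i x) l) UNIV"
    using has_sum_bounded_linear[OF bounded_linear_coord ortho_ext_has_sum[OF orthonormal_wave[OF \<theta>]]]
    by (simp add: imul_def)
  moreover have "((\<lambda>k. coord x k * coord (wave \<theta> i k) l) has_sum
      (\<Sum>m\<le>l i. coord x (line i l m) * coord \<theta> (l i - m))) UNIV"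
  proof (rule has_sum_finite_neutralI[of "line i l ` {..l i}"])
    fix k assume k: "k \<in> UNIV - line i l ` {..l i}"
    have "coord (wave \<theta> i k) l = 0"
    proof (cases "l \<in> range (line i k)")
      case True
      then obtain n where n: "l = line i k n" by (elim rangeE)
      have "k = line i l (k i)" unfolding n by (simp add: line_line line_self)
      then have "\<not> k i \<le> l i" using k by (metis Diff_iff atMost_iff image_eqI)
      then show ?thesis unfolding wave_def n by (simp add: coord_shift) (simp add: line_def)
    qed (simp add: wave_def coord_push_notin)
    then show "coord x k * coord (wave \<theta> i k) l = 0" by simp
  next
    have "coord (wave \<theta> i (line i l m)) l = coord \<theta> (l i - m)" if "m \<le> l i" for m
    proof -
      have "coord (unslice i l (shift m \<theta>)) (line i l (l i)) = coord \<theta> (l i - m)"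
        using that by (simp add: coord_shift)
      then show ?thesis by (simp add: wave_def line_line line_apply line_self)
    qed
    then show "(\<Sum>m\<le>l i. coord x (line i l m) * coord \<theta> (l i - m)) =
        (\<Sum>k\<in>line i l ` {..l i}. coord x k * coord (wave \<theta> i k) l)"
      by (simp add: sum.reindex[OF inj])
  qed auto
  ultimately show ?thesis by (rule has_sum_unique)
qed

lemma imul_commute:
  assumes \<theta>: "inner_seq \<theta>" "inner_seq \<phi>" "i \<noteq> j"
  shows "imul \<theta> i (imul \<phi> j x) = imul \<phi> j (imul \<theta> i x)"
proof (rule ell2_eqI)
  fix l
  have e: "line j (line i l m) n = line i (line j l n) m" for m n
    using assms(3) by (auto simp: line_def fun_eq_iff)
  have "coord (imul \<theta> i (imul \<phi> j x)) l = (\<Sum>m\<le>l i. \<Sum>n\<le>l j.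
      coord x (line j (line i l m) n) * coord \<phi> (l j - n) * coord \<theta> (l i - m))"
    using assms(3) assms(3)[symmetric] by (simp add: coord_imul \<theta> sum_distrib_right line_apply)
  also have "\<dots> = (\<Sum>n\<le>l j. \<Sum>m\<le>l i.
      coord x (line i (line j l n) m) * coord \<theta> (l i - m) * coord \<phi> (l j - n))"
    by (subst sum.swap) (simp add: e mult.assoc mult.commute[of "coord \<theta> _"])
  also have "\<dots> = coord (imul \<phi> j (imul \<theta> i x)) l"
    using assms(3) assms(3)[symmetric] by (simp add: coord_imul \<theta> sum_distrib_right line_apply)
  finally show "coord (imul \<theta> i (imul \<phi> j x)) l = coord (imul \<phi> j (imul \<theta> i x)) l" .
qed

text \<open>\<open>delta 1\<close> is the function \<open>z\<close>, so coordinate multiplications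
  are special inner multiplications and inherit their properties.\<close>

lemma inner_seq_delta_1: "inner_seq (delta 1)"
  unfolding inner_seq_def orthonormal_def by (auto simp: cinner_delta_right coord_delta)

lemma mul_eq_imul: "mul j x = imul (delta 1) j x"
proof (rule cblin_eqI[OF cblin_push cblin_imul[OF inner_seq_delta_1]])
  fix k
  show "mul j (delta k) = imul (delta 1) j (delta k)"
    by (simp add: imul_delta inner_seq_delta_1 wave_def up_def line_def Suc_eq_plus1 del: One_nat_def)
qed simp

section \<open>Orthogonal complements of the ranges of inner multiplications\<close>

definition wave_perp :: "nat ell2 \<Rightarrow> 'n \<Rightarrow> ('n \<Rightarrow> nat) ell2 set" where
  "wave_perp \<theta> i = {x. \<forall>k. cinner x (wave \<theta> i k) = 0}"

lemma hilbert_subspace_wave_perp: "hilbert_subspace (wave_perp \<theta> i)"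
proof -
  have "wave_perp \<theta> i = orthocomp (range (wave \<theta> i))" by (auto simp: wave_perp_def orthocomp_def)
  then show ?thesis using hilbert_subspace_orthocomp by metis
qed

lemma wave_perp_imul:
  assumes "inner_seq \<theta>" "x \<in> wave_perp \<theta> i" shows "cinner x (imul \<theta> i y) = 0"
proof -
  have "cinner (imul \<theta> i y) x = 0"
    by (rule cblin_cinner_0[OF cblin_imul[OF assms(1)]])
      (use assms(2) in \<open>simp add: imul_delta[OF assms(1)] wave_perp_def cinner_eq_0D\<close>)
  then show ?thesis by (rule cinner_eq_0D)
qed

lemma wave_perpI: 
  assumes "inner_seq \<theta>" "\<And>y. cinner x (imul \<theta> i y) = 0" shows "x \<in> wave_perp \<theta> i"
  using assms(2)[of "delta _"] by (simp add: wave_perp_def imul_delta[OF assms(1)])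

lemma cinner_sum_left: "cinner (sum f A) y = (\<Sum>a\<in>A. cinner (f a) y)"
  by (induction A rule: infinite_finite_induct) (simp_all add: cinner_add_left)

lemma coord_sum: "coord (sum f A) k = (\<Sum>a\<in>A. coord (f a) k)"
  by (induction A rule: infinite_finite_induct) simp_all

text \<open>Orthogonality to the range for variable \<open>i\<close> is a condition on slices in
  direction \<open>i\<close>, and such a slice of \<open>imul \<phi> j x\<close> is a finite linear
  combination of slices of \<open>x\<close> in the same direction.\<close>

lemma imul_wave_perp:
  assumes \<phi>: "inner_seq \<phi>" and ij: "i \<noteq> j" and x: "x \<in> wave_perp \<theta> i"
  shows "imul \<phi> j x \<in> wave_perp \<theta> i"
  unfolding wave_perp_def
proof (intro CollectI allI)
  fix k
  have "slice i k (imul \<phi> j x) = (\<Sum>m\<le>k j. cscale (coord \<phi> (k j - m)) (slice i (line j k m) x))"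
  proof (rule ell2_eqI)
    fix n
    have "line j (line i k n) m = line i (line j k m) n" for m
      using ij by (auto simp: line_def fun_eq_iff)
    then show "coord (slice i k (imul \<phi> j x)) n =
        coord (\<Sum>m\<le>k j. cscale (coord \<phi> (k j - m)) (slice i (line j k m) x)) n"
      using ij by (simp add: coord_imul[OF \<phi>] coord_sum line_apply mult.commute)
  qed
  moreover have "cinner (slice i (line j k m) x) (shift (k i) \<theta>) = 0" for m
  proof -
    have "cinner x (wave \<theta> i (line j k m)) = 0" using x by (simp add: wave_perp_def)
    then show ?thesis using ij by (simp add: cinner_wave line_apply)
  qed
  ultimately show "cinner (imul \<phi> j x) (wave \<theta> i k) = 0"
    by (simp add: cinner_wave cinner_sum_left)
qed

lemma mul_wave_perp: "i \<noteq> j \<Longrightarrow> x \<in> wave_perp \<theta> i \<Longrightarrow> mul j x \<in> wave_perp \<theta> i"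
  unfolding mul_eq_imul by (rule imul_wave_perp[OF inner_seq_delta_1])

lemma mul_adj_wave_perp: "x \<in> wave_perp \<theta> i \<Longrightarrow> mul_adj j x \<in> wave_perp \<theta> i"
  by (simp add: wave_perp_def cinner_push_right[OF inj_up, symmetric] wave_up)

text \<open>\<open>imul \<phi> j v\<close> is the projection of \<open>x\<close> onto the range for
  \<open>j\<close>, so \<open>v\<close> is the adjoint multiplication applied to \<open>x\<close>.
  As multiplications in different variables commute, pairing \<open>v\<close> with a multiple of
  \<open>\<theta>(z_i)\<close> amounts to pairing \<open>x\<close> with another such
  multiple.\<close>

lemma imul_component:
  assumes \<phi>: "inner_seq \<phi>"
  obtains v where "x - imul \<phi> j v \<in> wave_perp \<phi> j"
    "\<And>\<theta> i. inner_seq \<theta> \<Longrightarrow> i \<noteq> j \<Longrightarrow> x \<in> wave_perp \<theta> i \<Longrightarrow> imul \<phi> j v \<in> wave_perp \<theta> i"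
proof -
  define K where "K = range (imul \<phi> j)"
  have K: "hilbert_subspace K" unfolding K_def
    by (rule hilbert_subspace_isometric_image[OF cblin_imul[OF \<phi>] norm_imul[OF \<phi>] hilbert_subspace_UNIV])
  obtain v where v: "proj K x = imul \<phi> j v" using proj_in[OF K, of x] by (auto simp: K_def)
  have o: "cinner (x - imul \<phi> j v) (imul \<phi> j z) = 0" for z
    using proj_orth[OF K, of "imul \<phi> j z" x] v by (simp add: K_def)
  have "imul \<phi> j v \<in> wave_perp \<theta> i" if "inner_seq \<theta>" "i \<noteq> j" "x \<in> wave_perp \<theta> i" for \<theta> i
  proof (rule imul_wave_perp[OF \<phi> that(2)], rule wave_perpI[OF that(1)])
    fix y
    have "cinner v (imul \<theta> i y) = cinner x (imul \<phi> j (imul \<theta> i y))"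
      using o[of "imul \<theta> i y"] by (simp add: cinner_diff_left cinner_imul_imul[OF \<phi>])
    also have "\<dots> = 0"
      unfolding imul_commute[OF that(1) \<phi> that(2), symmetric] by (rule wave_perp_imul[OF that(1,3)])
    finally show "cinner v (imul \<theta> i y) = 0" .
  qed
  with wave_perpI[OF \<phi> o] show thesis by (rule that)
qed

section \<open>Sums of ranges of inner multipliers\<close>

text \<open>Components are removed one variable at a time. Each new component is itself orthogonal
  to the ranges already dealt with, so a single pass suffices.\<close>

lemma imul_sum_decomposition:
  fixes I :: "'n::finite set"
  assumes "\<And>i. i \<in> I \<Longrightarrow> inner_seq (\<theta> i)"
  shows "\<exists>u. \<forall>i\<in>I. x - (\<Sum>i\<in>I. imul (\<theta> i) i (u i)) \<in> wave_perp (\<theta> i) i"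
  using finite[of I] assms
proof (induction I)
  case (insert j I)
  then obtain u where u: "\<And>i. i \<in> I \<Longrightarrow> x - (\<Sum>i\<in>I. imul (\<theta> i) i (u i)) \<in> wave_perp (\<theta> i) i" by auto
  define q where "q = x - (\<Sum>i\<in>I. imul (\<theta> i) i (u i))"
  obtain v where v: "q - imul (\<theta> j) j v \<in> wave_perp (\<theta> j) j"
    "\<And>\<phi> i. inner_seq \<phi> \<Longrightarrow> i \<noteq> j \<Longrightarrow> q \<in> wave_perp \<phi> i \<Longrightarrow> imul (\<theta> j) j v \<in> wave_perp \<phi> i"
    using imul_component[of "\<theta> j" q j] insert.prems by blast
  have "(\<Sum>i\<in>I. imul (\<theta> i) i ((u(j := v)) i)) = (\<Sum>i\<in>I. imul (\<theta> i) i (u i))"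
    using insert.hyps by (intro sum.cong) auto
  then have e: "x - (\<Sum>i\<in>insert j I. imul (\<theta> i) i ((u(j := v)) i)) = q - imul (\<theta> j) j v"
    using insert.hyps by (simp add: q_def)
  have "q - imul (\<theta> j) j v \<in> wave_perp (\<theta> i) i" if "i \<in> I" for i
  proof (rule hilbert_subspaceD(5)[OF hilbert_subspace_wave_perp])
    show q: "q \<in> wave_perp (\<theta> i) i" using u that by (simp add: q_def)
    have ij: "i \<noteq> j" using that insert.hyps by auto
    have "inner_seq (\<theta> i)" by (rule insert.prems) (use that in simp)
    from v(2)[OF this ij q] show "imul (\<theta> j) j v \<in> wave_perp (\<theta> i) i" .
  qed
  then show ?case using v(1) e by (intro exI[of _ "u(j := v)"]) auto
qed simp

definition imul_sum :: "'n::finite set \<Rightarrow> ('n \<Rightarrow> nat ell2) \<Rightarrow> ('n \<Rightarrow> nat) ell2 set" where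
  "imul_sum I \<theta> = range (\<lambda>u. \<Sum>i\<in>I. imul (\<theta> i) i (u i))"

definition wave_perps :: "'n set \<Rightarrow> ('n \<Rightarrow> nat ell2) \<Rightarrow> ('n \<Rightarrow> nat) ell2 set" where
  "wave_perps I \<theta> = (\<Inter>i\<in>I. wave_perp (\<theta> i) i)"

lemma hilbert_subspace_wave_perps: "hilbert_subspace (wave_perps I \<theta>)"
proof -
  have "closed (wave_perps I \<theta>)" unfolding wave_perps_def
    by (intro closed_INT ballI hilbert_subspaceD(1)[OF hilbert_subspace_wave_perp])
  then show ?thesis
    by (simp add: hilbert_subspace_def wave_perps_def hilbert_subspaceD(2-4)[OF hilbert_subspace_wave_perp])
qed

lemma orthocomp_imul_sum:
  fixes I :: "'n::finite set"
  assumes \<theta>: "\<And>i. i \<in> I \<Longrightarrow> inner_seq (\<theta> i)"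
  shows "orthocomp (imul_sum I \<theta>) = wave_perps I \<theta>"
proof (intro equalityI subsetI)
  fix x assume x: "x \<in> wave_perps I \<theta>"
  show "x \<in> orthocomp (imul_sum I \<theta>)"
  proof (rule orthocompI)
    fix y assume "y \<in> imul_sum I \<theta>"
    then obtain u where y: "y = (\<Sum>i\<in>I. imul (\<theta> i) i (u i))" by (auto simp: imul_sum_def)
    have "cinner (imul (\<theta> i) i (u i)) x = 0" if "i \<in> I" for i
      by (rule cinner_eq_0D, rule wave_perp_imul[OF \<theta>[OF that]]) (use x that in \<open>simp add: wave_perps_def\<close>)
    then have "cinner y x = 0" unfolding y cinner_sum_left by (intro sum.neutral) auto
    then show "cinner x y = 0" by (rule cinner_eq_0D)
  qed
next
  fix x assume x: "x \<in> orthocomp (imul_sum I \<theta>)"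
  have "x \<in> wave_perp (\<theta> j) j" if "j \<in> I" for j
  proof (rule wave_perpI[OF \<theta>[OF that]])
    fix y
    have "(\<Sum>i\<in>I. imul (\<theta> i) i (if i = j then y else 0)) = (\<Sum>i\<in>I. if i = j then imul (\<theta> j) j y else 0)"
      by (intro sum.cong) (simp_all add: cblinD(5)[OF cblin_imul[OF \<theta>]])
    also have "\<dots> = imul (\<theta> j) j y" using that by simp
    finally have "(\<Sum>i\<in>I. imul (\<theta> i) i (if i = j then y else 0)) = imul (\<theta> j) j y" .
    then have "imul (\<theta> j) j y \<in> imul_sum I \<theta>" unfolding imul_sum_def
      by (intro range_eqI[where x = "\<lambda>i. if i = j then y else 0"]) (rule sym)
    with x show "cinner x (imul (\<theta> j) j y) = 0" by (rule orthocompD)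
  qed
  then show "x \<in> wave_perps I \<theta>" by (simp add: wave_perps_def)
qed

text \<open>Since orthogonal complements are closed, this contains the closedness of the algebraic
  sum. It rests on \<open>imul_sum_decomposition\<close>: the remainder \<open>x - s\<close> is
  orthogonal both to \<open>s\<close> and to \<open>x\<close>, hence zero.\<close>

lemma orthocomp_wave_perps:
  fixes I :: "'n::finite set"
  assumes \<theta>: "\<And>i. i \<in> I \<Longrightarrow> inner_seq (\<theta> i)"
  shows "orthocomp (wave_perps I \<theta>) = imul_sum I \<theta>"
proof (intro equalityI subsetI)
  fix x assume x: "x \<in> orthocomp (wave_perps I \<theta>)"
  have "\<exists>u. \<forall>i\<in>I. x - (\<Sum>i\<in>I. imul (\<theta> i) i (u i)) \<in> wave_perp (\<theta> i) i"
    by (rule imul_sum_decomposition[OF \<theta>])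
  then obtain u where u: "\<forall>i\<in>I. x - (\<Sum>i\<in>I. imul (\<theta> i) i (u i)) \<in> wave_perp (\<theta> i) i" ..
  define s where "s = (\<Sum>i\<in>I. imul (\<theta> i) i (u i))"
  have s: "s \<in> imul_sum I \<theta>" by (auto simp: s_def imul_sum_def)
  have q: "x - s \<in> wave_perps I \<theta>" using u by (simp add: s_def wave_perps_def)
  then have "x - s \<in> orthocomp (imul_sum I \<theta>)" by (simp add: orthocomp_imul_sum[OF \<theta>])
  then have "cinner x (x - s) = 0" "cinner s (x - s) = 0"
    using orthocompD[OF x q] orthocompD'[OF _ s] by simp_all
  then have "cinner (x - s) (x - s) = 0" by (simp add: cinner_diff_left)
  then show "x \<in> imul_sum I \<theta>" using s by (simp add: cinner_self_norm)
next
  fix x assume x: "x \<in> imul_sum I \<theta>"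
  show "x \<in> orthocomp (wave_perps I \<theta>)"
  proof (rule orthocompI)
    fix y assume "y \<in> wave_perps I \<theta>"
    then have "y \<in> orthocomp (imul_sum I \<theta>)" by (simp add: orthocomp_imul_sum[OF \<theta>])
    then show "cinner x y = 0" using x by (rule orthocompD')
  qed
qed

section \<open>Orthogonality of defects\<close>

text \<open>Double commutativity in terms of coefficients, see \<open>doubly_commuting_hfun\<close>.
  It is symmetric in the two indices, so no order on the variables is needed.\<close>

definition defect_orthogonal :: "('n \<Rightarrow> nat) ell2 set \<Rightarrow> bool" where
  "defect_orthogonal Q \<longleftrightarrow> (\<forall>i j. i \<noteq> j \<longrightarrow> (\<forall>f\<in>Q. \<forall>g\<in>Q.
     cinner (mul i f - proj Q (mul i f)) (mul j g - proj Q (mul j g)) = 0))"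

text \<open>For \<open>i \<in> I\<close> the defect in direction \<open>i\<close> is a multiple of
  the inner function in \<open>z_i\<close>, otherwise it is 0; in either case it stays orthogonal to
  the ranges for all other variables. Defects of different directions are therefore
  orthogonal.\<close>

lemma wave_perps_defect_orthogonal:
  fixes I :: "'n::finite set"
  assumes \<theta>: "\<And>i. i \<in> I \<Longrightarrow> inner_seq (\<theta> i)"
  shows "defect_orthogonal (wave_perps I \<theta>)"
proof -
  let ?Q = "wave_perps I \<theta>"
  have Q: "hilbert_subspace ?Q" by (rule hilbert_subspace_wave_perps)
  have perp: "mul i f \<in> wave_perp (\<theta> l) l" if "f \<in> ?Q" "l \<in> I" "l \<noteq> i" for f i l
    by (rule mul_wave_perp) (use that in \<open>simp_all add: wave_perps_def\<close>)
  have defect: "(\<forall>l\<in>I. l \<noteq> i \<longrightarrow> mul i f - proj ?Q (mul i f) \<in> wave_perp (\<theta> l) l) \<and>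
      (mul i f - proj ?Q (mul i f) = 0 \<or>
        (i \<in> I \<and> mul i f - proj ?Q (mul i f) \<in> range (imul (\<theta> i) i)))" if f: "f \<in> ?Q" for i f
  proof (cases "i \<in> I")
    case False
    have "mul i f \<in> ?Q"
      unfolding wave_perps_def
    proof
      fix l assume l: "l \<in> I"
      then have "l \<noteq> i" using False by auto
      with f l show "mul i f \<in> wave_perp (\<theta> l) l" by (rule perp)
    qed
    then have "proj ?Q (mul i f) = mul i f" by (intro proj_eqI[OF Q]) simp_all
    then show ?thesis using hilbert_subspaceD(2)[OF hilbert_subspace_wave_perp] by auto
  next
    case True
    obtain v where v: "mul i f - imul (\<theta> i) i v \<in> wave_perp (\<theta> i) i"
      "\<And>\<phi> l. inner_seq \<phi> \<Longrightarrow> l \<noteq> i \<Longrightarrow> mul i f \<in> wave_perp \<phi> l \<Longrightarrow> imul (\<theta> i) i v \<in> wave_perp \<phi> l"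
      using imul_component[OF \<theta>[OF True], of "mul i f" i] by blast
    have p: "imul (\<theta> i) i v \<in> wave_perp (\<theta> l) l" if "l \<in> I" "l \<noteq> i" for l
      using v(2)[OF \<theta>[OF that(1)] that(2) perp[OF f that]] .
    have r: "mul i f - imul (\<theta> i) i v \<in> ?Q"
      unfolding wave_perps_def
    proof
      fix l assume l: "l \<in> I"
      show "mul i f - imul (\<theta> i) i v \<in> wave_perp (\<theta> l) l"
      proof (cases "l = i")
        case False
        then show ?thesis
          by (intro hilbert_subspaceD(5)[OF hilbert_subspace_wave_perp] perp[OF f l] p[OF l])
      qed (use v(1) in simp)
    qed
    have "proj ?Q (mul i f) = mul i f - imul (\<theta> i) i v"
    proof (rule proj_eqI[OF Q r])
      fix q assume "q \<in> ?Q"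
      then have "cinner q (imul (\<theta> i) i v) = 0"
        by (intro wave_perp_imul[OF \<theta>[OF True]]) (use True in \<open>simp add: wave_perps_def\<close>)
      then show "cinner (mul i f - (mul i f - imul (\<theta> i) i v)) q = 0"
        using cinner_eq_0D by auto
    qed
    then show ?thesis using p True by auto
  qed
  show ?thesis
    unfolding defect_orthogonal_def
  proof (intro allI impI ballI)
    fix i j :: 'n and f g assume ij: "i \<noteq> j" and f: "f \<in> ?Q" and g: "g \<in> ?Q"
    define u w where "u = mul i f - proj ?Q (mul i f)" and "w = mul j g - proj ?Q (mul j g)"
    have u: "\<forall>l\<in>I. l \<noteq> i \<longrightarrow> u \<in> wave_perp (\<theta> l) l" unfolding u_def by (rule defect[OF f, THEN conjunct1])
    have "w = 0 \<or> (j \<in> I \<and> w \<in> range (imul (\<theta> j) j))" unfolding w_def by (rule defect[OF g, THEN conjunct2])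
    then have "cinner u w = 0"
    proof
      assume w: "j \<in> I \<and> w \<in> range (imul (\<theta> j) j)"
      then obtain y where y: "w = imul (\<theta> j) j y" by blast
      have "u \<in> wave_perp (\<theta> j) j" using u ij w by simp
      then show ?thesis unfolding y using w by (intro wave_perp_imul \<theta>) auto
    qed simp
    then show "cinner (mul i f - proj ?Q (mul i f)) (mul j g - proj ?Q (mul j g)) = 0"
      by (simp add: u_def w_def)
  qed
qed

section \<open>From orthogonal defects to inner functions\<close>

lift_definition cut :: "'n set \<Rightarrow> ('n \<Rightarrow> nat) ell2 \<Rightarrow> ('n \<Rightarrow> nat) ell2"
  is "\<lambda>F f k. if \<forall>j\<in>F. k j = 0 then f k else 0"
  by (erule summable_on_comparison_test) auto

lemma coord_cut: "coord (cut F x) k = (if \<forall>j\<in>F. k j = 0 then coord x k else 0)"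
  by transfer simp

text \<open>Setting \<open>z_j = 0\<close> is the operator \<open>1 - M_j M_j^*\<close>, so
  \<open>cut F\<close> is a product of such operators; \<open>X\<close> absorbs the adjoints and
  \<open>S\<close> the multiplications.\<close>

lemma cut_in_subspace:
  assumes S: "hilbert_subspace S" "\<And>i x. x \<in> S \<Longrightarrow> mul i x \<in> S"
    and X: "X \<subseteq> S" "\<And>j x. j \<in> A \<Longrightarrow> x \<in> X \<Longrightarrow> mul_adj j x \<in> X"
    and F: "finite F" "F \<subseteq> A" and x: "x \<in> X"
  shows "cut F x \<in> S"
  using F x
proof (induction F arbitrary: x)
  case empty
  have "cut {} x = x" by (rule ell2_eqI) (simp add: coord_cut)
  then show ?case using empty X(1) by auto
next
  case (insert j F)
  have "cut (insert j F) x = cut F x - mul j (cut F (mul_adj j x))"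
  proof (rule ell2_eqI)
    fix k
    show "coord (cut (insert j F) x) k = coord (cut F x - mul j (cut F (mul_adj j x))) k"
    proof (cases "k j")
      case 0
      then have "k \<notin> range (up j)" by (auto simp: up_def)
      then show ?thesis using 0 by (simp add: coord_cut coord_push_notin)
    next
      case (Suc m)
      define k' where "k' = k(j := m)"
      have k: "k = up j k'" using Suc by (auto simp: k'_def up_def)
      have "(\<forall>l\<in>F. k l = 0) \<longleftrightarrow> (\<forall>l\<in>F. k' l = 0)" using insert.hyps by (auto simp: k'_def)
      moreover have "coord (mul j (cut F (mul_adj j x))) k = (if \<forall>l\<in>F. k' l = 0 then coord x k else 0)"
        unfolding k coord_push[OF inj_up] by (simp add: coord_cut)
      ultimately show ?thesis using Suc by (simp add: coord_cut)
    qed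
  qed
  moreover have "cut F x \<in> S" "cut F (mul_adj j x) \<in> S" using insert X(2) by auto
  ultimately show ?case using S hilbert_subspaceD(5)[OF S(1)] by simp
qed

text \<open>The defects \<open>h = M\<^sub>i f - P M\<^sub>i f\<close> are invariant under the adjoints \<open>M\<^sub>j\<^sup>*\<close> for \<open>j \<noteq> i\<close>, so that
  every \<open>z\<^sub>i\<close>-slice of \<open>h\<close>, read as a function of \<open>z\<^sub>i\<close> alone, lies in the orthogonal complement of
  \<open>Q\<close>. Beurling's theorem applies to the space of all such one-variable functions.\<close>

theorem defect_orthogonal_imp_wave_perps:
  fixes Q :: "('n::finite \<Rightarrow> nat) ell2 set"
  assumes Q: "hilbert_subspace Q" "\<And>i x. x \<in> Q \<Longrightarrow> mul_adj i x \<in> Q"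
    and orth: "defect_orthogonal Q" and ne: "Q \<noteq> UNIV"
  obtains I \<theta> where "I \<noteq> {}" "\<And>i. i \<in> I \<Longrightarrow> inner_seq (\<theta> i)" "Q = wave_perps I \<theta>"
proof -
  define S where "S = orthocomp Q"
  have S: "hilbert_subspace S" unfolding S_def by (rule hilbert_subspace_orthocomp)
  have SM: "mul i x \<in> S" if "x \<in> S" for i x
    unfolding S_def
  proof (rule orthocompI)
    fix y assume "y \<in> Q"
    from Q(2)[OF this] show "cinner (mul i x) y = 0"
      unfolding cinner_push_left[OF inj_up] using that orthocompD by (auto simp: S_def)
  qed
  define S1 where "S1 i = {a. unslice i (\<lambda>_. 0) a \<in> S}" for i
  note unsl = cblin_push[OF inj_line]
  have S1: "hilbert_subspace (S1 i)" for i
  proof -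
    have "S1 i = unslice i (\<lambda>_. 0) -` S" by (auto simp: S1_def)
    then have "closed (S1 i)"
      using closed_vimage[OF hilbert_subspaceD(1)[OF S] linear_continuous_on[OF cblinD(1)[OF unsl]]]
      by metis
    then show ?thesis
      by (simp add: hilbert_subspace_def S1_def cblinD(2,3,5)[OF unsl] hilbert_subspaceD(2-4)[OF S])
  qed
  have S1M: "push Suc a \<in> S1 i" if "a \<in> S1 i" for a i
  proof -
    have "(\<lambda>m. line i (\<lambda>_. 0) (Suc m)) = (\<lambda>m. up i (line i (\<lambda>_. 0) m))" by (simp add: up_line_same)
    then have "unslice i (\<lambda>_. 0) (push Suc a) = mul i (unslice i (\<lambda>_. 0) a)"
      by (simp add: push_push)
    then show ?thesis using that SM by (simp add: S1_def)
  qed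
  \<comment> \<open>The variables for which \<open>S\<close> contains a nonzero function of that
    variable alone; these carry the inner functions.\<close>
  define I where "I = {i. S1 i \<noteq> {0}}"
  have "\<forall>i\<in>I. \<exists>\<theta>. \<theta> \<in> S1 i \<and> inner_seq \<theta> \<and>
      (\<forall>x y. x \<in> S1 i \<longrightarrow> (\<forall>k. cinner (shift k \<theta>) y = 0) \<longrightarrow> cinner x y = 0)"
  proof
    fix i assume "i \<in> I"
    then have ne: "S1 i \<noteq> {0}" by (simp add: I_def)
    show "\<exists>\<theta>. \<theta> \<in> S1 i \<and> inner_seq \<theta> \<and>
      (\<forall>x y. x \<in> S1 i \<longrightarrow> (\<forall>k. cinner (shift k \<theta>) y = 0) \<longrightarrow> cinner x y = 0)"
    proof (rule beurling[OF S1 _ ne])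
      fix x assume "x \<in> S1 i" then show "push Suc x \<in> S1 i" by (rule S1M)
    next
      fix \<theta> assume "\<theta> \<in> S1 i" "inner_seq \<theta>"
        and "\<And>x y. x \<in> S1 i \<Longrightarrow> (\<And>k. cinner (shift k \<theta>) y = 0) \<Longrightarrow> cinner x y = 0"
      then show ?thesis by (intro exI[of _ \<theta>] conjI allI impI) simp_all
    qed
  qed
  then obtain \<theta> where t: "\<forall>i\<in>I. \<theta> i \<in> S1 i \<and> inner_seq (\<theta> i) \<and>
      (\<forall>x y. x \<in> S1 i \<longrightarrow> (\<forall>k. cinner (shift k (\<theta> i)) y = 0) \<longrightarrow> cinner x y = 0)"
    unfolding bchoice_iff ..
  then have \<theta>: "\<And>i. i \<in> I \<Longrightarrow> \<theta> i \<in> S1 i" "\<And>i. i \<in> I \<Longrightarrow> inner_seq (\<theta> i)"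
    and beu: "\<And>i x y. i \<in> I \<Longrightarrow> x \<in> S1 i \<Longrightarrow> (\<And>k. cinner (shift k (\<theta> i)) y = 0) \<Longrightarrow> cinner x y = 0"
    by simp_all
  have wS: "wave (\<theta> i) i k \<in> S" if i: "i \<in> I" for i k
  proof (rule multi_index_induct[of UNIV k])
    show "wave (\<theta> i) i (\<lambda>_. 0) \<in> S" using \<theta>(1)[OF i] by (simp add: wave_def S1_def)
    show "wave (\<theta> i) i (up j k) \<in> S" if "wave (\<theta> i) i k \<in> S" for k j
      using SM[OF that, of j] by (simp add: wave_up)
  qed simp
  let ?P = "wave_perps I \<theta>"
  have P: "hilbert_subspace ?P" by (rule hilbert_subspace_wave_perps)
  have QP: "Q \<subseteq> ?P"
  proof
    fix q assume q: "q \<in> Q"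
    have "cinner q (wave (\<theta> i) i k) = 0" if "i \<in> I" for i k
      by (rule orthocompD'[OF wS[OF that, unfolded S_def] q])
    then show "q \<in> ?P" by (simp add: wave_perps_def wave_perp_def)
  qed
  \<comment> \<open>Membership in \<open>?P\<close> tests slices only against shifts of
    \<open>\<theta> i\<close>; Beurling's theorem extends this to all of \<open>S1 i\<close>. For
    \<open>i\<close> outside \<open>I\<close> that space is trivial.\<close>
  have slice_orth: "cinner a (slice i k g) = 0" if "g \<in> ?P" "a \<in> S1 i" for g a i k
  proof (cases "i \<in> I")
    case True
    have "cinner (shift m (\<theta> i)) (slice i k g) = 0" for m
    proof -
      have "cinner g (wave (\<theta> i) i (line i k m)) = 0"
        using that True by (simp add: wave_perps_def wave_perp_def)
      then show ?thesis using cinner_eq_0D by (simp add: cinner_wave line_line line_apply)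
    qed
    then show ?thesis by (rule beu[OF True that(2)])
  next
    case False
    then show ?thesis using that by (simp add: I_def)
  qed
  define D where "D i f = mul i f - proj Q (mul i f)" for i f
  have DS: "D i f \<in> S" for i f
    unfolding S_def D_def by (rule orthocompI) (rule proj_orth[OF Q(1)])
  have D_mul: "cinner x (D j q) = 0 \<Longrightarrow> x \<in> S \<Longrightarrow> cinner x (mul j q) = 0" for x j q
    using orthocompD[OF _ proj_in[OF Q(1)], of x "mul j q"] by (simp add: D_def S_def cinner_diff_right)
  \<comment> \<open>Orthogonality of the defects puts \<open>mul_adj j (D i f)\<close> into
    \<open>S\<close>. This makes \<open>mul_adj j (proj Q (mul i f))\<close> the projection of
    \<open>mul i (mul_adj j f)\<close>, so the outcome is again a defect.\<close>
  have D_adj: "mul_adj j (D i f) = D i (mul_adj j f)" if "f \<in> Q" "i \<noteq> j" for i j f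
  proof -
    have "mul_adj j (D i f) \<in> S"
      unfolding S_def
    proof (rule orthocompI)
      fix q assume "q \<in> Q"
      then have "cinner (D i f) (D j q) = 0"
        using orth that unfolding defect_orthogonal_def D_def by simp
      then show "cinner (mul_adj j (D i f)) q = 0"
        using D_mul[OF _ DS] by (simp add: cinner_push_right[symmetric])
    qed
    then have "proj Q (mul i (mul_adj j f)) = mul_adj j (proj Q (mul i f))"
      using Q(2)[OF proj_in[OF Q(1)], of j "mul i f"]
      by (intro proj_eqI[OF Q(1)])
        (auto simp: D_def S_def pull_diff mul_adj_mul_commute that dest: orthocompD)
    then show ?thesis using that by (simp add: D_def pull_diff mul_adj_mul_commute)
  qed
  have D_slice: "slice i k (D i f) \<in> S1 i" if f: "f \<in> Q" for i k f
  proof -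
    \<comment> \<open>Setting all variables but \<open>z_i\<close> to 0 keeps the element in
      \<open>S\<close> and leaves exactly the slice through the origin.\<close>
    have base: "slice i (\<lambda>_. 0) (D i f) \<in> S1 i" if f: "f \<in> Q" for f
    proof -
      have "cut (UNIV - {i}) (D i f) \<in> S"
        by (rule cut_in_subspace[of S "D i ` Q" "UNIV - {i}"])
          (use S SM DS D_adj Q(2) f in auto)
      moreover have "cut (UNIV - {i}) (D i f) = unslice i (\<lambda>_. 0) (slice i (\<lambda>_. 0) (D i f))"
      proof (rule ell2_eqI)
        fix k
        show "coord (cut (UNIV - {i}) (D i f)) k = coord (unslice i (\<lambda>_. 0) (slice i (\<lambda>_. 0) (D i f))) k"
        proof (cases "\<forall>j\<in>UNIV-{i}. k j = 0")
          case True
          then have k: "line i (\<lambda>_. 0) (k i) = k" by (auto simp: line_def)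
          have "coord (unslice i (\<lambda>_. 0) (slice i (\<lambda>_. 0) (D i f))) (line i (\<lambda>_. 0) (k i)) =
              coord (D i f) (line i (\<lambda>_. 0) (k i))" by simp
          then show ?thesis by (simp only: k coord_cut if_P[OF True])
        next
          case False
          then have "k \<notin> range (line i (\<lambda>_. 0))" by (auto simp: line_def)
          from coord_push_notin[OF inj_line this] show ?thesis
            by (simp only: coord_cut if_not_P[OF False])
        qed
      qed
      ultimately show ?thesis by (simp add: S1_def)
    qed
    \<comment> \<open>Quantified over \<open>f\<close>, because raising \<open>k\<close> in
      direction \<open>j\<close> replaces \<open>f\<close> by \<open>mul_adj j f\<close>. The entry
      at \<open>i\<close> is reset to 0 so that only directions other than \<open>i\<close> are
      used.\<close>
    have "\<forall>f\<in>Q. slice i (k(i := 0)) (D i f) \<in> S1 i"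
    proof (rule multi_index_induct[of "UNIV - {i}" "k(i := 0)"])
      fix k j assume j: "j \<in> UNIV - {i}" and IH: "\<forall>f\<in>Q. slice i k (D i f) \<in> S1 i"
      have "slice i (up j k) (D i f) = slice i k (D i (mul_adj j f))" if "f \<in> Q" for f
      proof -
        have "slice i k (mul_adj j (D i f)) = slice i (up j k) (D i f)"
          using j by (simp add: pull_pull up_line)  
        then show ?thesis using D_adj[OF that] j by auto
      qed
      then show "\<forall>f\<in>Q. slice i (up j k) (D i f) \<in> S1 i" using IH Q(2) by simp
    qed (use base in auto)
    moreover have "line i (k(i := 0)) = line i k" by (auto simp: line_def)
    ultimately show ?thesis using f by simp
  qed
  \<comment> \<open>What \<open>Q\<close> could be missing: \<open>N\<close> is the orthogonal
    complement of \<open>Q\<close> within \<open>?P\<close>, to be shown trivial.\<close>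
  define N where "N = S \<inter> ?P"
  \<comment> \<open>All slices of \<open>g\<close> are orthogonal to \<open>S1 j\<close>, which
    contains the slices of the defects; so \<open>g\<close> is orthogonal to the defects and
    \<open>mul_adj j g\<close> stays in \<open>S\<close>.\<close>
  have N_adj: "mul_adj j g \<in> N" if g: "g \<in> N" for g j
  proof -
    have "cinner g (D j q) = 0" if "q \<in> Q" for q
      by (rule cinner_eq_0D, rule slices_orthogonal[of j])
        (use slice_orth D_slice[OF that] g in \<open>auto simp: N_def\<close>)
    then have "mul_adj j g \<in> S"
      unfolding S_def using g D_mul
      by (intro orthocompI) (simp add: cinner_push_right[symmetric] N_def)
    moreover have "mul_adj j g \<in> ?P"
      using g by (simp add: N_def wave_perps_def mul_adj_wave_perp)
    ultimately show ?thesis by (simp add: N_def)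
  qed
  \<comment> \<open>\<open>cut UNIV\<close> leaves the constant term. If that were nonzero, the
    constant 1 would lie in \<open>S\<close>, hence in \<open>S1 i\<close>, and
    \<open>slice_orth\<close> would annihilate the constant coefficient.\<close>
  have N0: "coord g (\<lambda>_. 0) = 0" if g: "g \<in> N" for g
  proof (rule ccontr)
    assume c: "coord g (\<lambda>_. 0) \<noteq> 0"
    have "cut UNIV g \<in> S"
      by (rule cut_in_subspace[of S N UNIV]) (use S SM N_adj g in \<open>auto simp: N_def\<close>)
    moreover have "delta (\<lambda>_. 0) = cscale (1 / coord g (\<lambda>_. 0)) (cut UNIV g)"
      by (rule ell2_eqI) (use c in \<open>auto simp: coord_delta coord_cut\<close>)
    ultimately have d: "delta (\<lambda>_. 0) \<in> S" using hilbert_subspaceD(4)[OF S] by simp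
    fix i :: 'n
    have "line i (\<lambda>_. 0) 0 = (\<lambda>_. 0)" by (auto simp: line_def)
    then have "delta 0 \<in> S1 i" using d by (simp add: S1_def)
    from slice_orth[OF _ this, of g "\<lambda>_. 0"] g have "cnj (coord g (line i (\<lambda>_. 0) 0)) = 0"
      by (simp add: N_def cinner_delta_left)
    then show False using c \<open>line i (\<lambda>_. 0) 0 = (\<lambda>_. 0)\<close> by simp
  qed
  have N: "g = 0" if "g \<in> N" for g
  proof (rule ell2_eqI)
    fix k
    have "\<forall>g\<in>N. coord g k = 0"
    proof (rule multi_index_induct[of UNIV k])
      fix k j assume IH: "\<forall>g\<in>N. coord g k = 0"
      show "\<forall>g\<in>N. coord g (up j k) = 0"
      proof
        fix g assume "g \<in> N"
        from bspec[OF IH N_adj[OF this]] show "coord g (up j k) = 0" by simp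
      qed
    qed (use N0 in auto)
    then show "coord g k = coord 0 k" using that by simp
  qed
  have "?P \<subseteq> Q"
  proof
    fix x assume x: "x \<in> ?P"
    have "x - proj Q x \<in> ?P" using hilbert_subspaceD(5)[OF P x] proj_in[OF Q(1)] QP by blast
    moreover have "x - proj Q x \<in> S" unfolding S_def using proj_orth[OF Q(1)] by (rule orthocompI)
    ultimately have "x = proj Q x" using N[of "x - proj Q x"] by (simp add: N_def)
    then show "x \<in> Q" by (rule ssubst) (rule proj_in[OF Q(1)])
  qed
  then have eq: "Q = ?P" using QP by blast
  \<comment> \<open>The empty intersection is the whole space, which \<open>Q\<close> is
    not.\<close>
  moreover have "I \<noteq> {}" using ne eq by (auto simp: wave_perps_def)
  ultimately show thesis using that \<theta>(2) by blast
qed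

section \<open>Absolutely convergent trigonometric series\<close>

definition trig :: "(nat \<Rightarrow> complex) \<Rightarrow> real \<Rightarrow> complex" where
  "trig c t = (\<Sum>n. c n * cis (real n * t))"

lemma borel_measurable_lebesgue_on:
  "f \<in> borel_measurable borel \<Longrightarrow> f \<in> borel_measurable (lebesgue_on S)"
  by (intro measurable_restrict_space1 measurable_completion) simp

lemma borel_measurable_cis [measurable]: "(\<lambda>t. cis (a * t)) \<in> borel_measurable borel"
  by (intro borel_measurable_continuous_onI continuous_intros)

lemma borel_measurable_trig [measurable]: "trig c \<in> borel_measurable borel"
  unfolding trig_def[abs_def] by measurable

lemma summable_trig: "summable (\<lambda>n. norm (c n)) \<Longrightarrow> summable (\<lambda>n. c n * cis (real n * t))"
  by (rule summable_norm_cancel) (simp add: norm_mult)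

lemma norm_trig_le:
  assumes "summable (\<lambda>n. norm (c n))" shows "norm (trig c t) \<le> (\<Sum>n. norm (c n))"
  using summable_norm[of "\<lambda>n. c n * cis (real n * t)"] assms by (simp add: trig_def norm_mult)

lemma finite_measure_interval: "finite_measure (lebesgue_on {a..b::real})"
  by (rule finite_measure_lebesgue_on) simp

lemma integrable_bounded:
  fixes f :: "real \<Rightarrow> 'b::{banach, second_countable_topology}"
  assumes "f \<in> borel_measurable borel" "\<And>t. norm (f t) \<le> B"
  shows "integrable (lebesgue_on {a..b}) f"
  by (rule finite_measure.integrable_const_bound[OF finite_measure_interval, of _ B])
    (use assms borel_measurable_lebesgue_on in auto)

lemma integral_trig_mult:
  fixes g :: "real \<Rightarrow> complex"
  assumes c: "summable (\<lambda>n. norm (c n))" and g: "g \<in> borel_measurable borel" "\<And>t. norm (g t) \<le> B"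
  shows "(\<lambda>n. c n * (LINT t|lebesgue_on {a..b}. cis (real n * t) * g t)) sums
    (LINT t|lebesgue_on {a..b}. trig c t * g t)"
proof -
  let ?M = "lebesgue_on {a..b}"
  interpret finite_measure ?M by (rule finite_measure_interval)
  note [measurable] = g(1)
  have B: "norm (cis (real n * t) * g t) \<le> B" for n t using g(2)[of t] by (simp add: norm_mult)
  have int: "integrable ?M (\<lambda>t. c n * (cis (real n * t) * g t))" for n
    by (intro integrable_mult_right integrable_bounded[OF _ B]) measurable
  have nint: "(LINT t|?M. norm (c n * (cis (real n * t) * g t))) \<le> norm (c n) * (B * measure ?M (space ?M))" for n
  proof -
    have "(LINT t|?M. norm (c n * (cis (real n * t) * g t))) \<le> (LINT t|?M. norm (c n) * B)"
      by (intro integral_mono integrable_norm int integrable_const)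
        (use g(2) in \<open>auto simp: norm_mult intro!: mult_left_mono\<close>)
    then show ?thesis by (simp add: mult.commute mult.left_commute)
  qed
  have "(\<lambda>n. LINT t|?M. c n * (cis (real n * t) * g t)) sums (LINT t|?M. (\<Sum>n. c n * (cis (real n * t) * g t)))"
  proof (rule sums_integral[OF int])
    have "summable (\<lambda>n. norm (c n * (cis (real n * t) * g t)))" for t
      using summable_mult2[OF c, of "norm (g t)"] by (simp add: norm_mult)
    then show "AE t in ?M. summable (\<lambda>n. norm (c n * (cis (real n * t) * g t)))" by simp
    show "summable (\<lambda>n. LINT t|?M. norm (c n * (cis (real n * t) * g t)))"
      by (rule summable_comparison_test'[OF summable_mult2[OF c], of 0 _ "B * measure ?M (space ?M)"])
        (use nint in \<open>auto simp: integral_nonneg_AE\<close>)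
  qed
  moreover have "(\<Sum>n. c n * (cis (real n * t) * g t)) = trig c t * g t" for t
    unfolding trig_def mult.assoc[symmetric] by (rule suminf_mult2[OF summable_trig[OF c], symmetric])
  ultimately show ?thesis by simp
qed

lemma integral_cis_interval:
  assumes k: "k \<noteq> 0" and ab: "a \<le> b"
  shows "(LINT t|lebesgue_on {a..b}. cis (of_int k * t)) = (cis (of_int k * b) - cis (of_int k * a)) / (\<i> * of_int k)"
proof -
  define F where "F t = cis (of_int k * t) / (\<i> * of_int k)" for t
  have "((\<lambda>t. cis (of_int k * t)) has_integral (F b - F a)) {a..b}"
  proof (rule fundamental_theorem_of_calculus[OF ab])
    fix t
    have "((\<lambda>z. exp (\<i> * of_int k * z) / (\<i> * of_int k)) has_field_derivative
        exp (\<i> * of_int k * of_real t)) (at (of_real t))"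
      using k by (auto intro!: derivative_eq_intros)
    then have "((\<lambda>t. exp (\<i> * of_int k * of_real t) / (\<i> * of_int k)) has_vector_derivative
        exp (\<i> * of_int k * of_real t)) (at t within {a..b})"
      by (rule has_vector_derivative_real_field)
    then show "(F has_vector_derivative cis (of_int k * t)) (at t within {a..b})"
      by (simp add: F_def[abs_def] cis_conv_exp mult.assoc)
  qed
  moreover have "integrable (lebesgue_on {a..b}) (\<lambda>t. cis (of_int k * t))"
    by (rule integrable_bounded[of _ 1]) auto
  ultimately show ?thesis
    by (simp add: lebesgue_integral_eq_integral integral_unique F_def diff_divide_distrib)
qed

text \<open>The base point \<open>a\<close> is kept free: circle integrals are taken over
  \<open>{0..2 * pi}\<close> for inner functions and over the symmetric interval for the
  kernel.\<close>

lemma integral_cis: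
  "(LINT t|lebesgue_on {a..a + 2 * pi}. cis (of_int k * t)) = (if k = 0 then 2 * pi else 0)"
proof (cases "k = 0")
  case True
  then show ?thesis by (simp add: measure_restrict_space cis.ctr complex_eq_iff)
next
  case False
  have "cis (of_int k * (a + 2 * pi)) = cis (of_int k * a) * cis (2 * pi * of_int k)"
    by (simp add: cis_mult algebra_simps)
  then have "cis (of_int k * (a + 2 * pi)) = cis (of_int k * a)" by simp
  then show ?thesis using False by (simp add: integral_cis_interval)
qed

lemma integral_trig_cis:
  fixes c :: "nat \<Rightarrow> complex"
  assumes c: "summable (\<lambda>n. norm (c n))"
  shows "(LINT t|lebesgue_on {a..a + 2 * pi}. trig c t * cis (of_int m * t)) =
    (if m \<le> 0 then 2 * pi * c (nat (- m)) else 0)"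
proof -
  have "(LINT t|lebesgue_on {a..a + 2 * pi}. cis (real n * t) * cis (of_int m * t)) =
      (if int n = - m then 2 * pi else 0)" for n
  proof -
    have "cis (real n * t) * cis (of_int m * t) = cis (of_int (int n + m) * t)" for t
      by (simp add: cis_mult algebra_simps)
    then show ?thesis by (simp only: integral_cis) auto
  qed
  then have 1: "(\<lambda>n. c n * (if int n = - m then 2 * pi else 0)) sums
      (LINT t|lebesgue_on {a..a + 2 * pi}. trig c t * cis (of_int m * t))"
    using integral_trig_mult[OF c, of "\<lambda>t. cis (of_int m * t)" 1 a "a + 2 * pi"] by simp
  have 2: "(\<lambda>n. c n * (if int n = - m then 2 * pi else 0)) sums (if m \<le> 0 then 2 * pi * c (nat (- m)) else 0)"
  proof (cases "m \<le> 0")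
    case True
    have "(\<lambda>n. c n * (if int n = - m then 2 * pi else 0)) = (\<lambda>n. if n = nat (- m) then 2 * pi * c n else 0)"
      using True by (auto simp: fun_eq_iff)
    then show ?thesis using True sums_single[of "nat (- m)" "\<lambda>n. 2 * pi * c n"] by simp
  next
    case False
    then have "(\<lambda>n. c n * (if int n = - m then 2 * pi else 0)) = (\<lambda>n. 0)" by auto
    then show ?thesis using False by simp
  qed
  show ?thesis by (rule sums_unique2[OF 1 2])
qed

lemma trig_parseval:
  fixes c d :: "nat \<Rightarrow> complex"
  assumes c: "summable (\<lambda>n. norm (c n))" and d: "summable (\<lambda>n. norm (d n))"
  shows "(\<lambda>n. c n * cnj (d n)) sums
    ((LINT t|lebesgue_on {a..a + 2 * pi}. trig c t * cnj (trig d t)) / (2 * pi))"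
proof -
  have "(LINT t|lebesgue_on {a..a + 2 * pi}. cis (real n * t) * cnj (trig d t)) = 2 * pi * cnj (d n)" for n
  proof -
    have "(LINT t|lebesgue_on {a..a + 2 * pi}. cis (real n * t) * cnj (trig d t)) =
        (LINT t|lebesgue_on {a..a + 2 * pi}. cnj (trig d t * cis (of_int (- int n) * t)))"
      by (simp add: cis_cnj mult.commute)
    also have "\<dots> = cnj (2 * pi * d n)"
    proof -
      have "(LINT t|lebesgue_on {a..a + 2 * pi}. trig d t * cis (of_int (- int n) * t)) = 2 * pi * d n"
        by (subst integral_trig_cis[OF d, of a "- int n"]) simp
      then show ?thesis by (simp only: Bochner_Integration.integral_cnj)
    qed
    finally show ?thesis by simp
  qed
  then have "(\<lambda>n. c n * (2 * pi * cnj (d n))) sums (LINT t|lebesgue_on {a..a + 2 * pi}. trig c t * cnj (trig d t))"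
    using integral_trig_mult[OF c, of "\<lambda>t. cnj (trig d t)" "\<Sum>n. norm (d n)" a "a + 2 * pi"] norm_trig_le[OF d]
    by (simp add: borel_measurable_continuous_on[of cnj] continuous_on_cnj)
  from sums_divide[OF this, of "2 * pi"] show ?thesis by (simp add: field_simps)
qed

text \<open>Both series have nonnegative frequencies only, so the mean of the product sees just the
  constant terms. This will remove the analytic half of the kernel.\<close>

lemma integral_trig_trig:
  fixes c d :: "nat \<Rightarrow> complex"
  assumes c: "summable (\<lambda>n. norm (c n))" and d: "summable (\<lambda>n. norm (d n))"
  shows "(LINT t|lebesgue_on {a..a + 2 * pi}. trig c t * trig d t) = 2 * pi * c 0 * d 0"
proof -
  have "(LINT t|lebesgue_on {a..a + 2 * pi}. cis (real n * t) * trig d t) = (if n = 0 then 2 * pi * d 0 else 0)" for n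
    using integral_trig_cis[OF d, of a "int n"] by (simp add: mult.commute)
  then have "(\<lambda>n. c n * (if n = 0 then 2 * pi * d 0 else 0)) sums (LINT t|lebesgue_on {a..a + 2 * pi}. trig c t * trig d t)"
    using integral_trig_mult[OF c borel_measurable_trig norm_trig_le[OF d], of a "a + 2 * pi"] by simp
  moreover have "(\<lambda>n. c n * (if n = 0 then 2 * pi * d 0 else 0)) = (\<lambda>n. if n = 0 then c 0 * (2 * pi * d 0) else 0)"
    by auto
  ultimately have "(\<lambda>n. if n = 0 then c 0 * (2 * pi * d 0) else 0) sums (LINT t|lebesgue_on {a..a + 2 * pi}. trig c t * trig d t)"
    by simp
  from sums_unique2[OF this sums_single[of 0 "\<lambda>_. c 0 * (2 * pi * d 0)"]] show ?thesis by simp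
qed

section \<open>Dilations\<close>

text \<open>The coefficients of \<open>x(r z)\<close>. For \<open>r < 1\<close> they are absolutely
  summable, so every circle integral can be taken of a bounded function.\<close>

definition dil :: "real \<Rightarrow> nat ell2 \<Rightarrow> nat ell2" where
  "dil r x = Ell2 (\<lambda>n. of_real (r ^ n) * coord x n)"

lemma coord_dil [simp]:
  assumes "0 \<le> r" "r \<le> 1" shows "coord (dil r x) n = of_real (r ^ n) * coord x n"
proof -
  have "(\<lambda>n. (norm (of_real (r ^ n) * coord x n))\<^sup>2) summable_on UNIV"
  proof (rule summable_on_comparison_test[OF coord_summable[of x]])
    fix n
    have "norm (of_real (r ^ n) * coord x n) \<le> norm (coord x n)"
      using assms by (simp add: norm_mult norm_power mult_left_le_one_le power_le_one)
    then show "(norm (of_real (r ^ n) * coord x n))\<^sup>2 \<le> (norm (coord x n))\<^sup>2" by (intro power_mono) auto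
  qed simp
  then show ?thesis by (simp add: dil_def)
qed

text \<open>Dominated convergence for series: each factor \<open>r^n - 1\<close> has modulus at most
  1.\<close>

lemma dil_tendsto:
  assumes r: "\<And>j. 0 \<le> r j" "\<And>j. r j \<le> 1" "r \<longlonglongrightarrow> (1::real)"
  shows "(\<lambda>j. dil (r j) x) \<longlonglongrightarrow> x"
proof -
  have sq: "(\<lambda>n. (norm (coord x n))\<^sup>2) sums (norm x)\<^sup>2"
    unfolding norm_ell2_sq using coord_summable by (intro has_sum_imp_sums has_sum_infsum)
  have "(\<lambda>j. \<Sum>n. (norm (coord (dil (r j) x - x) n))\<^sup>2) \<longlonglongrightarrow> (\<Sum>n. 0)"
  proof (rule tannerys_theorem[THEN conjunct2, THEN conjunct2])
    show "(\<lambda>j. (norm (coord (dil (r j) x - x) n))\<^sup>2) \<longlonglongrightarrow> 0" for n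
    proof -
      have "(\<lambda>j. (norm (of_real (r j ^ n) * coord x n - coord x n))\<^sup>2)
          \<longlonglongrightarrow> (norm (of_real (1 ^ n) * coord x n - coord x n))\<^sup>2"
        by (intro tendsto_intros r)
      then show ?thesis using r by simp
    qed
    have "norm ((norm (coord (dil (r j) x - x) n))\<^sup>2) \<le> (norm (coord x n))\<^sup>2" for n j
    proof -
      have "coord (dil (r j) x - x) n = of_real (r j ^ n - 1) * coord x n"
        using r by (simp add: algebra_simps)
      moreover have "\<bar>r j ^ n - 1\<bar> \<le> 1" using r power_le_one[of "r j" n] by simp
      ultimately have "norm (coord (dil (r j) x - x) n) \<le> norm (coord x n)"
        by (simp only: norm_mult norm_of_real) (simp add: mult_left_le_one_le)
      then show ?thesis by (simp add: power_mono)
    qed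
    then show "\<forall>\<^sub>F (n, j) in sequentially \<times>\<^sub>F sequentially.
        norm ((norm (coord (dil (r j) x - x) n))\<^sup>2) \<le> (norm (coord x n))\<^sup>2"
      by (intro always_eventually) auto
    show "summable (\<lambda>n. (norm (coord x n))\<^sup>2)" using sq by (rule sums_summable)
  qed simp
  moreover have "(\<Sum>n. (norm (coord y n))\<^sup>2) = (norm y)\<^sup>2" for y :: "nat ell2"
    unfolding norm_ell2_sq using coord_summable[of y]
    by (intro sums_unique[symmetric] has_sum_imp_sums has_sum_infsum)
  ultimately have "(\<lambda>j. (norm (dil (r j) x - x))\<^sup>2) \<longlonglongrightarrow> 0" by (simp only: suminf_zero)
  from tendsto_real_sqrt[OF this] have "(\<lambda>j. norm (dil (r j) x - x)) \<longlonglongrightarrow> 0" by simp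
  then show ?thesis by (simp add: LIM_zero_iff tendsto_norm_zero_iff)
qed

lemma summable_coord_power:
  assumes "norm z < 1" shows "summable (\<lambda>n. norm (coord x n * z ^ n))"
proof (rule summable_comparison_test')
  show "summable (\<lambda>n. norm x * norm z ^ n)" using assms by (intro summable_mult summable_geometric) simp
  show "norm (norm (coord x n * z ^ n)) \<le> norm x * norm z ^ n" if "n \<ge> 0" for n
    by (simp add: norm_mult norm_power norm_coord_le mult_right_mono)
qed

lemma summable_norm_dil:
  assumes "0 \<le> r" "r < 1" shows "summable (\<lambda>n. norm (coord (dil r x) n))"
  using summable_coord_power[of "of_real r" x] assms by (simp add: norm_mult mult.commute)

lemma trig_dil:
  assumes "0 \<le> r" "r < 1"
  shows "trig (coord (dil r x)) t = (\<Sum>n. coord x n * (of_real r * cis t) ^ n)"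
proof -
  have "coord (dil r x) n * cis (real n * t) = coord x n * (of_real r * cis t) ^ n" for n
    using assms by (simp add: power_mult_distrib Complex.DeMoivre)
  then show ?thesis by (simp add: trig_def)
qed

lemma cinner_sums: "(\<lambda>n. coord x n * cnj (coord y n)) sums cinner x y" for x :: "nat ell2"
  using cinner_has_sum by (rule has_sum_imp_sums)

lemma cinner_trig:
  fixes x y :: "nat ell2"
  assumes "summable (\<lambda>n. norm (coord x n))" "summable (\<lambda>n. norm (coord y n))"
  shows "(LINT t|lebesgue_on {a..a + 2 * pi}. trig (coord x) t * cnj (trig (coord y) t)) = 2 * pi * cinner x y"
  using sums_unique2[OF trig_parseval[OF assms] cinner_sums] by (simp add: field_simps)

lemma norm_trig_integral:
  fixes x :: "nat ell2"
  assumes "summable (\<lambda>n. norm (coord x n))"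
  shows "(LINT t|lebesgue_on {a..a + 2 * pi}. (norm (trig (coord x) t))\<^sup>2) = 2 * pi * (norm x)\<^sup>2"
proof -
  have int: "integrable (lebesgue_on {a..a + 2 * pi}) (\<lambda>t. (norm (trig (coord x) t))\<^sup>2)"
  proof (rule integrable_bounded)
    show "norm ((norm (trig (coord x) t))\<^sup>2) \<le> (\<Sum>n. norm (coord x n))\<^sup>2" for t
      using norm_trig_le[OF assms, of t] by (simp add: power_mono)
  qed measurable
  have "complex_of_real (LINT t|lebesgue_on {a..a + 2 * pi}. (norm (trig (coord x) t))\<^sup>2) =
      (LINT t|lebesgue_on {a..a + 2 * pi}. trig (coord x) t * cnj (trig (coord x) t))"
    by (subst integral_of_real[symmetric]) (simp_all only: complex_norm_square int)
  also have "\<dots> = complex_of_real (2 * pi * (norm x)\<^sup>2)"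
    by (simp add: cinner_trig[OF assms assms] cinner_self_norm)
  finally show ?thesis by (simp only: of_real_eq_iff)
qed

section \<open>Inner functions have inner coefficient sequences\<close>

text \<open>A fixed sequence of radii, since dominated convergence is applied along
  sequences.\<close>

definition rad :: "nat \<Rightarrow> real" where "rad j = 1 - 1 / (real j + 2)"

lemma rad: "0 \<le> rad j" "rad j < 1" "rad \<longlonglongrightarrow> 1" "rad j \<le> 1"
proof -
  show "0 \<le> rad j" "rad j < 1" "rad j \<le> 1" by (simp_all add: rad_def field_simps)
  have "(\<lambda>j. 1 - 1 / (real j + 2)) \<longlonglongrightarrow> 1" by real_asymp
  then show "rad \<longlonglongrightarrow> 1" by (simp add: rad_def[abs_def])
qed

lemma rad_at_left: "filterlim rad (at_left 1) sequentially"
  using rad rad(2)[THEN less_imp_neq] by (auto simp: filterlim_at intro!: always_eventually)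

lemma trig_shift:
  assumes "summable (\<lambda>n. norm (coord x n))"
  shows "summable (\<lambda>n. norm (coord (shift k x) n))"
    and "trig (coord (shift k x)) t = cis (real k * t) * trig (coord x) t"
proof -
  have e: "coord (shift k x) (n + k) = coord x n" for n by (simp add: coord_shift)
  have "summable (\<lambda>n. norm (coord (shift k x) (n + k)))" using assms by (simp add: e)
  then show s: "summable (\<lambda>n. norm (coord (shift k x) n))" by (rule summable_iff_shift[THEN iffD1])
  have "(\<lambda>n. cis (real k * t) * (coord x n * cis (real n * t))) sums (cis (real k * t) * trig (coord x) t)"
    unfolding trig_def by (intro sums_mult summable_sums summable_trig assms)
  moreover have "cis (real k * t) * (coord x n * cis (real n * t)) =
      coord (shift k x) (n + k) * cis (real (n + k) * t)" for n
  proof -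
    have "cis (real (n + k) * t) = cis (real n * t) * cis (real k * t)" by (simp add: cis_mult algebra_simps)
    then show ?thesis by (simp add: e)
  qed
  ultimately have "(\<lambda>n. coord (shift k x) (n + k) * cis (real (n + k) * t)) sums (cis (real k * t) * trig (coord x) t)"
    by simp
  moreover have "(\<Sum>n<k. coord (shift k x) n * cis (real n * t)) = 0"
    by (rule sum.neutral) (simp add: coord_shift)
  ultimately have "(\<lambda>n. coord (shift k x) n * cis (real n * t)) sums (cis (real k * t) * trig (coord x) t)"
    by (subst (asm) sums_iff_shift) simp
  then show "trig (coord (shift k x)) t = cis (real k * t) * trig (coord x) t"
    unfolding trig_def by (rule sums_unique[symmetric])
qed

lemma integrable_norm_sq_trig:
  assumes "summable (\<lambda>n. norm (c n))"
  shows "integrable (lebesgue_on {a..b}) (\<lambda>t. (norm (trig c t))\<^sup>2)"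
proof (rule integrable_bounded)
  show "norm ((norm (trig c t))\<^sup>2) \<le> (\<Sum>n. norm (c n))\<^sup>2" for t
    using norm_trig_le[OF assms, of t] by (simp add: power_mono)
qed measurable

lemma tendsto_shift: "(f \<longlongrightarrow> x) F \<Longrightarrow> ((\<lambda>j. shift k (f j)) \<longlongrightarrow> shift k x) F"
  by (rule bounded_linear.tendsto[OF cblinD(1)[OF cblin_push[OF inj_plus_nat]]])

lemma tendsto_cinner:
  fixes x y :: "'a ell2"
  assumes x: "f \<longlonglongrightarrow> x" and y: "g \<longlonglongrightarrow> y"
  shows "(\<lambda>j. cinner (f j) (g j)) \<longlonglongrightarrow> cinner x y"
proof -
  have "(\<lambda>j. inner (f j) (g j)) \<longlonglongrightarrow> inner x y" by (intro tendsto_intros x y)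
  moreover have "(\<lambda>j. inner (f j) (cscale \<i> (g j))) \<longlonglongrightarrow> inner x (cscale \<i> y)"
    by (intro tendsto_intros x bounded_linear.tendsto[OF bounded_linear_cscale] y)
  ultimately show ?thesis unfolding cinner_Re_i
    by (intro tendsto_add tendsto_mult tendsto_const tendsto_of_real)
qed

lemma inner_function_imp_inner_seq:
  assumes "inner_function \<Theta>"
  obtains \<theta> where "inner_seq \<theta>" "\<And>z. norm z < 1 \<Longrightarrow> (\<lambda>n. coord \<theta> n * z ^ n) sums \<Theta> z"
proof -
  have hol: "\<Theta> holomorphic_on ball 0 1" and bd: "bounded (\<Theta> ` ball 0 1)"
    and ae: "AE t in lebesgue_on {0..2 * pi}.
        \<exists>b. ((\<lambda>r. \<Theta> (of_real r * cis t)) \<longlongrightarrow> b) (at_left 1) \<and> norm b = 1"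
    using assms by (auto simp: inner_function_def)
  obtain B where "\<forall>w\<in>\<Theta> ` ball 0 1. norm w \<le> B" using bd unfolding bounded_iff ..
  then have B: "norm (\<Theta> z) \<le> B" if "norm z < 1" for z using that by simp
  have B0: "0 \<le> B" using order_trans[OF norm_ge_zero B[of 0]] by simp
  define a where "a n = (deriv ^^ n) \<Theta> 0 / fact n" for n
  have sums: "(\<lambda>n. a n * z ^ n) sums \<Theta> z" if "norm z < 1" for z
    using holomorphic_power_series[OF hol, of z] that by (simp add: a_def)
  define c where "c r n = a n * of_real (r ^ n)" for r n
  have summ: "summable (\<lambda>n. norm (c r n))" if r: "0 \<le> r" "r < 1" for r
  proof -
    \<comment> \<open>A radius strictly between \<open>r\<close> and 1: convergence at
      \<open>s\<close> gives absolute convergence at \<open>r\<close>.\<close>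
    define s where "s = (r + 1) / 2"
    have s: "norm (of_real s :: complex) < 1" "norm (of_real r :: complex) < norm (of_real s :: complex)"
      using r by (simp_all add: s_def)
    have "summable (\<lambda>n. norm (a n * of_real r ^ n))"
      by (rule powser_insidea[OF sums_summable[OF sums[OF s(1)]] s(2)])
    then show ?thesis by (simp add: c_def)
  qed
  have nrm: "norm (of_real r * cis t) < 1" if "0 \<le> r" "r < 1" for r t using that by (simp add: norm_mult)
  have trg: "trig (c r) t = \<Theta> (of_real r * cis t)" if r: "0 \<le> r" "r < 1" for r t
  proof -
    have "c r n * cis (real n * t) = a n * (of_real r * cis t) ^ n" for n
      by (simp add: c_def power_mult_distrib Complex.DeMoivre)
    then have "trig (c r) t = (\<Sum>n. a n * (of_real r * cis t) ^ n)" by (simp add: trig_def)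
    also have "\<dots> = \<Theta> (of_real r * cis t)" using sums[OF nrm[OF r]] by (rule sums_unique[symmetric])
    finally show ?thesis .
  qed
  \<comment> \<open>Parseval's identity on the circle of radius \<open>r\<close> bounds the
    coefficients by the bound \<open>B\<close> of the function, uniformly in
    \<open>r\<close>.\<close>
  have fin_r: "(\<Sum>n\<in>F. (norm (c r n))\<^sup>2) \<le> B\<^sup>2" if F: "finite F" and r: "0 \<le> r" "r < 1" for F r
  proof -
    let ?M = "lebesgue_on {0..0 + 2 * pi}"
    interpret finite_measure ?M by (rule finite_measure_interval)
    have "(\<lambda>n. c r n * cnj (c r n)) sums ((LINT t|?M. trig (c r) t * cnj (trig (c r) t)) / (2 * pi))"
      by (rule trig_parseval[OF summ[OF r] summ[OF r]])
    then have "(\<lambda>n. Re (c r n * cnj (c r n))) sums Re ((LINT t|?M. trig (c r) t * cnj (trig (c r) t)) / (2 * pi))"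
      by (rule sums_Re)
    moreover have "Re (z * cnj z) = (norm z)\<^sup>2" for z :: complex
      unfolding complex_norm_square[symmetric] by (rule Re_complex_of_real)
    moreover have "(LINT t|?M. trig (c r) t * cnj (trig (c r) t)) = complex_of_real (LINT t|?M. (norm (trig (c r) t))\<^sup>2)"
      by (subst integral_of_real[symmetric, OF integrable_norm_sq_trig[OF summ[OF r]]])
        (simp only: complex_norm_square)
    ultimately have S: "(\<lambda>n. (norm (c r n))\<^sup>2) sums ((LINT t|?M. (norm (trig (c r) t))\<^sup>2) / (2 * pi))"
      by simp
    have "(LINT t|?M. (norm (trig (c r) t))\<^sup>2) \<le> (LINT t|?M. B\<^sup>2)"
      by (intro integral_mono integrable_norm_sq_trig[OF summ[OF r]] integrable_const)
        (simp add: trg[OF r] B[OF nrm[OF r]] power_mono)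
    also have "\<dots> = 2 * pi * B\<^sup>2" by (simp add: measure_restrict_space)
    finally have "(LINT t|?M. (norm (trig (c r) t))\<^sup>2) / (2 * pi) \<le> B\<^sup>2" by (simp add: field_simps)
    moreover have "(\<Sum>n\<in>F. (norm (c r n))\<^sup>2) \<le> (\<Sum>n. (norm (c r n))\<^sup>2)"
      by (rule sum_le_suminf[OF sums_summable[OF S] F]) simp
    ultimately show ?thesis using sums_unique[OF S] by linarith
  qed
  have fin: "(\<Sum>n\<in>F. (norm (a n))\<^sup>2) \<le> B\<^sup>2" if F: "finite F" for F
  proof (rule LIMSEQ_le_const2)
    have "(\<lambda>j. \<Sum>n\<in>F. (norm (c (rad j) n))\<^sup>2) \<longlonglongrightarrow> (\<Sum>n\<in>F. (norm (a n * of_real (1 ^ n)))\<^sup>2)"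
      unfolding c_def by (intro tendsto_intros rad)
    then show "(\<lambda>j. \<Sum>n\<in>F. (norm (c (rad j) n))\<^sup>2) \<longlonglongrightarrow> (\<Sum>n\<in>F. (norm (a n))\<^sup>2)" by simp
    show "\<exists>N. \<forall>j\<ge>N. (\<Sum>n\<in>F. (norm (c (rad j) n))\<^sup>2) \<le> B\<^sup>2" using fin_r[OF F] rad by blast
  qed
  obtain \<theta> where \<theta>: "coord \<theta> = a" by (rule ell2_bounded[OF fin B0])
  have cr: "coord (dil r \<theta>) = c r" if "0 \<le> r" "r < 1" for r
    using that by (simp add: fun_eq_iff c_def \<theta>)
  \<comment> \<open>For dilations this inner product is a Fourier coefficient of the squared modulus
    of \<open>\<Theta>\<close> on a smaller circle; boundedness lets the limit pass under the
    integral, where the modulus becomes 1.\<close>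
  have key: "cinner (shift k \<theta>) \<theta> = (if k = 0 then 1 else 0)" for k
  proof -
    let ?M = "lebesgue_on {0..0 + 2 * pi}"
    interpret finite_measure ?M by (rule finite_measure_interval)
    define h where "h j t = cis (real k * t) * of_real ((norm (\<Theta> (of_real (rad j) * cis t)))\<^sup>2)" for j t
    have h: "h j t = cis (real k * t) * of_real ((norm (trig (c (rad j)) t))\<^sup>2)" for j t
      by (simp add: h_def trg rad)
    have sj: "summable (\<lambda>n. norm (coord (dil (rad j) \<theta>) n))" for j
      using summ[OF rad(1,2)] by (simp add: cr rad)
    have "(LINT t|?M. h j t) = 2 * pi * cinner (shift k (dil (rad j) \<theta>)) (dil (rad j) \<theta>)" for j
    proof -
      have "(LINT t|?M. h j t) =
          (LINT t|?M. trig (coord (shift k (dil (rad j) \<theta>))) t * cnj (trig (coord (dil (rad j) \<theta>)) t))"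
        by (simp only: trig_shift(2)[OF sj] h cr[OF rad(1,2)] complex_norm_square mult.assoc)
      also have "\<dots> = 2 * pi * cinner (shift k (dil (rad j) \<theta>)) (dil (rad j) \<theta>)"
        by (rule cinner_trig[OF trig_shift(1)[OF sj] sj])
      finally show ?thesis .
    qed
    then have "(\<lambda>j. 2 * pi * cinner (shift k (dil (rad j) \<theta>)) (dil (rad j) \<theta>)) = (\<lambda>j. LINT t|?M. h j t)"
      by simp
    moreover have "(\<lambda>j. LINT t|?M. h j t) \<longlonglongrightarrow> (LINT t|?M. cis (real k * t))"
    proof (rule integral_dominated_convergence)
      show "(\<lambda>t. cis (real k * t)) \<in> borel_measurable ?M"
        by (rule borel_measurable_lebesgue_on) measurable
      show "h j \<in> borel_measurable ?M" for j
        unfolding h[abs_def] by (rule borel_measurable_lebesgue_on) measurable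
      show "integrable ?M (\<lambda>_. B\<^sup>2)" by (rule integrable_const)
      show "AE t in ?M. norm (h j t) \<le> B\<^sup>2" for j
      proof (rule AE_I2)
        fix t
        have "norm (h j t) = (norm (\<Theta> (of_real (rad j) * cis t)))\<^sup>2"
          by (simp add: h_def norm_mult norm_power)
        also have "\<dots> \<le> B\<^sup>2" by (intro power_mono B nrm rad) simp
        finally show "norm (h j t) \<le> B\<^sup>2" .
      qed
      show "AE t in ?M. (\<lambda>j. h j t) \<longlonglongrightarrow> cis (real k * t)"
        using ae unfolding add_0
      proof eventually_elim
        case (elim t)
        then obtain b where b: "((\<lambda>r. \<Theta> (of_real r * cis t)) \<longlongrightarrow> b) (at_left 1)" "norm b = 1" by blast
        have "(\<lambda>j. \<Theta> (of_real (rad j) * cis t)) \<longlonglongrightarrow> b"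
          by (rule filterlim_compose[OF b(1) rad_at_left])
        then have "(\<lambda>j. h j t) \<longlonglongrightarrow> cis (real k * t) * of_real ((norm b)\<^sup>2)"
          unfolding h_def by (intro tendsto_intros)
        then show ?case using b(2) by simp
      qed
    qed
    moreover have "(LINT t|?M. cis (real k * t)) = (if k = 0 then 2 * pi else 0)"
      using integral_cis[of 0 "int k"] by simp
    moreover have "(\<lambda>j. 2 * pi * cinner (shift k (dil (rad j) \<theta>)) (dil (rad j) \<theta>)) \<longlonglongrightarrow> 2 * pi * cinner (shift k \<theta>) \<theta>"
      by (intro tendsto_intros tendsto_cinner tendsto_shift dil_tendsto rad)
    ultimately have "2 * pi * cinner (shift k \<theta>) \<theta> = (if k = 0 then 2 * pi else 0)"
      by (metis LIMSEQ_unique)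
    then show ?thesis by (simp split: if_splits)
  qed
  have "norm \<theta> = 1" using key[of 0] by (intro norm_eq_1_cinner) simp
  then have "inner_seq \<theta>" using key by (intro inner_seqI) auto
  then show thesis using that[of \<theta>] sums \<theta> by simp
qed

section \<open>Boundary values\<close>

lemma szego_kernel:
  assumes z: "norm (z::complex) < 1"
  obtains \<kappa> where "coord \<kappa> = (\<lambda>n. cnj z ^ n)"
proof -
  have "(\<lambda>n. (norm (cnj z ^ n))\<^sup>2) summable_on UNIV"
  proof (rule summable_nonneg_imp_summable_on)
    have "norm ((norm z)\<^sup>2) < 1" using z by (simp add: abs_square_less_1)
    from summable_geometric[OF this] show "summable (\<lambda>n. (norm (cnj z ^ n))\<^sup>2)"
      by (simp add: norm_power power_mult[symmetric] mult.commute)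
  qed simp
  then show thesis using that coord_Ell2 by metis
qed

text \<open>The kernel \<open>\<kappa>\<close> at \<open>z\<close> is an eigenvector of the adjoint
  of multiplication by \<open>\<theta>\<close>: pairing \<open>conv \<theta> \<kappa>\<close> with
  \<open>\<kappa>\<close> gives the value at \<open>z\<close> times the squared norm of
  \<open>\<kappa>\<close>. As the multiplication is isometric, Cauchy-Schwarz bounds the value by
  1.\<close>

lemma inner_seq_le_1:
  assumes \<theta>: "inner_seq \<theta>" and z: "norm z < 1"
  shows "norm (\<Sum>n. coord \<theta> n * z ^ n) \<le> 1"
proof -
  obtain \<kappa> where \<kappa>: "coord \<kappa> = (\<lambda>n. cnj z ^ n)" by (rule szego_kernel[OF z])
  have ev: "cinner x \<kappa> = (\<Sum>n. coord x n * z ^ n)" for x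
    using sums_unique[OF cinner_sums[of x \<kappa>]] by (simp add: \<kappa>)
  note o = \<theta>[unfolded inner_seq_def]
  define v where "v = (\<Sum>n. coord \<theta> n * z ^ n)"
  have sh: "cinner (shift k \<theta>) \<kappa> = v * z ^ k" for k
  proof -
    have "pull ((+) k) \<kappa> = cscale (cnj z ^ k) \<kappa>"
      by (rule ell2_eqI) (simp add: \<kappa> power_add)
    then have "cinner (shift k \<theta>) \<kappa> = z ^ k * cinner \<theta> \<kappa>" by (simp add: cinner_push_left)
    then show ?thesis by (simp add: ev v_def)
  qed
  have "cinner (conv \<theta> \<kappa>) \<kappa> = v * cinner \<kappa> \<kappa>"
  proof -
    have "(\<lambda>k. coord \<kappa> k * cinner (shift k \<theta>) \<kappa>) sums cinner (conv \<theta> \<kappa>) \<kappa>"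
      unfolding conv_def by (rule has_sum_imp_sums[OF ortho_ext_cinner_left[OF o]])
    moreover have "(\<lambda>k. v * (coord \<kappa> k * cnj (coord \<kappa> k))) sums (v * cinner \<kappa> \<kappa>)"
      by (intro sums_mult cinner_sums)
    ultimately show ?thesis
      by (intro sums_unique2[of "\<lambda>k. coord \<kappa> k * cinner (shift k \<theta>) \<kappa>"]) (simp_all add: sh \<kappa> mult_ac)
  qed
  then have "norm v * (norm \<kappa>)\<^sup>2 = norm (cinner (conv \<theta> \<kappa>) \<kappa>)"
    by (simp add: norm_mult cinner_self_norm norm_power)
  also have "\<dots> \<le> norm (conv \<theta> \<kappa>) * norm \<kappa>" by (rule Cauchy_Schwarz_cinner)
  also have "\<dots> = (norm \<kappa>)\<^sup>2" by (simp add: conv_def norm_ortho_ext[OF o] power2_eq_square)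
  finally have "norm v * (norm \<kappa>)\<^sup>2 \<le> 1 * (norm \<kappa>)\<^sup>2" by simp
  moreover have "(norm \<kappa>)\<^sup>2 > 0"
  proof -
    have "1 \<le> norm \<kappa>" using norm_coord_le[of \<kappa> 0] by (simp add: \<kappa>)
    then show ?thesis by (intro zero_less_power) linarith
  qed
  ultimately show ?thesis unfolding v_def by (rule mult_right_le_imp_le)
qed

text \<open>Dilations converge in mean, which gives pointwise convergence only along a subsequence;
  this is enough to define the boundary function \<open>g\<close>. Having modulus at most 1 and mean
  square 1, it is unimodular almost everywhere.\<close>

lemma inner_seq_boundary_function:
  assumes \<theta>: "inner_seq \<theta>"
  obtains g \<rho> where "g \<in> borel_measurable (lebesgue_on {0..2 * pi})"
    "\<And>j. 0 \<le> \<rho> j" "\<And>j. \<rho> j < (1::real)" "\<rho> \<longlonglongrightarrow> 1"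
    "AE t in lebesgue_on {0..2 * pi}. (\<lambda>j. trig (coord (dil (\<rho> j) \<theta>)) t) \<longlonglongrightarrow> g t"
    "AE t in lebesgue_on {0..2 * pi}. norm (g t) = 1"
proof -
  let ?M = "lebesgue_on {0..2 * pi}"
  interpret finite_measure ?M by (rule finite_measure_interval)
  define s where "s j = trig (coord (dil (rad j) \<theta>))" for j
  have sd: "summable (\<lambda>n. norm (coord (dil (rad j) \<theta>) n))" for j by (rule summable_norm_dil) (rule rad)+
  have s_bd: "norm (s j t) \<le> 1" for j t
    unfolding s_def trig_dil[OF rad(1,2)]
    by (rule inner_seq_le_1[OF \<theta>]) (simp add: norm_mult rad)
  have s_meas: "s j \<in> borel_measurable borel" for j unfolding s_def by measurable
  have s_int: "integrable ?M (s j)" for j by (rule integrable_bounded[OF s_meas s_bd])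
  have cau: "\<exists>N. \<forall>i\<ge>N. \<forall>j\<ge>N. (LINT t|?M. norm (s i t - s j t)) < e" if e: "e > 0" for e
  proof -
    define \<eta> where "\<eta> = e / (2 * pi)"
    have \<eta>: "\<eta> > 0" using e by (simp add: \<eta>_def)
    have "Cauchy (\<lambda>j. dil (rad j) \<theta>)"
      by (rule LIMSEQ_imp_Cauchy[OF dil_tendsto]) (rule rad)+
    then obtain N where N: "\<And>i j. i \<ge> N \<Longrightarrow> j \<ge> N \<Longrightarrow> dist (dil (rad i) \<theta>) (dil (rad j) \<theta>) < \<eta>"
      using \<eta> unfolding Cauchy_def by meson
    have "(LINT t|?M. norm (s i t - s j t)) < e" if ij: "i \<ge> N" "j \<ge> N" for i j
    proof -
      define x where "x = dil (rad i) \<theta> - dil (rad j) \<theta>"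
      have sx: "summable (\<lambda>n. norm (coord x n))"
        by (rule summable_comparison_test'[OF summable_add[OF sd[of i] sd[of j]], of 0])
          (simp add: x_def norm_triangle_ineq4)
      have d: "s i t - s j t = trig (coord x) t" for t
      proof -
        have "(\<lambda>n. coord (dil (rad i) \<theta>) n * cis (real n * t) - coord (dil (rad j) \<theta>) n * cis (real n * t))
            sums (s i t - s j t)"
          unfolding s_def trig_def by (intro sums_diff summable_sums summable_trig sd)
        then show ?thesis unfolding trig_def by (simp add: x_def left_diff_distrib sums_iff)
      qed
      have nx: "norm x < \<eta>" using N[OF ij] by (simp add: x_def dist_norm)
      have i2: "integrable ?M (\<lambda>t. (norm (trig (coord x) t))\<^sup>2)" by (rule integrable_norm_sq_trig[OF sx])
      \<comment> \<open>The inequality \<open>u \<le> \<eta>/2 + u^2/(2 \<eta>)\<close> takes the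
        place of Cauchy-Schwarz in passing from mean square to mean; integrated over length
        \<open>2 pi\<close> with \<open>norm x < \<eta>\<close> it stays below
        \<open>2 pi \<eta> = e\<close>.\<close>
      have "(LINT t|?M. norm (s i t - s j t)) \<le> (LINT t|?M. \<eta> / 2 + (norm (trig (coord x) t))\<^sup>2 / (2 * \<eta>))"
      proof (intro integral_mono)
        fix t
        define u where "u = norm (trig (coord x) t)"
        have "0 \<le> (u - \<eta>)\<^sup>2 / (2 * \<eta>)" using \<eta> by simp
        also have "\<dots> = \<eta> / 2 + u\<^sup>2 / (2 * \<eta>) - u" using \<eta> by (simp add: power2_eq_square field_simps)
        finally show "norm (s i t - s j t) \<le> \<eta> / 2 + (norm (trig (coord x) t))\<^sup>2 / (2 * \<eta>)"
          unfolding d u_def by simp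
      qed (use s_int i2 in simp_all)
      also have "\<dots> = pi * \<eta> + pi * ((norm x)\<^sup>2 / \<eta>)"
        using i2 norm_trig_integral[OF sx, of 0] \<eta> by (simp add: measure_restrict_space field_simps)
      also have "\<dots> < pi * \<eta> + pi * \<eta>"
      proof -
        have "(norm x)\<^sup>2 < \<eta>\<^sup>2" using nx by (intro power_strict_mono) auto
        then have "(norm x)\<^sup>2 / \<eta> < \<eta>" using \<eta> by (simp add: power2_eq_square field_simps)
        then show ?thesis by (intro add_strict_left_mono mult_strict_left_mono) auto
      qed
      also have "\<dots> = e" by (simp add: \<eta>_def)
      finally show ?thesis .
    qed
    then show ?thesis by blast
  qed
  obtain q where q: "strict_mono q" "AE t in ?M. Cauchy (\<lambda>j. s (q j) t)"
    by (rule cauchy_L1_AE_cauchy_subseq[OF s_int cau])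
  define g where "g t = lim (\<lambda>j. s (q j) t)" for t
  have g_meas: "g \<in> borel_measurable ?M"
    unfolding g_def[abs_def] by (intro borel_measurable_lim_metric borel_measurable_lebesgue_on s_meas)
  have conv: "AE t in ?M. (\<lambda>j. s (q j) t) \<longlonglongrightarrow> g t"
    using q(2) by eventually_elim (simp add: g_def Cauchy_convergent_iff convergent_LIMSEQ_iff)
  have g_bd: "AE t in ?M. norm (g t) \<le> 1"
    using conv by eventually_elim (rule LIMSEQ_le_const2[OF tendsto_norm], use s_bd in auto)
  have rq: "(\<lambda>j. rad (q j)) \<longlonglongrightarrow> 1" using LIMSEQ_subseq_LIMSEQ[OF rad(3) q(1)] by (simp add: o_def)
  have "(\<lambda>j. LINT t|?M. (norm (s (q j) t))\<^sup>2) \<longlonglongrightarrow> (LINT t|?M. (norm (g t))\<^sup>2)"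
  proof (rule integral_dominated_convergence[of _ _ _ "\<lambda>_. 1"])
    show "(\<lambda>t. (norm (g t))\<^sup>2) \<in> borel_measurable ?M" using g_meas by measurable
    show "(\<lambda>t. (norm (s (q j) t))\<^sup>2) \<in> borel_measurable ?M" for j
      using borel_measurable_lebesgue_on[OF s_meas] by measurable
    show "AE t in ?M. (\<lambda>j. (norm (s (q j) t))\<^sup>2) \<longlonglongrightarrow> (norm (g t))\<^sup>2"
      using conv by eventually_elim (intro tendsto_intros)
    show "AE t in ?M. norm ((norm (s (q j) t))\<^sup>2) \<le> 1" for j
      using s_bd by (auto simp: power_le_one)
  qed (rule integrable_const)
  moreover have "(LINT t|?M. (norm (s (q j) t))\<^sup>2) = 2 * pi * (norm (dil (rad (q j)) \<theta>))\<^sup>2" for j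
    using norm_trig_integral[OF sd, of 0] by (simp add: s_def)
  moreover have "(\<lambda>j. 2 * pi * (norm (dil (rad (q j)) \<theta>))\<^sup>2) \<longlonglongrightarrow> 2 * pi * (norm \<theta>)\<^sup>2"
    by (intro tendsto_intros dil_tendsto rad rq)
  moreover have "norm \<theta> = 1" using orthonormal_norm[OF \<theta>[unfolded inner_seq_def], of 0] by simp
  ultimately have g2: "(LINT t|?M. (norm (g t))\<^sup>2) = 2 * pi" using LIMSEQ_unique by fastforce
  have g2_int: "integrable ?M (\<lambda>t. (norm (g t))\<^sup>2)"
  proof (rule integrable_const_bound[of _ 1])
    show "AE t in ?M. norm ((norm (g t))\<^sup>2) \<le> 1" using g_bd by eventually_elim (simp add: power_le_one)
    show "(\<lambda>t. (norm (g t))\<^sup>2) \<in> borel_measurable ?M" using g_meas by measurable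
  qed
  have "(LINT t|?M. 1 - (norm (g t))\<^sup>2) = 0"
    using g2 g2_int by (simp add: measure_restrict_space)
  moreover have "AE t in ?M. 0 \<le> 1 - (norm (g t))\<^sup>2"
    using g_bd by eventually_elim (simp add: power_le_one)
  ultimately have "AE t in ?M. 1 - (norm (g t))\<^sup>2 = 0"
    using g2_int by (subst (asm) integral_nonneg_eq_0_iff_AE) auto
  then have "AE t in ?M. norm (g t) = 1"
    by eventually_elim (metis eq_iff_diff_eq_0 norm_ge_zero one_power2 power2_eq_iff_nonneg zero_le_one)
  then show thesis
    using that[OF g_meas, of "\<lambda>j. rad (q j)"] rad rq conv by (simp add: s_def)
qed

section \<open>Radial limits\<close>

text \<open>Minus the derivative in \<open>s\<close> of the Poisson kernel
  \<open>(1 - r^2) / (1 - 2 r cos s + r^2)\<close>.\<close>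

definition pder :: "real \<Rightarrow> real \<Rightarrow> real" where
  "pder r s = 2 * r * (1 - r\<^sup>2) * sin s / (1 - 2 * r * cos s + r\<^sup>2)\<^sup>2"

text \<open>Coefficients of the analytic half of \<open>pder\<close>, whose Fourier series has the
  terms \<open>2 n r^n sin (n s)\<close>.\<close>

definition pcoef :: "real \<Rightarrow> nat \<Rightarrow> complex" where "pcoef r n = - \<i> * of_nat n * of_real r ^ n"

context
  fixes r :: real assumes r: "0 \<le> r" "r < 1"
begin

lemma pcoef_sums: "(\<lambda>n. of_nat n * (of_real r * cis s) ^ n) sums (of_real r * cis s / (1 - of_real r * cis s)\<^sup>2)"
proof -
  define z where "z = of_real r * cis s"
  have "norm z < 1" using r by (simp add: z_def norm_mult)
  then have "(\<lambda>n. z * (of_nat (Suc n) * z ^ n)) sums (z * (1 / (1 - z)\<^sup>2))"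
    by (intro sums_mult geometric_deriv_sums)
  then have "(\<lambda>n. of_nat (Suc n) * z ^ Suc n) sums (z / (1 - z)\<^sup>2)" by (simp add: mult_ac)
  then show ?thesis by (subst (asm) sums_Suc_iff) (simp add: z_def)
qed

lemma summable_pcoef: "summable (\<lambda>n. norm (pcoef r n))"
proof -
  have "summable (\<lambda>n. real (Suc n) * r ^ n)"
    using geometric_deriv_sums[of r] r by (simp add: sums_iff)
  then have "summable (\<lambda>n. r * (real (Suc n) * r ^ n))" by (rule summable_mult)
  then have "summable (\<lambda>n. real (Suc n) * r ^ Suc n)" by (simp add: mult_ac)
  then have "summable (\<lambda>n. real n * r ^ n)" by (subst (asm) summable_Suc_iff)
  then show ?thesis using r by (simp add: pcoef_def norm_mult norm_power)
qed

lemma pder_denominator: "(norm (1 - of_real r * cis s))\<^sup>2 = 1 - 2 * r * cos s + r\<^sup>2"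
proof -
  have "(norm (1 - of_real r * cis s))\<^sup>2 = (1 - r * cos s)\<^sup>2 + (r * sin s)\<^sup>2"
    by (simp add: cmod_power2)
  also have "\<dots> = 1 - 2 * r * cos s + r\<^sup>2 * ((sin s)\<^sup>2 + (cos s)\<^sup>2)"
    by algebra
  finally show ?thesis by simp
qed

lemma trig_pcoef: "trig (pcoef r) s + cnj (trig (pcoef r) s) = of_real (pder r s)"
proof -
  define z where "z = of_real r * cis s"
  have "(\<lambda>n. - \<i> * (of_nat n * z ^ n)) sums (- \<i> * (z / (1 - z)\<^sup>2))"
    unfolding z_def by (intro sums_mult pcoef_sums)
  moreover have "- \<i> * (of_nat n * z ^ n) = pcoef r n * cis (real n * s)" for n
    by (simp add: z_def pcoef_def power_mult_distrib Complex.DeMoivre)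
  ultimately have "trig (pcoef r) s = - \<i> * (z / (1 - z)\<^sup>2)"
    unfolding trig_def by (simp add: sums_iff)
  moreover have "z / (1 - z)\<^sup>2 = z * cnj ((1 - z)\<^sup>2) / of_real ((norm ((1 - z)\<^sup>2))\<^sup>2)"
    using complex_div_cnj[of z "(1 - z)\<^sup>2"] by simp
  moreover have "norm ((1 - z)\<^sup>2) = 1 - 2 * r * cos s + r\<^sup>2"
    unfolding norm_power z_def by (rule pder_denominator)
  moreover have "Im (z * cnj ((1 - z)\<^sup>2)) = r * (1 - r\<^sup>2) * sin s"
  proof -
    have "z * cnj ((1 - z)\<^sup>2) = z - 2 * (z * cnj z) + (z * cnj z) * cnj z"
      by (simp add: power2_eq_square algebra_simps)
    moreover have "z * cnj z = of_real (r\<^sup>2)"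
      unfolding complex_norm_square[symmetric] using r by (simp add: z_def norm_mult)
    ultimately have "Im (z * cnj ((1 - z)\<^sup>2)) = Im z - r\<^sup>2 * Im z" by simp
    then show ?thesis by (simp add: z_def algebra_simps)
  qed
  ultimately have "Re (trig (pcoef r) s) = r * (1 - r\<^sup>2) * sin s / (1 - 2 * r * cos s + r\<^sup>2)\<^sup>2"
    by (simp add: Im_divide_of_real)
  then show ?thesis by (simp add: complex_add_cnj pder_def)
qed

text \<open>The kernel is an analytic series without constant term plus its conjugate. The former
  integrates to 0 against \<open>trig d\<close>, the latter is a Parseval pairing. The result is the
  angular derivative, at angle 0 and radius \<open>r\<close>, of the power series with coefficients
  \<open>d\<close>.\<close>

lemma integral_pder_trig:
  assumes d: "summable (\<lambda>n. norm (d n))"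
  shows "(\<lambda>n. \<i> * of_nat n * of_real r ^ n * d n) sums
    ((LINT s|lebesgue_on {- pi..- pi + 2 * pi}. of_real (pder r s) * trig d s) / (2 * pi))"
    and "integrable (lebesgue_on {- pi..- pi + 2 * pi}) (\<lambda>s. of_real (pder r s) * trig d s)"
proof -
  let ?M = "lebesgue_on {- pi..- pi + 2 * pi}"
  let ?A = "trig (pcoef r)"
  have e: "of_real (pder r s) * trig d s = ?A s * trig d s + trig d s * cnj (?A s)" for s
    unfolding trig_pcoef[symmetric] by (simp add: algebra_simps)
  define S where "S = (\<Sum>n. norm (pcoef r n)) * (\<Sum>n. norm (d n))"
  have bd: "norm (?A s * trig d s) \<le> S" "norm (trig d s * cnj (?A s)) \<le> S" for s
    using norm_trig_le[OF summable_pcoef, of s] norm_trig_le[OF d, of s]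
      suminf_nonneg[OF summable_pcoef] suminf_nonneg[OF d]
    by (auto simp: S_def norm_mult mult.commute intro!: mult_mono)
  have meas: "(\<lambda>s. ?A s * trig d s) \<in> borel_measurable borel" "(\<lambda>s. trig d s * cnj (?A s)) \<in> borel_measurable borel"
    by (measurable, simp add: borel_measurable_continuous_on[of cnj] continuous_on_cnj)
  note int = integrable_bounded[OF meas(1) bd(1)] integrable_bounded[OF meas(2) bd(2)]
  show "integrable ?M (\<lambda>s. of_real (pder r s) * trig d s)" unfolding e using int by simp
  have "(LINT s|?M. of_real (pder r s) * trig d s) = (LINT s|?M. trig d s * cnj (?A s))"
  proof -
    have "pcoef r 0 = 0" by (simp add: pcoef_def)
    then show ?thesis
      unfolding e using int integral_trig_trig[OF summable_pcoef d, of "- pi"] by simp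
  qed
  then have "(\<lambda>n. d n * cnj (pcoef r n)) sums ((LINT s|?M. of_real (pder r s) * trig d s) / (2 * pi))"
    using trig_parseval[OF d summable_pcoef, of "- pi"] by simp
  moreover have "d n * cnj (pcoef r n) = \<i> * of_nat n * of_real r ^ n * d n" for n
    by (simp add: pcoef_def)
  ultimately show "(\<lambda>n. \<i> * of_nat n * of_real r ^ n * d n) sums ((LINT s|?M. of_real (pder r s) * trig d s) / (2 * pi))"
    by simp
qed

text \<open>A single frequency; the cases \<open>k = 0\<close> and \<open>k = 1\<close> give the
  integrals of the kernel against 1 and against \<open>sin\<close>.\<close>

lemma integral_pder_single:
  "(LINT s|lebesgue_on {- pi..- pi + 2 * pi}. of_real (pder r s) * cis (real k * s)) = 2 * pi * \<i> * of_nat k * of_real r ^ k"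
  "integrable (lebesgue_on {- pi..- pi + 2 * pi}) (\<lambda>s. of_real (pder r s) * cis (real k * s))"
proof -
  let ?M = "lebesgue_on {- pi..- pi + 2 * pi}"
  define d :: "nat \<Rightarrow> complex" where "d n = (if n = k then 1 else 0)" for n
  have d: "summable (\<lambda>n. norm (d n))" by (rule summable_finite[of "{k}"]) (auto simp: d_def)
  have "(\<lambda>n. if n = k then cis (real n * s) else 0) sums cis (real k * s)" for s by (rule sums_single)
  then have t: "trig d s = cis (real k * s)" for s
    unfolding trig_def d_def by (simp add: sums_iff if_distrib[of "\<lambda>x. x * _"] cong: if_cong)
  show "integrable ?M (\<lambda>s. of_real (pder r s) * cis (real k * s))"
    using integral_pder_trig(2)[OF d] by (simp add: t)
  have "(\<lambda>n. if n = k then \<i> * of_nat n * of_real r ^ n else 0) sums (\<i> * of_nat k * of_real r ^ k)"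
    by (rule sums_single)
  moreover have "(\<lambda>n. \<i> * of_nat n * of_real r ^ n * d n) = (\<lambda>n. if n = k then \<i> * of_nat n * of_real r ^ n else 0)"
    by (auto simp: d_def)
  ultimately have "(LINT s|?M. of_real (pder r s) * cis (real k * s)) / (2 * pi) = \<i> * of_nat k * of_real r ^ k"
    using integral_pder_trig(1)[OF d] sums_unique2 by (simp add: t) blast
  then show "(LINT s|?M. of_real (pder r s) * cis (real k * s)) = 2 * pi * \<i> * of_nat k * of_real r ^ k"
    by (simp add: field_simps)
qed

lemma integral_pder_sin:
  "(LINT s|lebesgue_on {- pi..- pi + 2 * pi}. pder r s * sin s) = 2 * pi * r"
  "integrable (lebesgue_on {- pi..- pi + 2 * pi}) (\<lambda>s. pder r s * sin s)"
proof -
  let ?M = "lebesgue_on {- pi..- pi + 2 * pi}"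
  note int = integral_pder_single(2)[of 1]
  have e: "pder r s * sin s = Im (of_real (pder r s) * cis (real 1 * s))" for s by simp
  show "integrable ?M (\<lambda>s. pder r s * sin s)" unfolding e using int by (rule integrable_Im)
  have "(LINT s|?M. pder r s * sin s) = Im (LINT s|?M. of_real (pder r s) * cis (real 1 * s))"
    unfolding e by (rule integral_Im[OF int])
  then show "(LINT s|?M. pder r s * sin s) = 2 * pi * r" by (simp add: integral_pder_single(1)[of 1, simplified])
qed

lemma pder_sin_nonneg: "\<bar>pder r s\<bar> * \<bar>sin s\<bar> = pder r s * sin s"
proof -
  have "r\<^sup>2 \<le> 1" using r by (simp add: power_le_one)
  then have "pder r s * sin s = 2 * r * (1 - r\<^sup>2) * (sin s)\<^sup>2 / (1 - 2 * r * cos s + r\<^sup>2)\<^sup>2"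
    and "0 \<le> 2 * r * (1 - r\<^sup>2) * (sin s)\<^sup>2 / (1 - 2 * r * cos s + r\<^sup>2)\<^sup>2"
    using r by (simp_all add: pder_def power2_eq_square)
  then have "0 \<le> pder r s * sin s" by (simp only:)
  then show ?thesis by (simp only: abs_mult[symmetric] abs_of_nonneg)
qed

text \<open>Since \<open>1 - 2 r cos \<delta> + r^2 = (r - cos \<delta>)^2 + (sin
  \<delta>)^2\<close>, the quadratic in the denominator is at least \<open>(sin \<delta>)^2\<close>
  away from 0. The factor \<open>1 - r^2\<close> of the numerator then makes the kernel vanish
  uniformly there as \<open>r\<close> tends to 1.\<close>

lemma pder_away:
  assumes \<delta>: "0 < \<delta>" "\<delta> \<le> pi / 2" and s: "\<delta> \<le> \<bar>s\<bar>" "\<bar>s\<bar> \<le> pi"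
  shows "\<bar>pder r s\<bar> \<le> 2 * (1 - r\<^sup>2) / (sin \<delta>) ^ 4"
proof -
  have sd: "0 < sin \<delta>" using \<delta> by (intro sin_gt_zero) (use pi_gt_zero in linarith)+
  have "cos \<bar>s\<bar> \<le> cos \<delta>" using \<delta> s by (intro cos_monotone_0_pi_le) auto
  then have "cos s \<le> cos \<delta>" by (simp add: abs_if split: if_splits)
  then have "1 - 2 * r * cos \<delta> + r\<^sup>2 \<le> 1 - 2 * r * cos s + r\<^sup>2" using r by (simp add: mult_left_mono)
  moreover have "1 - 2 * r * cos \<delta> + r\<^sup>2 = (r - cos \<delta>)\<^sup>2 + (sin \<delta>)\<^sup>2"
    by (simp add: sin_squared_eq power2_eq_square algebra_simps)
  moreover have "0 \<le> (r - cos \<delta>)\<^sup>2" by simp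
  ultimately have D: "(sin \<delta>)\<^sup>2 \<le> 1 - 2 * r * cos s + r\<^sup>2" by linarith
  then have D2: "((sin \<delta>)\<^sup>2)\<^sup>2 \<le> (1 - 2 * r * cos s + r\<^sup>2)\<^sup>2" by (rule power_mono) simp
  have r2: "0 \<le> 1 - r\<^sup>2" using r by (simp add: power_le_one)
  have "\<bar>2 * r * (1 - r\<^sup>2) * sin s\<bar> = r * \<bar>sin s\<bar> * (2 * (1 - r\<^sup>2))"
    using r r2 by (simp add: abs_mult)
  also have "\<dots> \<le> 1 * (2 * (1 - r\<^sup>2))"
    using r r2 abs_sin_le_one[of s] by (intro mult_right_mono mult_le_one) auto
  finally have N: "\<bar>2 * r * (1 - r\<^sup>2) * sin s\<bar> \<le> 2 * (1 - r\<^sup>2)" by simp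
  have "\<bar>pder r s\<bar> = \<bar>2 * r * (1 - r\<^sup>2) * sin s\<bar> / (1 - 2 * r * cos s + r\<^sup>2)\<^sup>2"
    by (simp add: pder_def)
  also have "\<dots> \<le> 2 * (1 - r\<^sup>2) / ((sin \<delta>)\<^sup>2)\<^sup>2"
    using N D2 sd r2 by (intro frac_le) auto
  also have "((sin \<delta>)\<^sup>2)\<^sup>2 = (sin \<delta>) ^ 4" by (simp flip: power_mult)
  finally show ?thesis .
qed

end

lemma sin_near_0:
  assumes "0 < (e::real)" obtains \<delta> where "0 < \<delta>" "\<And>s::real. \<bar>s\<bar> < \<delta> \<Longrightarrow> \<bar>sin s - s\<bar> \<le> e * \<bar>s\<bar>"
proof -
  have "(sin has_derivative (*) 1) (at (0::real))"
    using DERIV_sin[of 0] by (simp add: has_field_derivative_def)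
  then obtain \<delta> where "\<delta> > 0" "\<And>y::real. norm (y - 0) < \<delta> \<Longrightarrow> norm (sin y - sin 0 - 1 * (y - 0)) \<le> e * norm (y - 0)"
    unfolding has_derivative_at_alt using assms by blast
  then show thesis using that[of \<delta>] by simp
qed

text \<open>The angular derivative of a Poisson integral is the integral against the derivative of the
  Poisson kernel, which is nonnegative after multiplication with \<open>sin s\<close>; comparing the difference
  quotient with \<open>L sin s\<close> therefore avoids any integration by parts.\<close>

lemma radial_limit_derivative:
  fixes d :: "nat \<Rightarrow> complex"
  assumes d: "summable (\<lambda>n. norm (d n))"
    and L: "\<And>e. 0 < e \<Longrightarrow> \<exists>\<delta>>0. \<forall>h. \<bar>h\<bar> < \<delta> \<longrightarrow>
      norm (trig d (x + h) - trig d x - of_real h * L) \<le> e * \<bar>h\<bar>"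
  shows "((\<lambda>r. \<Sum>n. \<i> * of_nat n * d n * (of_real r * cis x) ^ n) \<longlongrightarrow> L) (at_left 1)"
proof -
  define d' where "d' n = d n * cis (real n * x)" for n
  have sd': "summable (\<lambda>n. norm (d' n))" using d by (simp add: d'_def norm_mult)
  have td': "trig d' s = trig d (x + s)" for s
  proof -
    have "d' n * cis (real n * s) = d n * cis (real n * (x + s))" for n
      by (simp add: d'_def cis_mult algebra_simps)
    then show ?thesis by (simp add: trig_def)
  qed
  define S where "S r = (\<Sum>n. \<i> * of_nat n * d n * (of_real r * cis x) ^ n)" for r
  define C where "C = 2 * (\<Sum>n. norm (d n)) + norm L"
  \<comment> \<open>Error of the linear approximation, with \<open>sin s\<close> in place of
    \<open>s\<close>. The kernel has integral 0, and integral \<open>2 pi r\<close> against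
    \<open>sin\<close>, so \<open>S r - L r\<close> is exactly the mean of the kernel times
    \<open>H\<close>.\<close>
  define H where "H s = trig d (x + s) - trig d x - L * of_real (sin s)" for s
  have C: "norm (H s) \<le> C" for s
  proof -
    have "norm (H s) \<le> norm (trig d (x + s)) + norm (trig d x) + norm (L * of_real (sin s))"
      unfolding H_def by (meson norm_triangle_ineq4 order_trans add_right_mono)
    moreover have "norm (L * of_real (sin s)) \<le> norm L"
      using abs_sin_le_one[of s] by (simp add: norm_mult mult_left_le)
    ultimately show ?thesis using norm_trig_le[OF d, of x] norm_trig_le[OF d, of "x + s"] by (simp add: C_def)
  qed
  have C0: "0 \<le> C" using order_trans[OF norm_ge_zero C] .
  let ?M = "lebesgue_on {- pi..- pi + 2 * pi}"
  interpret finite_measure ?M by (rule finite_measure_interval)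
  have main: "S r - L * of_real r = (LINT s|?M. of_real (pder r s) * H s) / (2 * pi)"
    and int: "integrable ?M (\<lambda>s. of_real (pder r s) * H s)" if r: "0 \<le> r" "r < 1" for r
  proof -
    have i1: "integrable ?M (\<lambda>s. of_real (pder r s) * trig d (x + s))"
      using integral_pder_trig(2)[OF r sd'] by (simp add: td')
    have i2: "integrable ?M (\<lambda>s. complex_of_real (pder r s))" "(LINT s|?M. complex_of_real (pder r s)) = 0"
      using integral_pder_single[OF r, of 0] by (simp_all del: integral_complex_of_real)
    have i3: "integrable ?M (\<lambda>s. complex_of_real (pder r s * sin s))"
      "(LINT s|?M. complex_of_real (pder r s * sin s)) = of_real (2 * pi * r)"
      using integrable_of_real[OF integral_pder_sin(2)[OF r]] integral_pder_sin(1)[OF r]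
      by (simp_all only: integral_complex_of_real)
    have e: "of_real (pder r s) * H s = of_real (pder r s) * trig d (x + s) - of_real (pder r s) * trig d x
        - of_real (pder r s * sin s) * L" for s
      by (simp add: H_def algebra_simps)
    have j2: "integrable ?M (\<lambda>s. complex_of_real (pder r s) * trig d x)"
      and j3: "integrable ?M (\<lambda>s. complex_of_real (pder r s * sin s) * L)"
      by (intro integrable_mult_left i2 i3)+
    note j12 = Bochner_Integration.integrable_diff[OF i1 j2]
    show "integrable ?M (\<lambda>s. of_real (pder r s) * H s)"
      unfolding e by (rule Bochner_Integration.integrable_diff[OF j12 j3])
    have "(LINT s|?M. of_real (pder r s) * H s) = (LINT s|?M. of_real (pder r s) * trig d (x + s))
        - (LINT s|?M. complex_of_real (pder r s)) * trig d x - (LINT s|?M. complex_of_real (pder r s * sin s)) * L"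
      unfolding e Bochner_Integration.integral_diff[OF j12 j3] Bochner_Integration.integral_diff[OF i1 j2]
      by (simp only: integral_mult_left_zero)
    then have "(LINT s|?M. of_real (pder r s) * H s) = (LINT s|?M. of_real (pder r s) * trig d (x + s)) - of_real (2 * pi * r) * L"
      by (simp only: i2 i3 mult_zero_left diff_zero)
    moreover have "(LINT s|?M. of_real (pder r s) * trig d (x + s)) / (2 * pi) = S r"
    proof -
      have "\<i> * of_nat n * of_real r ^ n * d' n = \<i> * of_nat n * d n * (of_real r * cis x) ^ n" for n
        by (simp add: d'_def power_mult_distrib Complex.DeMoivre)
      then have "S r = (\<Sum>n. \<i> * of_nat n * of_real r ^ n * d' n)" by (simp only: S_def)
      then show ?thesis using sums_unique[OF integral_pder_trig(1)[OF r sd']] by (simp only: td')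
    qed
    ultimately show "S r - L * of_real r = (LINT s|?M. of_real (pder r s) * H s) / (2 * pi)"
      by (simp add: field_simps)
  qed
  have est: "\<exists>K. \<forall>r. 0 \<le> r \<longrightarrow> r < 1 \<longrightarrow> norm (S r - L * of_real r) \<le> \<epsilon> + K * (1 - r\<^sup>2)" if \<epsilon>: "0 < \<epsilon>" for \<epsilon>
  proof -
    obtain \<delta>1 where \<delta>1: "0 < \<delta>1"
      "\<And>h. \<bar>h\<bar> < \<delta>1 \<Longrightarrow> norm (trig d (x + h) - trig d x - of_real h * L) \<le> \<epsilon> / 4 * \<bar>h\<bar>"
      using L[of "\<epsilon> / 4"] \<epsilon> by auto
    \<comment> \<open>The bound \<open>1/2\<close> secures \<open>|s| \<le> 2 |sin s|\<close>; the
      other one keeps the error of replacing \<open>s\<close> by \<open>sin s\<close>, multiplied by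
      \<open>L\<close>, below \<open>\<epsilon>/4 |s|\<close>. The \<open>+ 1\<close> covers
      \<open>L = 0\<close>.\<close>
    define e2 where "e2 = min (1/2) (\<epsilon> / (4 * (norm L + 1)))"
    have "0 < norm L + 1" using norm_ge_zero[of L] by linarith
    then have e2: "0 < e2" "e2 \<le> 1/2" "norm L * e2 \<le> \<epsilon> / 4"
    proof -
      have "norm L * e2 \<le> (norm L + 1) * (\<epsilon> / (4 * (norm L + 1)))"
        using \<epsilon> \<open>0 < norm L + 1\<close> by (intro mult_mono) (auto simp: e2_def)
      also have "\<dots> = \<epsilon> / 4" using \<open>0 < norm L + 1\<close> by (simp add: field_simps)
      finally show "norm L * e2 \<le> \<epsilon> / 4" .
      show "e2 \<le> 1/2" unfolding e2_def by (rule min.cobounded1)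
      show "0 < e2" using \<epsilon> \<open>0 < norm L + 1\<close> by (simp add: e2_def)
    qed
    obtain \<delta>2 where \<delta>2: "0 < \<delta>2" "\<And>s. \<bar>s\<bar> < \<delta>2 \<Longrightarrow> \<bar>sin s - s\<bar> \<le> e2 * \<bar>s\<bar>"
      by (rule sin_near_0[OF e2(1)]) (rule that, simp_all)
    define \<delta> where "\<delta> = min (pi / 2) (min \<delta>1 \<delta>2)"
    have \<delta>: "0 < \<delta>" "\<delta> \<le> pi / 2" using \<delta>1 \<delta>2 by (auto simp: \<delta>_def)
    have near: "norm (H s) \<le> \<epsilon> * \<bar>sin s\<bar>" if s: "\<bar>s\<bar> < \<delta>" for s
    proof -
      have s2: "\<bar>sin s - s\<bar> \<le> e2 * \<bar>s\<bar>" using \<delta>2 s by (auto simp: \<delta>_def)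
      have "e2 * \<bar>s\<bar> \<le> 1/2 * \<bar>s\<bar>" using e2 by (intro mult_right_mono) auto
      then have s3: "\<bar>s\<bar> \<le> 2 * \<bar>sin s\<bar>" using s2 by linarith
      have "H s = (trig d (x + s) - trig d x - of_real s * L) - L * of_real (sin s - s)"
        by (simp add: H_def algebra_simps)
      then have "norm (H s) \<le> norm (trig d (x + s) - trig d x - of_real s * L) + norm (L * of_real (sin s - s))"
        by (simp only: norm_triangle_ineq4)
      also have "\<dots> \<le> \<epsilon> / 4 * \<bar>s\<bar> + norm L * (e2 * \<bar>s\<bar>)"
        using \<delta>1(2)[of s] s s2 unfolding norm_mult norm_of_real
        by (intro add_mono mult_left_mono) (auto simp: \<delta>_def)
      also have "norm L * (e2 * \<bar>s\<bar>) \<le> \<epsilon> / 4 * \<bar>s\<bar>"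
        unfolding mult.assoc[symmetric] by (intro mult_right_mono e2) simp
      finally have "norm (H s) \<le> \<epsilon> / 2 * \<bar>s\<bar>" by simp
      also have "\<dots> \<le> \<epsilon> / 2 * (2 * \<bar>sin s\<bar>)" using \<epsilon> s3 by (intro mult_left_mono) auto
      finally show ?thesis by simp
    qed
    \<comment> \<open>Bound for the kernel times \<open>H\<close> at distance at least
      \<open>\<delta>\<close> from 0, with the factor \<open>1 - r^2\<close> split off.\<close>
    define K where "K = C * (2 / (sin \<delta>) ^ 4)"
    have "0 < sin \<delta>" using \<delta> by (intro sin_gt_zero) (use pi_gt_zero in linarith)+
    then have K0: "0 \<le> K" using C0 by (simp add: K_def)
    have "norm (S r - L * of_real r) \<le> \<epsilon> + K * (1 - r\<^sup>2)" if r: "0 \<le> r" "r < 1" for r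
    proof -
      have r2: "0 \<le> 1 - r\<^sup>2" using r by (simp add: power_le_one)
      have pt: "norm (of_real (pder r s) * H s) \<le> \<epsilon> * (pder r s * sin s) + K * (1 - r\<^sup>2)"
        if s: "s \<in> {- pi..- pi + 2 * pi}" for s
      proof (cases "\<bar>s\<bar> < \<delta>")
        case True
        have "norm (of_real (pder r s) * H s) \<le> \<bar>pder r s\<bar> * (\<epsilon> * \<bar>sin s\<bar>)"
          unfolding norm_mult norm_of_real by (intro mult_left_mono near True) simp
        also have "\<dots> = \<epsilon> * (pder r s * sin s)" using pder_sin_nonneg[OF r, of s] by (simp add: mult_ac)
        finally show ?thesis using mult_nonneg_nonneg[OF K0 r2] by linarith
      next
        case False
        have "\<bar>s\<bar> \<le> pi" using s by (auto simp: abs_le_iff)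
        then have "\<bar>pder r s\<bar> \<le> 2 * (1 - r\<^sup>2) / (sin \<delta>) ^ 4" using pder_away[OF r \<delta>, of s] False by simp
        then have "norm (of_real (pder r s) * H s) \<le> 2 * (1 - r\<^sup>2) / (sin \<delta>) ^ 4 * C"
          unfolding norm_mult norm_of_real by (intro mult_mono C) (use C0 r2 in auto)
        also have "\<dots> = K * (1 - r\<^sup>2)" by (simp add: K_def)
        finally show ?thesis
          using \<epsilon> pder_sin_nonneg[OF r, of s, symmetric] by (simp add: add_increasing)
      qed
      have i: "integrable ?M (\<lambda>s. \<epsilon> * (pder r s * sin s) + K * (1 - r\<^sup>2))"
        using integral_pder_sin(2)[OF r] by simp
      have "norm (LINT s|?M. of_real (pder r s) * H s) \<le> (LINT s|?M. \<epsilon> * (pder r s * sin s) + K * (1 - r\<^sup>2))"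
        by (rule Bochner_Integration.integral_norm_bound_integral[OF int[OF r] i]) (simp add: pt)
      also have "\<dots> = \<epsilon> * (2 * pi * r) + 2 * pi * (K * (1 - r\<^sup>2))"
        using integral_pder_sin[OF r] by (simp add: measure_restrict_space)
      finally have "norm (S r - L * of_real r) \<le> (\<epsilon> * (2 * pi * r) + 2 * pi * (K * (1 - r\<^sup>2))) / (2 * pi)"
        unfolding main[OF r] by (simp add: norm_divide divide_right_mono)
      also have "\<dots> = \<epsilon> * r + K * (1 - r\<^sup>2)" by (simp add: field_simps)
      also have "\<dots> \<le> \<epsilon> + K * (1 - r\<^sup>2)" using \<epsilon> r by (simp add: mult_left_le)
      finally show ?thesis .
    qed
    then show ?thesis by blast
  qed
  have ev01: "\<forall>\<^sub>F r in at_left (1::real). 0 \<le> r \<and> r < 1"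
    using eventually_at_left_real[of 0 "1::real"] by (auto elim: eventually_mono)
  have "((\<lambda>r. S r - L * of_real r) \<longlongrightarrow> 0) (at_left 1)"
  proof (rule tendstoI)
    fix e :: real assume e: "0 < e"
    obtain K where K: "\<And>r. 0 \<le> r \<Longrightarrow> r < 1 \<Longrightarrow> norm (S r - L * of_real r) \<le> e / 2 + K * (1 - r\<^sup>2)"
      using est[of "e / 2"] e by auto
    have "((\<lambda>r. K * (1 - r\<^sup>2)) \<longlongrightarrow> K * (1 - 1\<^sup>2)) (at_left 1)" by (intro tendsto_intros)
    then have "((\<lambda>r. K * (1 - r\<^sup>2)) \<longlongrightarrow> 0) (at_left 1)" by simp
    then have "\<forall>\<^sub>F r in at_left 1. K * (1 - r\<^sup>2) < e / 2" by (rule order_tendstoD) (use e in simp)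
    then show "\<forall>\<^sub>F r in at_left 1. dist (S r - L * of_real r) 0 < e"
      using ev01
    proof eventually_elim
      case (elim r)
      then show ?case using K[of r] by simp
    qed
  qed
  moreover have "((\<lambda>r. L * of_real r) \<longlongrightarrow> L * of_real 1) (at_left 1)" by (intro tendsto_intros)
  ultimately have "((\<lambda>r. (S r - L * of_real r) + L * of_real r) \<longlongrightarrow> 0 + L * of_real 1) (at_left 1)"
    by (rule tendsto_add)
  then show ?thesis by (simp add: S_def)
qed

section \<open>The primitive of the boundary function and its differentiation\<close>

lemma inner_seq_power_series_sums:
  "norm z < 1 \<Longrightarrow> (\<lambda>n. coord x n * z ^ n) sums (\<Sum>n. coord x n * z ^ n)"
  by (intro summable_sums summable_norm_cancel[OF summable_coord_power])

text \<open>\<open>anti \<theta>\<close> collects the Fourier coefficients of the periodic part of the antiderivative of the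
  boundary function; at \<open>n = 0\<close> the division by zero yields \<open>0\<close>.\<close>

definition anti :: "nat ell2 \<Rightarrow> nat \<Rightarrow> complex" where "anti x n = coord x n / (\<i> * of_nat n)"

text \<open>\<open>2 a b \<le> a^2 + b^2\<close> for the two square-summable sequences
  \<open>norm (coord x n)\<close> and \<open>1/n\<close>.\<close>

lemma summable_anti: "summable (\<lambda>n. norm (anti x n))"
proof (rule summable_comparison_test')
  have "summable (\<lambda>n. (norm (coord x n))\<^sup>2)"
    by (rule summable_on_imp_summable[OF coord_summable])
  moreover have "summable (\<lambda>n. inverse ((real n)\<^sup>2))" by (rule inverse_power_summable) simp
  ultimately show "summable (\<lambda>n. (norm (coord x n))\<^sup>2 + inverse ((real n)\<^sup>2))" by (rule summable_add)
  fix n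
  have "0 \<le> (norm (coord x n) - inverse (real n))\<^sup>2" by simp
  then have "2 * (norm (coord x n) * inverse (real n)) \<le> (norm (coord x n))\<^sup>2 + (inverse (real n))\<^sup>2"
    by (simp add: power2_diff)
  moreover have "0 \<le> norm (coord x n) * inverse (real n)" by simp
  moreover have "norm (norm (anti x n)) = norm (coord x n) * inverse (real n)"
    by (simp add: anti_def norm_divide norm_mult) (simp add: divide_inverse)
  moreover have "(inverse (real n))\<^sup>2 = inverse ((real n)\<^sup>2)" by (rule power_inverse)
  ultimately show "norm (norm (anti x n)) \<le> (norm (coord x n))\<^sup>2 + inverse ((real n)\<^sup>2)"
    by linarith
qed

lemma integral_trig:
  assumes t: "0 \<le> t" and x: "summable (\<lambda>n. norm (coord x n))"
  shows "(LINT s|lebesgue_on {0..t}. trig (coord x) s) = coord x 0 * of_real t + trig (anti x) t - trig (anti x) 0"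
proof -
  have e: "(LINT s|lebesgue_on {0..t}. cis (real n * s)) =
      (if n = 0 then of_real t else (cis (real n * t) - 1) / (\<i> * of_nat n))" for n
  proof (cases "n = 0")
    case True
    then show ?thesis using t by (simp add: measure_restrict_space complex_eq_iff)
  next
    case False
    then show ?thesis using integral_cis_interval[of "int n" 0 t] t by simp
  qed
  have "(\<lambda>n. coord x n * (LINT s|lebesgue_on {0..t}. cis (real n * s) * 1)) sums
      (LINT s|lebesgue_on {0..t}. trig (coord x) s * 1)"
    by (rule integral_trig_mult[OF x, of _ 1]) simp_all
  moreover have "coord x n * (LINT s|lebesgue_on {0..t}. cis (real n * s) * 1) =
      (if n = 0 then coord x n * of_real t else 0) + (anti x n * cis (real n * t) - anti x n * cis (real n * 0))" for n
    by (simp only: mult_1_right e) (simp add: anti_def diff_divide_distrib right_diff_distrib)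
  ultimately have 1: "(\<lambda>n. (if n = 0 then coord x n * of_real t else 0) +
      (anti x n * cis (real n * t) - anti x n * cis (real n * 0))) sums (LINT s|lebesgue_on {0..t}. trig (coord x) s)"
    by simp
  have 2: "(\<lambda>n. (if n = 0 then coord x n * of_real t else 0) +
      (anti x n * cis (real n * t) - anti x n * cis (real n * 0))) sums
      (coord x 0 * of_real t + (trig (anti x) t - trig (anti x) 0))"
    unfolding trig_def
    by (intro sums_add sums_diff summable_sums summable_trig summable_anti) (rule sums_single)
  from sums_unique2[OF 1 2] show ?thesis by simp
qed

lemma trig_anti_tendsto:
  assumes \<rho>: "\<And>j. 0 \<le> \<rho> j" "\<And>j. \<rho> j < 1" "\<rho> \<longlonglongrightarrow> (1::real)"
  shows "(\<lambda>j. trig (anti (dil (\<rho> j) x)) t) \<longlonglongrightarrow> trig (anti x) t"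
  unfolding trig_def
proof (rule tannerys_theorem[THEN conjunct2, THEN conjunct2])
  have d: "anti (dil (\<rho> j) x) n = of_real (\<rho> j ^ n) * anti x n" for j n
    using \<rho>(1,2)[of j] by (simp add: anti_def less_imp_le)
  show "(\<lambda>j. anti (dil (\<rho> j) x) n * cis (real n * t)) \<longlonglongrightarrow> anti x n * cis (real n * t)" for n
  proof -
    have "(\<lambda>j. of_real (\<rho> j ^ n) * anti x n * cis (real n * t)) \<longlonglongrightarrow> of_real (1 ^ n) * anti x n * cis (real n * t)"
      by (intro tendsto_intros \<rho>)
    then show ?thesis by (simp add: d)
  qed
  have "norm (anti (dil (\<rho> j) x) n * cis (real n * t)) \<le> norm (anti x n)" for n j
    using \<rho>(1,2)[of j] by (simp add: d norm_mult norm_power mult_left_le_one_le power_le_one)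
  then show "\<forall>\<^sub>F (n, j) in sequentially \<times>\<^sub>F sequentially.
      norm (anti (dil (\<rho> j) x) n * cis (real n * t)) \<le> norm (anti x n)"
    by (intro always_eventually) auto
qed (simp_all add: summable_anti)

lemma AE_lebesgue_on_iff:
  "S \<in> sets lebesgue \<Longrightarrow> (AE x in lebesgue_on S. P x) \<longleftrightarrow> (AE x in lebesgue. x \<in> S \<longrightarrow> P x)"
  by (subst AE_restrict_space_iff) auto

text \<open>Lebesgue differentiation over intervals to the right of a point; differentiation from
  the left will come from applying it to the reflected function.\<close>

lemma one_sided_differentiation:
  fixes f :: "real \<Rightarrow> complex"
  assumes "\<And>a b. f integrable_on {a..b}"
  obtains N where "negligible N"
    "\<And>x e. x \<notin> N \<Longrightarrow> 0 < e \<Longrightarrow> \<exists>\<delta>>0. \<forall>h. 0 < h \<and> h < \<delta> \<longrightarrow> norm (integral {x..x + h} f - of_real h * f x) \<le> e * h"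
proof -
  obtain N where N: "negligible N"
    "\<And>x e. x \<notin> N \<Longrightarrow> 0 < e \<Longrightarrow> \<exists>d>0. \<forall>h. 0 < h \<and> h < d \<longrightarrow>
       norm (integral (cbox x (x + h *\<^sub>R One)) f /\<^sub>R h ^ DIM(real) - f x) < e"
    by (rule integrable_ccontinuous_explicit[of f]) (use assms in \<open>auto simp: cbox_interval\<close>)
  have "\<exists>\<delta>>0. \<forall>h. 0 < h \<and> h < \<delta> \<longrightarrow> norm (integral {x..x + h} f - of_real h * f x) \<le> e * h"
    if x: "x \<notin> N" and e: "0 < e" for x e
  proof -
    obtain d where d: "d > 0" "\<forall>h. 0 < h \<and> h < d \<longrightarrow>
       norm (integral (cbox x (x + h *\<^sub>R One)) f /\<^sub>R h ^ DIM(real) - f x) < e"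
      using N(2)[OF x e] by blast
    have "norm (integral {x..x + h} f - of_real h * f x) \<le> e * h" if h: "0 < h" "h < d" for h
    proof -
      have "norm (integral {x..x + h} f /\<^sub>R h - f x) < e" using d(2) h by (simp add: cbox_interval)
      then have "h * norm (integral {x..x + h} f /\<^sub>R h - f x) \<le> h * e" using h by (intro mult_left_mono) auto
      moreover have "h * norm (integral {x..x + h} f /\<^sub>R h - f x) = norm (h *\<^sub>R (integral {x..x + h} f /\<^sub>R h - f x))"
        using h by simp
      moreover have "h *\<^sub>R (integral {x..x + h} f /\<^sub>R h - f x) = integral {x..x + h} f - of_real h * f x"
        using h by (simp add: scaleR_conv_of_real right_diff_distrib mult.assoc[symmetric])
      ultimately show ?thesis by (simp add: mult.commute)
    qed
    then show ?thesis using d(1) by blast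
  qed
  then show thesis using that N(1) by blast
qed

text \<open>A primitive of the boundary function is a linear term plus the absolutely convergent
  series \<open>trig (anti \<theta>)\<close>. At almost every \<open>x\<close> that series has the
  derivative \<open>f x - coord \<theta> 0\<close>, and \<open>radial_limit_derivative\<close> turns
  this into the radial limit of the differentiated series, which is the series of
  \<open>\<theta>\<close> without its constant term.\<close>

lemma inner_seq_radial_limits:
  assumes \<theta>: "inner_seq \<theta>"
  shows "AE t in lebesgue_on {0..2 * pi}. \<exists>b. ((\<lambda>r. \<Sum>n. coord \<theta> n * (of_real r * cis t) ^ n) \<longlongrightarrow> b) (at_left 1) \<and> norm b = 1"
proof -
  let ?M = "lebesgue_on {0..2 * pi}"
  obtain g \<rho> where g: "g \<in> borel_measurable ?M"
    and \<rho>: "\<And>j. 0 \<le> \<rho> j" "\<And>j. \<rho> j < (1::real)" "\<rho> \<longlonglongrightarrow> 1"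
    and lim: "AE t in ?M. (\<lambda>j. trig (coord (dil (\<rho> j) \<theta>)) t) \<longlonglongrightarrow> g t"
    and g1: "AE t in ?M. norm (g t) = 1"
    by (rule inner_seq_boundary_function[OF \<theta>]) (rule that; simp)
  \<comment> \<open>Extended by 0 to the line, so that integrals over arbitrary intervals and the
    reflection are available.\<close>
  define f where "f t = (if t \<in> {0..2 * pi} then g t else 0)" for t
  have f_meas: "f \<in> borel_measurable lebesgue"
    unfolding f_def[abs_def] by (rule borel_measurable_if_I[OF g]) simp
  have lim': "AE t in lebesgue. t \<in> {0..2 * pi} \<longrightarrow> (\<lambda>j. trig (coord (dil (\<rho> j) \<theta>)) t) \<longlonglongrightarrow> f t"
    using lim unfolding AE_lebesgue_on_iff[OF lmeasurable_interval(1)[THEN fmeasurableD]] by eventually_elim (simp add: f_def)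
  have f1: "AE t in lebesgue. t \<in> {0..2 * pi} \<longrightarrow> norm (f t) = 1"
    using g1 unfolding AE_lebesgue_on_iff[OF lmeasurable_interval(1)[THEN fmeasurableD]] by eventually_elim (simp add: f_def)
  have f_bd: "AE t in lebesgue. norm (f t) \<le> 1"
    using f1 by eventually_elim (auto simp: f_def)
  have f_int: "integrable (lebesgue_on {a..b}) f" for a b
  proof (rule finite_measure.integrable_const_bound[OF finite_measure_interval, of _ 1])
    show "AE t in lebesgue_on {a..b}. norm (f t) \<le> 1"
      unfolding AE_lebesgue_on_iff[OF lmeasurable_interval(1)[THEN fmeasurableD]] using f_bd by eventually_elim simp
    show "f \<in> borel_measurable (lebesgue_on {a..b})" by (rule measurable_restrict_space1[OF f_meas])
  qed
  have f_hk: "f integrable_on {a..b}" for a b by (rule integrable_on_lebesgue_on[OF f_int]) simp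
  have sd: "summable (\<lambda>n. norm (coord (dil (\<rho> j) \<theta>) n))" for j by (rule summable_norm_dil[OF \<rho>(1,2)])
  have bd: "norm (trig (coord (dil (\<rho> j) \<theta>)) t) \<le> 1" for j t
    unfolding trig_dil[OF \<rho>(1,2)] by (rule inner_seq_le_1[OF \<theta>]) (simp add: norm_mult \<rho>)
  have prim: "integral {0..t} f = coord \<theta> 0 * of_real t + trig (anti \<theta>) t - trig (anti \<theta>) 0"
    if t: "0 \<le> t" "t \<le> 2 * pi" for t
  proof -
    interpret finite_measure "lebesgue_on {0..t}" by (rule finite_measure_interval)
    have "(\<lambda>j. LINT s|lebesgue_on {0..t}. trig (coord (dil (\<rho> j) \<theta>)) s) \<longlonglongrightarrow> (LINT s|lebesgue_on {0..t}. f s)"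
    proof (rule integral_dominated_convergence[of _ _ _ "\<lambda>_. 1"])
      show "f \<in> borel_measurable (lebesgue_on {0..t})" by (rule measurable_restrict_space1[OF f_meas])
      show "trig (coord (dil (\<rho> j) \<theta>)) \<in> borel_measurable (lebesgue_on {0..t})" for j
        by (rule borel_measurable_lebesgue_on) measurable
      show "integrable (lebesgue_on {0..t}) (\<lambda>_. 1::real)" by (rule integrable_const)
      show "AE s in lebesgue_on {0..t}. (\<lambda>j. trig (coord (dil (\<rho> j) \<theta>)) s) \<longlonglongrightarrow> f s"
        unfolding AE_lebesgue_on_iff[OF lmeasurable_interval(1)[THEN fmeasurableD]]
        using lim' by eventually_elim (use t in auto)
      show "AE s in lebesgue_on {0..t}. norm (trig (coord (dil (\<rho> j) \<theta>)) s) \<le> 1" for j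
        using bd by simp
    qed
    moreover have "(LINT s|lebesgue_on {0..t}. trig (coord (dil (\<rho> j) \<theta>)) s) =
        coord \<theta> 0 * of_real t + trig (anti (dil (\<rho> j) \<theta>)) t - trig (anti (dil (\<rho> j) \<theta>)) 0" for j
      using integral_trig[OF t(1) sd[of j]] \<rho>(1,2)[of j] by (simp add: less_imp_le)
    moreover have "(\<lambda>j. coord \<theta> 0 * of_real t + trig (anti (dil (\<rho> j) \<theta>)) t - trig (anti (dil (\<rho> j) \<theta>)) 0)
        \<longlonglongrightarrow> coord \<theta> 0 * of_real t + trig (anti \<theta>) t - trig (anti \<theta>) 0"
      by (intro tendsto_intros trig_anti_tendsto \<rho>)
    ultimately have "(LINT s|lebesgue_on {0..t}. f s) = coord \<theta> 0 * of_real t + trig (anti \<theta>) t - trig (anti \<theta>) 0"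
      using LIMSEQ_unique by simp
    then show ?thesis by (simp add: lebesgue_integral_eq_integral[OF f_int])
  qed
  obtain N1 where N1: "negligible N1" "\<And>x e. x \<notin> N1 \<Longrightarrow> 0 < e \<Longrightarrow>
      \<exists>\<delta>>0. \<forall>h. 0 < h \<and> h < \<delta> \<longrightarrow> norm (integral {x..x + h} f - of_real h * f x) \<le> e * h"
    using one_sided_differentiation[OF f_hk] by metis
  have f_refl: "(\<lambda>s. f (- s)) integrable_on {a..b}" for a b
    using f_hk[of "- b" "- a"] has_integral_reflect_real[of f _ "- a" "- b"] by (auto simp: integrable_on_def)
  obtain N2 where N2: "negligible N2" "\<And>x e. x \<notin> N2 \<Longrightarrow> 0 < e \<Longrightarrow>
      \<exists>\<delta>>0. \<forall>h. 0 < h \<and> h < \<delta> \<longrightarrow> norm (integral {x..x + h} (\<lambda>s. f (- s)) - of_real h * f (- x)) \<le> e * h"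
    using one_sided_differentiation[OF f_refl] by metis
  have N2': "negligible (uminus ` N2)"
    by (rule negligible_differentiable_image_negligible[OF _ N2(1)])
      (auto intro!: derivative_intros simp: differentiable_on_def)
  have pt: "\<exists>b. ((\<lambda>r. \<Sum>n. coord \<theta> n * (of_real r * cis x) ^ n) \<longlongrightarrow> b) (at_left 1) \<and> norm b = 1"
    if x: "0 < x" "x < 2 * pi" "x \<notin> N1" "x \<notin> uminus ` N2" "norm (f x) = 1" for x
  proof -
    define L where "L = f x - coord \<theta> 0"
    have "- x \<notin> N2" using x(4) by (metis image_eqI minus_minus)
    note N2x = N2(2)[OF this]
    have deriv: "\<exists>\<delta>>0. \<forall>h. \<bar>h\<bar> < \<delta> \<longrightarrow>
      norm (trig (anti \<theta>) (x + h) - trig (anti \<theta>) x - of_real h * L) \<le> e * \<bar>h\<bar>" if e: "0 < e" for e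
    proof -
      obtain \<delta>1 where \<delta>1: "\<delta>1 > 0" "\<And>h. 0 < h \<Longrightarrow> h < \<delta>1 \<Longrightarrow> norm (integral {x..x + h} f - of_real h * f x) \<le> e * h"
        using N1(2)[OF x(3) e] by blast
      obtain \<delta>2 where \<delta>2: "\<delta>2 > 0" "\<And>h. 0 < h \<Longrightarrow> h < \<delta>2 \<Longrightarrow>
          norm (integral {- x..- x + h} (\<lambda>s. f (- s)) - of_real h * f x) \<le> e * h"
        using N2x[OF e] by auto
      \<comment> \<open>The distances to both ends keep \<open>x + h\<close> inside
        \<open>{0..2 * pi}\<close>, where \<open>prim\<close> is valid.\<close>
      define \<delta> where "\<delta> = min (min \<delta>1 \<delta>2) (min x (2 * pi - x))"
      have \<delta>: "\<delta> > 0" using \<delta>1 \<delta>2 x by (simp add: \<delta>_def)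
      have diff: "integral {a..b} f = coord \<theta> 0 * of_real (b - a) + trig (anti \<theta>) b - trig (anti \<theta>) a"
        if "0 \<le> a" "a \<le> b" "b \<le> 2 * pi" for a b
        using Henstock_Kurzweil_Integration.integral_combine[OF that(1,2) f_hk] prim[of a] prim[of b] that
        by (simp add: algebra_simps)
      have "norm (trig (anti \<theta>) (x + h) - trig (anti \<theta>) x - of_real h * L) \<le> e * \<bar>h\<bar>" if h: "\<bar>h\<bar> < \<delta>" for h
      proof (cases h "0::real" rule: linorder_cases)
        case greater
        have "trig (anti \<theta>) (x + h) - trig (anti \<theta>) x - of_real h * L = integral {x..x + h} f - of_real h * f x"
          using diff[of x "x + h"] h x greater by (simp add: L_def \<delta>_def algebra_simps)
        then show ?thesis using \<delta>1(2)[of h] greater h by (simp add: \<delta>_def)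
      next
        case less
        have "integral {- x..- x + (- h)} (\<lambda>s. f (- s)) = integral {x + h..x} f"
          using has_integral_reflect_real[of f "integral {x + h..x} f" x "x + h"] integrable_integral[OF f_hk[of "x + h" x]]
          by (intro integral_unique) simp
        moreover have "norm (trig (anti \<theta>) (x + h) - trig (anti \<theta>) x - of_real h * L) =
            norm (integral {x + h..x} f - of_real (- h) * f x)"
        proof -
          have "trig (anti \<theta>) (x + h) - trig (anti \<theta>) x - of_real h * L = - (integral {x + h..x} f - of_real (- h) * f x)"
            using diff[of "x + h" x] h x less by (simp add: L_def \<delta>_def algebra_simps)
          then show ?thesis by (simp only: norm_minus_cancel)
        qed
        ultimately show ?thesis using \<delta>2(2)[of "- h"] less h by (simp add: \<delta>_def)
      qed simp
      then show ?thesis using \<delta> by blast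
    qed
    have lim: "((\<lambda>r. coord \<theta> 0 + (\<Sum>n. \<i> * of_nat n * anti \<theta> n * (of_real r * cis x) ^ n)) \<longlongrightarrow> coord \<theta> 0 + L) (at_left 1)"
      by (intro tendsto_add tendsto_const radial_limit_derivative[OF summable_anti deriv])
    have "\<forall>\<^sub>F r in at_left (1::real). 0 < r \<and> r < 1"
      using eventually_at_left_real[of 0 "1::real"] by simp
    then have "\<forall>\<^sub>F r in at_left 1. coord \<theta> 0 + (\<Sum>n. \<i> * of_nat n * anti \<theta> n * (of_real r * cis x) ^ n) =
        (\<Sum>n. coord \<theta> n * (of_real r * cis x) ^ n)"
    proof eventually_elim
      case (elim r)
      define z where "z = of_real r * cis x"
      have z: "norm z < 1" using elim by (simp add: z_def norm_mult)
      have "(\<lambda>n. coord \<theta> n * z ^ n - (if n = 0 then coord \<theta> n else 0)) sums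
          ((\<Sum>n. coord \<theta> n * z ^ n) - coord \<theta> 0)"
        by (intro sums_diff inner_seq_power_series_sums z) (rule sums_single)
      moreover have "coord \<theta> n * z ^ n - (if n = 0 then coord \<theta> n else 0) = \<i> * of_nat n * anti \<theta> n * z ^ n" for n
        by (simp add: anti_def)
      ultimately show ?case by (simp add: sums_iff z_def)
    qed
    then have "((\<lambda>r. \<Sum>n. coord \<theta> n * (of_real r * cis x) ^ n) \<longlongrightarrow> coord \<theta> 0 + L) (at_left 1)"
      using lim tendsto_cong by force
    then show ?thesis using x(5) by (intro exI[of _ "coord \<theta> 0 + L"]) (simp add: L_def)
  qed
  have "negligible ({0, 2 * pi} \<union> N1 \<union> uminus ` N2)" using N1(1) N2' by simp
  then have "AE x in lebesgue. x \<notin> {0, 2 * pi} \<union> N1 \<union> uminus ` N2"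
    unfolding negligible_iff_null_sets by (rule AE_not_in)
  then show ?thesis
    unfolding AE_lebesgue_on_iff[OF lmeasurable_interval(1)[THEN fmeasurableD]]
    using f1
  proof eventually_elim
    case (elim x)
    show ?case
    proof
      assume x: "x \<in> {0..2 * pi}"
      with elim have "0 < x" "x < 2 * pi" by auto
      with elim x show "\<exists>b. ((\<lambda>r. \<Sum>n. coord \<theta> n * (of_real r * cis x) ^ n) \<longlongrightarrow> b) (at_left 1) \<and> norm b = 1"
        by (intro pt) auto
    qed
  qed
qed

lemma inner_seq_imp_inner_function:
  assumes \<theta>: "inner_seq \<theta>" shows "inner_function (\<lambda>z. \<Sum>n. coord \<theta> n * z ^ n)"
  unfolding inner_function_def
proof (intro conjI inner_seq_radial_limits[OF \<theta>])
  show "(\<lambda>z. \<Sum>n. coord \<theta> n * z ^ n) holomorphic_on ball 0 1"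
  proof (rule power_series_holomorphic[of 0 1 "coord \<theta>"])
    fix w :: complex assume "w \<in> ball 0 1"
    then show "(\<lambda>n. coord \<theta> n * (w - 0) ^ n) sums (\<Sum>n. coord \<theta> n * w ^ n)"
      by (simp add: inner_seq_power_series_sums)
  qed
  show "bounded ((\<lambda>z. \<Sum>n. coord \<theta> n * z ^ n) ` ball 0 1)"
    unfolding bounded_iff by (intro exI[of _ 1]) (auto intro: inner_seq_le_1[OF \<theta>])
qed

section \<open>The Hardy space of the polydisc as a sequence space\<close>

lemma polydiscD: "z \<in> polydisc \<Longrightarrow> norm (z $ i) < 1"
  by (simp add: polydisc_def)

text \<open>A finite set of multi-indices fits into a box, where the sum factors into geometric
  sums, one for each variable.\<close>

lemma monomial_square_summable:
  fixes z :: "complex ^ 'n::finite"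
  assumes z: "z \<in> polydisc"
  shows "(\<lambda>k. (norm (cnj (monomial k z)))\<^sup>2) summable_on UNIV"
proof (rule nonneg_bdd_above_summable_on)
  define q where "q i = (norm (z $ i))\<^sup>2" for i
  have q: "0 \<le> q i" "q i < 1" for i using polydiscD[OF z, of i] by (simp_all add: q_def abs_square_less_1)
  have e: "(norm (cnj (monomial k z)))\<^sup>2 = (\<Prod>i\<in>UNIV. q i ^ k i)" for k
    by (simp add: monomial_def q_def prod_norm[symmetric] norm_power prod_power_distrib power_mult[symmetric] mult.commute)
  have "sum (\<lambda>k. (norm (cnj (monomial k z)))\<^sup>2) F \<le> (\<Prod>i\<in>UNIV. 1 / (1 - q i))" if F: "finite F" for F
  proof -
    define N where "N = Max (insert 0 ((\<lambda>(k, i). k i) ` (F \<times> UNIV)))"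
    have N: "k i \<le> N" if "k \<in> F" for k i
      unfolding N_def using F that by (intro Max_ge) auto
    have "F \<subseteq> (UNIV \<rightarrow>\<^sub>E {..N})" using N by (auto simp: PiE_def extensional_def)
    then have "sum (\<lambda>k. (norm (cnj (monomial k z)))\<^sup>2) F \<le> (\<Sum>k\<in>UNIV \<rightarrow>\<^sub>E {..N}. \<Prod>i\<in>UNIV. q i ^ k i)"
      unfolding e by (intro sum_mono2) (auto intro!: finite_PiE prod_nonneg zero_le_power q)
    also have "\<dots> = (\<Prod>i\<in>UNIV. \<Sum>m\<le>N. q i ^ m)"
      by (rule prod_sum_PiE[symmetric]) auto
    also have "\<dots> \<le> (\<Prod>i\<in>UNIV. 1 / (1 - q i))"
    proof (intro prod_mono conjI sum_nonneg zero_le_power q)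
      fix i
      have "(\<Sum>m\<le>N. q i ^ m) \<le> (\<Sum>m. q i ^ m)"
        by (rule sum_le_suminf) (use q[of i] in \<open>auto intro!: summable_geometric\<close>)
      then show "(\<Sum>m\<le>N. q i ^ m) \<le> 1 / (1 - q i)" using q[of i] by (simp add: suminf_geometric)
    qed
    finally show ?thesis .
  qed
  then show "bdd_above (sum (\<lambda>k. (norm (cnj (monomial k z)))\<^sup>2) ` {F. F \<subseteq> UNIV \<and> finite F})"
    by (intro bdd_aboveI[of _ "\<Prod>i\<in>UNIV. 1 / (1 - q i)"]) auto
qed simp

text \<open>The reproducing kernel; the conjugate makes the inner product with \<open>ker z\<close>
  the evaluation at \<open>z\<close>.\<close>

definition ker :: "complex ^ 'n::finite \<Rightarrow> ('n \<Rightarrow> nat) ell2" where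
  "ker z = Ell2 (\<lambda>k. cnj (monomial k z))"

lemma coord_ker: "z \<in> polydisc \<Longrightarrow> coord (ker z) k = cnj (monomial k z)"
  unfolding ker_def by (subst coord_Ell2[OF monomial_square_summable]) auto

definition hfun :: "('n::finite \<Rightarrow> nat) ell2 \<Rightarrow> complex ^ 'n \<Rightarrow> complex" where
  "hfun x z = (if z \<in> polydisc then cinner x (ker z) else 0)"

lemma hfun_has_sum: "z \<in> polydisc \<Longrightarrow> ((\<lambda>k. coord x k * monomial k z) has_sum hfun x z) UNIV"
  using cinner_has_sum[of x "ker z"] by (simp add: hfun_def coord_ker)

lemma monomial_up: "monomial (up i k) z = z $ i * monomial k z"
proof -
  have "(\<Prod>j\<in>UNIV. (z $ j) ^ up i k j) = (\<Prod>j\<in>UNIV. (if j = i then z $ i else 1) * (z $ j) ^ k j)"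
    by (intro prod.cong) (auto simp: up_def)
  then show ?thesis by (simp add: monomial_def prod.distrib)
qed

lemma monomial_line: "monomial (line i k (k i + n)) z = monomial k z * (z $ i) ^ n"
proof -
  have "(\<Prod>j\<in>UNIV. (z $ j) ^ line i k (k i + n) j) = (\<Prod>j\<in>UNIV. (z $ j) ^ k j * (if j = i then (z $ i) ^ n else 1))"
    by (intro prod.cong) (auto simp: line_def power_add)
  then show ?thesis by (simp add: monomial_def prod.distrib)
qed

lemma mul_adj_ker: "z \<in> polydisc \<Longrightarrow> mul_adj i (ker z) = cscale (cnj (z $ i)) (ker z)"
  by (rule ell2_eqI) (simp add: coord_ker monomial_up)

definition coord_upd :: "'n \<Rightarrow> complex \<Rightarrow> complex ^ 'n::finite \<Rightarrow> complex ^ 'n" where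
  "coord_upd i t z = (\<chi> j. if j = i then t else z $ j)"

lemma coord_upd_nth [simp]: "coord_upd i t z $ j = (if j = i then t else z $ j)"
  by (simp add: coord_upd_def)

lemma coord_upd_polydisc: "z \<in> polydisc \<Longrightarrow> norm t < 1 \<Longrightarrow> coord_upd i t z \<in> polydisc"
  by (simp add: polydisc_def)

text \<open>Kernel form of the expansion of \<open>f(z)\<close> as its value at
  \<open>z_i = 0\<close> plus \<open>z_i\<close> times the value of \<open>mul_adj i f\<close>; in
  other words, \<open>mul_adj i\<close> is the difference quotient in \<open>z_i\<close>.\<close>

lemma ker_decompose:
  assumes z: "z \<in> polydisc"
  shows "ker z = ker (coord_upd i 0 z) + cscale (cnj (z $ i)) (mul i (ker z))"
proof (rule ell2_eqI)
  fix k
  have z0: "coord_upd i 0 z \<in> polydisc" using coord_upd_polydisc[OF z] by simp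
  show "coord (ker z) k = coord (ker (coord_upd i 0 z) + cscale (cnj (z $ i)) (mul i (ker z))) k"
  proof (cases "k i")
    case 0
    have "monomial k (coord_upd i 0 z) = monomial k z"
      unfolding monomial_def by (intro prod.cong) (use 0 in auto)
    then show ?thesis using 0 by (simp add: coord_ker z z0 coord_push_notin not_range_up)
  next
    case (Suc m)
    define k' where "k' = k(i := m)"
    have k: "k = up i k'" using Suc by (auto simp: k'_def up_def)
    have "monomial k (coord_upd i 0 z) = 0" unfolding k monomial_up by simp
    moreover have "coord (mul i (ker z)) k = cnj (monomial k' z)" unfolding k by (simp add: coord_ker z)
    moreover have "monomial k z = z $ i * monomial k' z" unfolding k by (rule monomial_up)
    ultimately show ?thesis by (simp add: coord_ker z z0)
  qed
qed

lemma cinner_ker_decompose: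
  "z \<in> polydisc \<Longrightarrow> cinner x (ker z) = cinner x (ker (coord_upd i 0 z)) + z $ i * cinner (mul_adj i x) (ker z)"
  by (subst ker_decompose[of z i]) (simp_all add: cinner_add_right cinner_push_right)

lemma norm_ker_mono:
  fixes z w :: "complex ^ 'n::finite"
  assumes z: "z \<in> polydisc" "w \<in> polydisc" and le: "\<And>i. norm (z $ i) \<le> norm (w $ i)"
  shows "norm (ker z) \<le> norm (ker w)"
proof (rule power2_le_imp_le)
  show "(norm (ker z))\<^sup>2 \<le> (norm (ker w))\<^sup>2"
    unfolding norm_ell2_sq
  proof (rule infsum_mono[OF coord_summable coord_summable])
    fix k
    have "norm (monomial k z) \<le> norm (monomial k w)"
      unfolding monomial_def prod_norm[symmetric] norm_power
      by (intro prod_mono conjI power_mono le) auto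
    then show "(norm (coord (ker z) k))\<^sup>2 \<le> (norm (coord (ker w) k))\<^sup>2"
      by (simp add: coord_ker z power_mono)
  qed
qed simp

text \<open>Uniqueness of the coefficients: if \<open>f\<close> vanishes identically then so does the difference quotient
  \<open>M\<^sub>i\<^sup>* f\<close>, off \<open>z\<^sub>i = 0\<close> by division and on \<open>z\<^sub>i = 0\<close> by continuity.\<close>

lemma ker_total:
  fixes x :: "('n::finite \<Rightarrow> nat) ell2"
  assumes "\<And>z. z \<in> polydisc \<Longrightarrow> cinner x (ker z) = 0"
  shows "x = 0"
proof -
  define N where "N = {x :: ('n \<Rightarrow> nat) ell2. \<forall>z\<in>polydisc. cinner x (ker z) = 0}"
  have adj: "mul_adj i y \<in> N" if y: "y \<in> N" for i y
  proof -
    have nz: "cinner (mul_adj i y) (ker z) = 0" if z: "z \<in> polydisc" "z $ i \<noteq> 0" for z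
      using cinner_ker_decompose[OF z(1), of y i] y z coord_upd_polydisc[OF z(1), of 0 i] by (simp add: N_def)
    have "cinner (mul_adj i y) (ker z) = 0" if z: "z \<in> polydisc" "z $ i = 0" for z
    proof -
      let ?h = "coord_upd i (1/2) z"
      have h: "?h \<in> polydisc" using coord_upd_polydisc[OF z(1)] by simp
      \<comment> \<open>The value at \<open>z\<close> is minus \<open>t\<close> times a second
        difference quotient at the point with \<open>z_i = t\<close>. For \<open>t \<le> 1/2\<close>
        that quotient is bounded by \<open>B\<close>, through the kernel at
        \<open>z_i = 1/2\<close>; then \<open>t\<close> tends to 0.\<close>
      define B where "B = norm (mul_adj i (mul_adj i y)) * norm (ker ?h)"
      have bd: "norm (cinner (mul_adj i y) (ker z)) \<le> t * B" if t: "0 < t" "t \<le> 1/2" for t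
      proof -
        let ?w = "coord_upd i (of_real t) z"
        have w: "?w \<in> polydisc" using coord_upd_polydisc[OF z(1)] t by simp
        have "coord_upd i 0 ?w = z" using z(2) by (auto simp: vec_eq_iff)
        then have "cinner (mul_adj i y) (ker z) = - (of_real t * cinner (mul_adj i (mul_adj i y)) (ker ?w))"
          using cinner_ker_decompose[OF w, of "mul_adj i y" i] nz[OF w] t by (simp add: eq_neg_iff_add_eq_0)
        then have "norm (cinner (mul_adj i y) (ker z)) = t * norm (cinner (mul_adj i (mul_adj i y)) (ker ?w))"
          using t by (simp add: norm_mult)
        also have "\<dots> \<le> t * (norm (mul_adj i (mul_adj i y)) * norm (ker ?w))"
          using t by (intro mult_left_mono Cauchy_Schwarz_cinner) simp
        also have "\<dots> \<le> t * B" unfolding B_def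
          using t by (intro mult_left_mono norm_ker_mono w h) auto
        finally show ?thesis .
      qed
      have "norm (cinner (mul_adj i y) (ker z)) \<le> 0"
      proof (rule tendsto_lowerbound)
        show "((\<lambda>t. t * B) \<longlongrightarrow> 0) (at_right 0)" by (rule tendsto_mult_left_zero[OF tendsto_ident_at])
        show "\<forall>\<^sub>F t in at_right 0. norm (cinner (mul_adj i y) (ker z)) \<le> t * B"
          using eventually_at_right_real[of 0 "1/2::real"] by (auto elim!: eventually_mono intro: bd)
      qed simp
      then show ?thesis by simp
    qed
    then show ?thesis using nz by (auto simp: N_def)
  qed
  have "coord y (\<lambda>_. 0) = 0" if "y \<in> N" for y
  proof -
    have p: "(0 :: complex ^ 'n) \<in> polydisc" by (simp add: polydisc_def)
    have "ker (0 :: complex ^ 'n) = delta (\<lambda>_. 0)"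
    proof (rule ell2_eqI)
      fix k :: "'n \<Rightarrow> nat"
      have "(\<Prod>i\<in>UNIV. (0::complex) ^ k i) = (if k = (\<lambda>_. 0) then 1 else 0)"
        by (auto simp: fun_eq_iff prod_zero_iff power_0_left)
      then show "coord (ker 0) k = coord (delta (\<lambda>_. 0)) k"
        by (simp add: coord_ker[OF p] coord_delta monomial_def)
    qed
    then show ?thesis using that p by (auto simp: N_def cinner_delta_right)
  qed
  then have base: "\<forall>y\<in>N. coord y (\<lambda>_. 0) = 0" by simp
  have all: "\<forall>y\<in>N. coord y k = 0" for k
  proof (rule multi_index_induct[of UNIV k])
    show "\<forall>y\<in>N. coord y (\<lambda>_. 0) = 0" by (rule base)
    fix k j assume IH: "\<forall>y\<in>N. coord y k = 0"
    show "\<forall>y\<in>N. coord y (up j k) = 0"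
    proof
      fix y assume "y \<in> N"
      from bspec[OF IH adj[OF this]] show "coord y (up j k) = 0" by simp
    qed
  qed simp
  have "x \<in> N" using assms by (simp add: N_def)
  then show ?thesis using all by (intro ell2_eqI) simp
qed

section \<open>Translation of the Hardy space notions into coefficients\<close>

lemma hardy_expansion_hfun: "hardy_expansion (coord x) (hfun x)"
  by (simp add: hardy_expansion_def coord_summable hfun_has_sum)

lemma hfun_in_hardy: "hfun x \<in> hardy"
  using hardy_expansion_hfun by (auto simp: hardy_def hfun_def)

lemma hardy_coeff_hfun:
  fixes x :: "('n::finite \<Rightarrow> nat) ell2"
  shows "hardy_coeff (hfun x) = coord x"
  unfolding hardy_coeff_def
proof (rule the_equality)
  show "hardy_expansion (coord x) (hfun x)" by (rule hardy_expansion_hfun)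
  fix a assume a: "hardy_expansion a (hfun x)"
  define y where "y = Ell2 a"
  have y: "coord y = a" using a by (simp add: y_def hardy_expansion_def)
  have "x - y = 0"
  proof (rule ker_total)
    fix z :: "complex ^ 'n" assume z: "z \<in> polydisc"
    have "((\<lambda>k. a k * monomial k z) has_sum hfun x z) UNIV" using a z by (simp add: hardy_expansion_def)
    then have "hfun y z = hfun x z" using hfun_has_sum[OF z, of y] unfolding y by (rule has_sum_unique[symmetric])
    then show "cinner (x - y) (ker z) = 0" using z by (simp add: hfun_def cinner_diff_left)
  qed
  then show "a = coord x" using y by simp
qed

lemma hardy_eq: "hardy = range (hfun :: ('n::finite \<Rightarrow> nat) ell2 \<Rightarrow> _)"
proof (intro equalityI subsetI)
  fix f :: "complex ^ 'n \<Rightarrow> complex" assume "f \<in> hardy"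
  then obtain a where f0: "\<And>z. z \<notin> polydisc \<Longrightarrow> f z = 0" and a: "hardy_expansion a f"
    by (auto simp: hardy_def)
  define y where "y = Ell2 a"
  have y: "coord y = a" using a by (simp add: y_def hardy_expansion_def)
  have "f z = hfun y z" for z
  proof (cases "z \<in> polydisc")
    case True
    then have "((\<lambda>k. a k * monomial k z) has_sum f z) UNIV" using a by (simp add: hardy_expansion_def)
    then show ?thesis using hfun_has_sum[OF True, of y] unfolding y by (rule has_sum_unique)
  qed (simp add: f0 hfun_def)
  then have "f = hfun y" by (rule ext)
  then show "f \<in> range hfun" by (rule range_eqI)
qed (auto simp: hfun_in_hardy)

lemma inj_hfun: "hfun x = hfun y \<longleftrightarrow> x = y"
  by (metis coord_inject hardy_coeff_hfun)

lemma hfun_add: "hfun (x + y) = (\<lambda>z. hfun x z + hfun y z)"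
  and hfun_diff: "hfun (x - y) = (\<lambda>z. hfun x z - hfun y z)"
  and hfun_cscale: "hfun (cscale c x) = (\<lambda>z. c * hfun x z)"
  and hfun_0: "hfun 0 = (\<lambda>z. 0)"
  by (auto simp: hfun_def cinner_add_left cinner_diff_left)

lemma hfun_sum: "hfun (\<Sum>a\<in>A. x a) = (\<lambda>z. \<Sum>a\<in>A. hfun (x a) z)"
  by (induction A rule: infinite_finite_induct) (simp_all add: hfun_0 hfun_add)

lemma hardy_inner_hfun: "hardy_inner (hfun x) (hfun y) = cinner x y"
  by (simp add: hardy_inner_def hardy_coeff_hfun cinner_def)

lemma hardy_norm_hfun: "hardy_norm (hfun x) = norm x"
  by (simp add: hardy_norm_def hardy_inner_hfun cinner_self_norm)

lemma hfun_image_iff: "hfun x \<in> hfun ` V \<longleftrightarrow> x \<in> V"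
  by (auto simp: inj_hfun)

lemma closed_subspace_hfun: "closed_subspace (hfun ` V) \<longleftrightarrow> hilbert_subspace V"
proof
  assume c: "closed_subspace (hfun ` V)"
  have "closed V"
    unfolding closed_sequential_limits
  proof (intro allI impI, elim conjE)
    fix X x assume X: "\<forall>n. X n \<in> V" and lim: "X \<longlonglongrightarrow> x"
    have l: "(\<lambda>n. hardy_norm (\<lambda>z. hfun (X n) z - hfun x z)) \<longlonglongrightarrow> 0"
      unfolding hfun_diff[symmetric] hardy_norm_hfun using lim by (simp add: LIM_zero_iff tendsto_norm_zero_iff)
    have cl: "\<forall>F f. (\<forall>k::nat. F k \<in> hfun ` V) \<longrightarrow> f \<in> hardy \<longrightarrow>
        (\<lambda>k. hardy_norm (\<lambda>z. F k z - f z)) \<longlonglongrightarrow> 0 \<longrightarrow> f \<in> hfun ` V"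
      using c unfolding closed_subspace_def by (elim conjE)
    have "\<forall>n. hfun (X n) \<in> hfun ` V" using X by simp
    from cl[THEN spec, THEN spec, THEN mp, OF this, THEN mp, OF hfun_in_hardy, THEN mp, OF l]
    have "hfun x \<in> hfun ` V" .
    then show "x \<in> V" by (simp add: hfun_image_iff)
  qed
  moreover have "0 \<in> V" using c unfolding closed_subspace_def hfun_0[symmetric] by (simp add: hfun_image_iff)
  moreover have "\<forall>x\<in>V. \<forall>y\<in>V. x + y \<in> V" using c unfolding closed_subspace_def
    by (simp add: hfun_add[symmetric] hfun_image_iff)
  moreover have "\<forall>c. \<forall>x\<in>V. cscale c x \<in> V" using c unfolding closed_subspace_def
    by (simp add: hfun_cscale[symmetric] hfun_image_iff)
  ultimately show "hilbert_subspace V" by (simp add: hilbert_subspace_def)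
next
  assume V: "hilbert_subspace V"
  have "f \<in> hfun ` V" if F: "\<forall>k::nat. F k \<in> hfun ` V" and f: "f \<in> hardy"
    and lim: "(\<lambda>k. hardy_norm (\<lambda>z. F k z - f z)) \<longlonglongrightarrow> 0" for F f
  proof -
    have "\<forall>k. \<exists>x. x \<in> V \<and> F k = hfun x" using F by blast
    then obtain X where X: "\<forall>k. X k \<in> V \<and> F k = hfun (X k)" unfolding choice_iff ..
    obtain x where x: "f = hfun x" using f by (auto simp: hardy_eq)
    have "(\<lambda>k. norm (X k - x)) \<longlonglongrightarrow> 0"
      using lim X by (simp add: x hfun_diff[symmetric] hardy_norm_hfun)
    then have lim': "X \<longlonglongrightarrow> x" by (simp add: LIM_zero_iff tendsto_norm_zero_iff)
    have "x \<in> V" by (rule closed_sequentially[OF hilbert_subspaceD(1)[OF V] _ lim']) (use X in simp)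
    then show ?thesis by (simp add: x)
  qed
  then show "closed_subspace (hfun ` V)"
    unfolding closed_subspace_def using hilbert_subspaceD(2-4)[OF V] hfun_in_hardy
    by (auto simp: hfun_add[symmetric] hfun_cscale[symmetric] hfun_0[symmetric] hfun_image_iff)
qed

lemma mult_coord_hfun: "mult_coord i (hfun x) = hfun (mul i x)"
  by (rule ext) (simp add: mult_coord_def hfun_def cinner_push_left mul_adj_ker)

text \<open>Adjoint and projection are definite descriptions over functions; this moves them to
  coefficient families.\<close>

lemma the_hfun:
  assumes "P (hfun x)" "\<And>y. P (hfun y) \<Longrightarrow> y = x" "\<And>f. P f \<Longrightarrow> f \<in> hardy"
  shows "(THE f. P f) = hfun x"
proof (rule the_equality)
  show "P (hfun x)" by (rule assms(1))
  fix f assume P: "P f"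
  from assms(3)[OF this] obtain y where "f = hfun y" unfolding hardy_eq by (rule rangeE)
  with P assms(2) show "f = hfun x" by simp
qed

lemma hardy_adjoint_hfun:
  assumes T: "\<And>x. x \<in> V \<Longrightarrow> T (hfun x) = hfun (S x)" and y': "y' \<in> V"
    and adj: "\<And>x. x \<in> V \<Longrightarrow> cinner (S x) y = cinner x y'" and V: "hilbert_subspace V"
  shows "hardy_adjoint (hfun ` V) T (hfun y) = hfun y'"
  unfolding hardy_adjoint_def
proof (rule the_hfun)
  show "hfun y' \<in> hfun ` V \<and> (\<forall>f\<in>hfun ` V. hardy_inner (T f) (hfun y) = hardy_inner f (hfun y'))"
    using y' by (auto simp: T hardy_inner_hfun adj)
  fix w assume "hfun w \<in> hfun ` V \<and> (\<forall>f\<in>hfun ` V. hardy_inner (T f) (hfun y) = hardy_inner f (hfun w))"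
  then have w: "w \<in> V" "\<And>x. x \<in> V \<Longrightarrow> cinner x y' = cinner x w"
    by (auto simp: hfun_image_iff T hardy_inner_hfun adj)
  have "w - y' \<in> V" by (rule hilbert_subspaceD(5)[OF V w(1) y'])
  then have "cinner (w - y') (w - y') = 0" using w(2) by (simp add: cinner_diff_right)
  then show "w = y'" by (simp add: cinner_self_norm)
qed (use hfun_in_hardy in auto)

lemma hardy_proj_hfun:
  assumes V: "hilbert_subspace V"
  shows "hardy_proj (hfun ` V) (hfun x) = hfun (proj V x)"
  unfolding hardy_proj_def
proof (rule the_hfun)
  show "hfun (proj V x) \<in> hfun ` V \<and> (\<forall>h\<in>hfun ` V. hardy_inner (\<lambda>z. hfun x z - hfun (proj V x) z) h = 0)"
    using proj_in[OF V] proj_orth[OF V] by (auto simp: hfun_diff[symmetric] hardy_inner_hfun)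
  fix w assume "hfun w \<in> hfun ` V \<and> (\<forall>h\<in>hfun ` V. hardy_inner (\<lambda>z. hfun x z - hfun w z) h = 0)"
  then show "w = proj V x"
    by (intro proj_eqI[OF V, symmetric]) (auto simp: hfun_image_iff hfun_diff[symmetric] hardy_inner_hfun)
qed (use hfun_in_hardy in auto)

lemma quotient_module_hfun:
  fixes V :: "('n::finite \<Rightarrow> nat) ell2 set"
  shows "quotient_module (hfun ` V) \<longleftrightarrow> hilbert_subspace V \<and> (\<forall>i. \<forall>x\<in>V. mul_adj i x \<in> V)"
proof -
  have "hardy_adjoint hardy (mult_coord i) (hfun x) = hfun (mul_adj i x)"
    for i and x :: "('n \<Rightarrow> nat) ell2"
    unfolding hardy_eq
    by (rule hardy_adjoint_hfun[where S = "mul i"])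
      (simp_all add: mult_coord_hfun cinner_push_left hilbert_subspace_UNIV)
  then show ?thesis by (auto simp: quotient_module_def closed_subspace_hfun hfun_image_iff)
qed

lemma submodule_hfun:
  "submodule (hfun ` V) \<longleftrightarrow> hilbert_subspace V \<and> (\<forall>i. \<forall>x\<in>V. mul i x \<in> V)"
  by (auto simp: submodule_def closed_subspace_hfun mult_coord_hfun hfun_image_iff)

lemma hardy_quotient_hfun: "hardy_quotient (hfun ` V) = hfun ` orthocomp V"
  by (auto simp: hardy_quotient_def hardy_eq orthocomp_def hardy_inner_hfun)

text \<open>As \<open>V\<close> is invariant under the adjoint shifts, the adjoint of a compression
  is \<open>mul_adj j\<close> itself. Commutation then says that \<open>mul_adj j\<close> maps the
  defect of \<open>mul i x\<close> into the complement of \<open>V\<close>; moving the adjoint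
  across leaves \<open>mul j y\<close>, of which only the defect counts.\<close>

lemma doubly_commuting_hfun:
  fixes V :: "('n::{finite, linorder} \<Rightarrow> nat) ell2 set"
  assumes V: "hilbert_subspace V" and adj: "\<And>i x. x \<in> V \<Longrightarrow> mul_adj i x \<in> V"
  shows "doubly_commuting (hfun ` V) \<longleftrightarrow> defect_orthogonal V"
proof -
  have comp: "compression (hfun ` V) i (hfun x) = hfun (proj V (mul i x))" for i x
    by (simp add: compression_def mult_coord_hfun hardy_proj_hfun[OF V])
  have cadj: "hardy_adjoint (hfun ` V) (compression (hfun ` V) j) (hfun x) = hfun (mul_adj j x)" if x: "x \<in> V" for j x
  proof (rule hardy_adjoint_hfun[where S = "\<lambda>y. proj V (mul j y)"])
    show "compression (hfun ` V) j (hfun y) = hfun (proj V (mul j y))" for y by (rule comp)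
    show "mul_adj j x \<in> V" by (rule adj[OF x])
    show "hilbert_subspace V" by (rule V)
    fix y
    have "cinner (mul j y - proj V (mul j y)) x = 0" by (rule proj_orth[OF V x])
    then show "cinner (proj V (mul j y)) x = cinner y (mul_adj j x)"
      by (simp add: cinner_diff_left cinner_push_left)
  qed
  have key: "proj V (mul i (mul_adj j x)) = mul_adj j (proj V (mul i x)) \<longleftrightarrow>
      (\<forall>y\<in>V. cinner (mul i x - proj V (mul i x)) (mul j y - proj V (mul j y)) = 0)"
    if ij: "i \<noteq> j" and x: "x \<in> V" for i j x
  proof -
    define D where "D = mul i x - proj V (mul i x)"
    have e: "mul i (mul_adj j x) - mul_adj j (proj V (mul i x)) = mul_adj j D"
      using ij by (simp add: D_def pull_diff mul_adj_mul_commute)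
    have c: "cinner (mul_adj j D) y = cinner D (mul j y - proj V (mul j y))" for y
    proof -
      have "cinner D (proj V (mul j y)) = 0" unfolding D_def by (rule proj_orth[OF V proj_in[OF V]])
      then show ?thesis by (simp add: cinner_diff_right cinner_push_right)
    qed
    show ?thesis
      unfolding D_def[symmetric]
    proof
      assume "proj V (mul i (mul_adj j x)) = mul_adj j (proj V (mul i x))"
      then show "\<forall>y\<in>V. cinner D (mul j y - proj V (mul j y)) = 0"
        using proj_orth[OF V, of _ "mul i (mul_adj j x)"] by (simp add: e c)
    next
      assume "\<forall>y\<in>V. cinner D (mul j y - proj V (mul j y)) = 0"
      then show "proj V (mul i (mul_adj j x)) = mul_adj j (proj V (mul i x))"
        by (intro proj_eqI[OF V] adj proj_in[OF V]) (simp add: e c)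
    qed
  qed
  have "doubly_commuting (hfun ` V) \<longleftrightarrow> (\<forall>i j. i < j \<longrightarrow> (\<forall>x\<in>V.
      proj V (mul i (mul_adj j x)) = mul_adj j (proj V (mul i x))))"
    unfolding doubly_commuting_def by (simp add: cadj comp proj_in[OF V] inj_hfun)
  also have "\<dots> \<longleftrightarrow> (\<forall>i j. i < j \<longrightarrow> (\<forall>x\<in>V. \<forall>y\<in>V.
      cinner (mul i x - proj V (mul i x)) (mul j y - proj V (mul j y)) = 0))"
    by (intro all_cong1 imp_cong ball_cong refl) (rule key, auto)
  also have "\<dots> \<longleftrightarrow> defect_orthogonal V"
  proof
    assume L: "\<forall>i j. i < j \<longrightarrow> (\<forall>x\<in>V. \<forall>y\<in>V.
      cinner (mul i x - proj V (mul i x)) (mul j y - proj V (mul j y)) = 0)"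
    show "defect_orthogonal V"
      unfolding defect_orthogonal_def
    proof (intro allI impI ballI)
      fix i j :: 'n and x y assume ij: "i \<noteq> j" and x: "x \<in> V" and y: "y \<in> V"
      show "cinner (mul i x - proj V (mul i x)) (mul j y - proj V (mul j y)) = 0"
      proof (cases "i < j")
        case True
        then show ?thesis using L x y by simp
      next
        case False
        then have "j < i" using ij by simp
        then show ?thesis using L x y by (intro cinner_eq_0D[of "mul j y - proj V (mul j y)"]) simp
      qed
    qed
  qed (auto simp: defect_orthogonal_def)
  finally show ?thesis .
qed

section \<open>The classification\<close>

text \<open>Checked on monomials: along the line through \<open>k\<close> the kernel is geometric,
  so pairing it with the wave sums the power series of \<open>\<Theta>\<close> at
  \<open>z_i\<close>.\<close>

lemma hfun_imul:
  assumes \<theta>: "inner_seq \<theta>" "\<And>w. norm w < 1 \<Longrightarrow> (\<lambda>n. coord \<theta> n * w ^ n) sums \<Theta> w"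
  shows "hfun (imul \<theta> i x) = (\<lambda>z. \<Theta> (z $ i) * hfun x z)"
proof (rule ext)
  fix z
  show "hfun (imul \<theta> i x) z = \<Theta> (z $ i) * hfun x z"
  proof (cases "z \<in> polydisc")
    case True
    have cs: "cblin (cscale (\<Theta> (z $ i)) :: ('a \<Rightarrow> nat) ell2 \<Rightarrow> _)"
      by (simp add: cblin_def bounded_linear_cscale mult.commute)
    have "cinner (imul \<theta> i x) (ker z) = cinner (cscale (\<Theta> (z $ i)) x) (ker z)"
    proof (rule cblin_cinner_eqI[OF cblin_imul[OF \<theta>(1)] cs])
      fix k
      have "(\<lambda>n. coord \<theta> n * cnj (coord (pull ((+) (k i)) (slice i k (ker z))) n)) sums
          cinner \<theta> (pull ((+) (k i)) (slice i k (ker z)))"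
        by (rule cinner_sums)
      moreover have "(\<lambda>n. coord \<theta> n * cnj (coord (pull ((+) (k i)) (slice i k (ker z))) n)) =
          (\<lambda>n. monomial k z * (coord \<theta> n * (z $ i) ^ n))"
        by (simp add: coord_ker True monomial_line fun_eq_iff)
      ultimately have 1: "(\<lambda>n. monomial k z * (coord \<theta> n * (z $ i) ^ n)) sums
          cinner \<theta> (pull ((+) (k i)) (slice i k (ker z)))"
        by (simp only:)
      have 2: "(\<lambda>n. monomial k z * (coord \<theta> n * (z $ i) ^ n)) sums (monomial k z * \<Theta> (z $ i))"
        by (intro sums_mult \<theta>(2) polydiscD True)
      from sums_unique2[OF 1 2]
      show "cinner (imul \<theta> i (delta k)) (ker z) = cinner (cscale (\<Theta> (z $ i)) (delta k)) (ker z)"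
        by (simp add: imul_delta[OF \<theta>(1)] wave_def cinner_push_left cinner_delta_left coord_ker True mult.commute)
    qed
    then show ?thesis using True by (simp add: hfun_def)
  qed (simp add: hfun_def)
qed

lemma inner_sum_hfun:
  fixes idx :: "nat \<Rightarrow> 'n::finite"
  assumes idx: "inj_on idx {1..m}"
    and \<theta>: "\<And>j. j \<in> {1..m} \<Longrightarrow> inner_seq (\<theta> (idx j))"
    and \<Theta>: "\<And>j w. j \<in> {1..m} \<Longrightarrow> norm w < 1 \<Longrightarrow> (\<lambda>n. coord (\<theta> (idx j)) n * w ^ n) sums \<Theta> (idx j) w"
  shows "inner_sum m idx \<Theta> = hfun ` imul_sum (idx ` {1..m}) \<theta>"
proof -
  have S: "(\<lambda>z. \<Sum>j=1..m. \<Theta> (idx j) (z $ idx j) * hfun (u (idx j)) z) =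
      hfun (\<Sum>i\<in>idx ` {1..m}. imul (\<theta> i) i (u i))" for u
  proof -
    have "hfun (\<Sum>i\<in>idx ` {1..m}. imul (\<theta> i) i (u i)) = (\<lambda>z. \<Sum>j=1..m. hfun (imul (\<theta> (idx j)) (idx j) (u (idx j))) z)"
      by (simp only: hfun_sum sum.reindex[OF idx] o_def)
    also have "\<dots> = (\<lambda>z. \<Sum>j=1..m. \<Theta> (idx j) (z $ idx j) * hfun (u (idx j)) z)"
      by (intro ext sum.cong refl) (simp only: hfun_imul[OF \<theta> \<Theta>])
    finally show ?thesis by simp
  qed
  show ?thesis
  proof (intro equalityI subsetI)
    fix f assume "f \<in> inner_sum m idx \<Theta>"
    then obtain F where F: "\<forall>j\<in>{1..m}. F j \<in> hardy" and f: "f = (\<lambda>z. \<Sum>j=1..m. \<Theta> (idx j) (z $ idx j) * F j z)"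
      by (auto simp: inner_sum_def)
    have "\<forall>j\<in>{1..m}. \<exists>x. F j = hfun x" using F by (auto simp: hardy_eq)
    then obtain w where w: "\<forall>j\<in>{1..m}. F j = hfun (w j)" unfolding bchoice_iff ..
    \<comment> \<open>The families in \<open>imul_sum\<close> are indexed by variables, so the
      functions are carried over by the inverse of \<open>idx\<close>.\<close>
    define u where "u i = w (inv_into {1..m} idx i)" for i
    have "F j = hfun (u (idx j))" if "j \<in> {1..m}" for j
      using w that inv_into_f_f[OF idx that] by (simp add: u_def)
    then have "f = (\<lambda>z. \<Sum>j=1..m. \<Theta> (idx j) (z $ idx j) * hfun (u (idx j)) z)"
      unfolding f by (intro ext sum.cong) auto
    then show "f \<in> hfun ` imul_sum (idx ` {1..m}) \<theta>"
      unfolding S by (auto simp: imul_sum_def)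
  next
    fix f assume "f \<in> hfun ` imul_sum (idx ` {1..m}) \<theta>"
    then obtain u where "f = hfun (\<Sum>i\<in>idx ` {1..m}. imul (\<theta> i) i (u i))" by (auto simp: imul_sum_def)
    then have f: "f = (\<lambda>z. \<Sum>j=1..m. \<Theta> (idx j) (z $ idx j) * hfun (u (idx j)) z)" by (simp only: S)
    show "f \<in> inner_sum m idx \<Theta>"
      unfolding inner_sum_def f
      by (intro CollectI exI[of _ "\<lambda>j. hfun (u (idx j))"] conjI refl) (simp add: hfun_in_hardy)
  qed
qed

text \<open>Written as an orthogonal complement, the algebraic sum is closed without taking a
  closure, and its invariance reduces to that of \<open>wave_perps\<close> under the adjoint
  shifts.\<close>

lemma submodule_imul_sum:
  fixes I :: "'n::finite set"
  assumes \<theta>: "\<And>i. i \<in> I \<Longrightarrow> inner_seq (\<theta> i)"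
  shows "submodule (hfun ` imul_sum I \<theta>)"
proof -
  have mul: "mul j x \<in> orthocomp (wave_perps I \<theta>)" if x: "x \<in> orthocomp (wave_perps I \<theta>)" for j x
  proof (rule orthocompI)
    fix y assume "y \<in> wave_perps I \<theta>"
    then have "mul_adj j y \<in> wave_perps I \<theta>" by (simp add: wave_perps_def mul_adj_wave_perp)
    with x show "cinner (mul j x) y = 0" unfolding cinner_push_left[OF inj_up] by (rule orthocompD)
  qed
  have "orthocomp (wave_perps I \<theta>) = imul_sum I \<theta>" by (rule orthocomp_wave_perps) (rule \<theta>)
  moreover have "submodule (hfun ` orthocomp (wave_perps I \<theta>))"
    unfolding submodule_hfun by (intro conjI hilbert_subspace_orthocomp allI ballI mul)
  ultimately show ?thesis by simp
qed

theorem theorem4p7: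
  fixes Q :: "(complex ^ 'n::{finite,linorder} \<Rightarrow> complex) set"
  assumes "quotient_module Q" and "Q \<noteq> hardy"
  shows "doubly_commuting Q \<longleftrightarrow>
    (\<exists>(m::nat) (idx::nat \<Rightarrow> 'n) \<Theta>.
       1 \<le> m \<and> m \<le> CARD('n) \<and> strict_mono_on {1..m} idx \<and>
       (\<forall>j\<in>{1..m}. inner_function (\<Theta> (idx j))) \<and>
       submodule (inner_sum m idx \<Theta>) \<and>
       Q = hardy_quotient (inner_sum m idx \<Theta>))"
proof -
  have "Q \<subseteq> range hfun" using assms(1) by (auto simp: quotient_module_def closed_subspace_def hardy_eq)
  then obtain V where Q: "Q = hfun ` V" unfolding subset_image_iff by auto
  have V: "hilbert_subspace V" "\<And>i x. x \<in> V \<Longrightarrow> mul_adj i x \<in> V"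
    using assms(1) by (simp_all add: Q quotient_module_hfun)
  have ne: "V \<noteq> UNIV" using assms(2) by (auto simp: Q hardy_eq)
  have dc: "doubly_commuting (hfun ` V) \<longleftrightarrow> defect_orthogonal V"
    by (rule doubly_commuting_hfun[OF V(1)]) (rule V(2))
  show ?thesis
    unfolding Q dc
  proof
    assume "defect_orthogonal V"
    have "\<exists>I \<theta>. I \<noteq> {} \<and> (\<forall>i\<in>I. inner_seq (\<theta> i)) \<and> V = wave_perps I \<theta>"
    proof (rule defect_orthogonal_imp_wave_perps[OF V(1) _ \<open>defect_orthogonal V\<close> ne])
      show "mul_adj i x \<in> V" if "x \<in> V" for i x by (rule V(2)[OF that])
      fix I \<theta> assume "I \<noteq> {}" "\<And>i. i \<in> I \<Longrightarrow> inner_seq (\<theta> i)" "V = wave_perps I \<theta>"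
      then show ?thesis by (intro exI[of _ I] exI[of _ \<theta>]) simp
    qed
    then obtain I \<theta> where I: "I \<noteq> {}" and t: "\<forall>i\<in>I. inner_seq (\<theta> i)" and VI: "V = wave_perps I \<theta>"
      by (elim exE conjE)
    have \<theta>: "inner_seq (\<theta> i)" if "i \<in> I" for i using t that by (rule bspec)
    define m where "m = card I"
    \<comment> \<open>List positions start at 0 and the indices \<open>j\<close> at 1, hence
      \<open>j - 1\<close>.\<close>
    define idx where "idx j = sorted_list_of_set I ! (j - 1)" for j
    define \<Theta> where "\<Theta> i w = (\<Sum>n. coord (\<theta> i) n * w ^ n)" for i w
    have mono: "strict_mono_on {1..m} idx"
    proof (rule strict_mono_onI)
      fix r s assume "r \<in> {1..m}" "s \<in> {1..m}" "r < s"
      then show "idx r < idx s" unfolding idx_def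
        by (intro sorted_wrt_nth_less[OF strict_sorted_list_of_set]) (auto simp: m_def)
    qed
    have idxI: "idx ` {1..m} = I"
    proof -
      have "idx ` {1..m} = (!) (sorted_list_of_set I) ` (\<lambda>j. j - 1) ` {1..m}"
        by (auto simp: idx_def image_image)
      also have "(\<lambda>j. j - 1) ` {1..m} = {..<m}"
      proof (intro equalityI subsetI)
        fix j assume "j \<in> {..<m}"
        then show "j \<in> (\<lambda>j. j - 1) ` {1..m}" by (intro image_eqI[of _ _ "Suc j"]) auto
      qed auto
      also have "(!) (sorted_list_of_set I) ` {..<m} = set (sorted_list_of_set I)"
        by (auto simp: set_conv_nth m_def image_def simp del: set_sorted_list_of_set)
      finally show ?thesis by simp
    qed
    have \<theta>': "inner_seq (\<theta> (idx j))" if "j \<in> {1..m}" for j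
      using that idxI by (intro \<theta>) auto
    have sum: "inner_sum m idx \<Theta> = hfun ` imul_sum I \<theta>"
      unfolding idxI[symmetric]
    proof (rule inner_sum_hfun[OF strict_mono_on_imp_inj_on[OF mono]])
      show "inner_seq (\<theta> (idx j))" if "j \<in> {1..m}" for j by (rule \<theta>'[OF that])
      show "(\<lambda>n. coord (\<theta> (idx j)) n * w ^ n) sums \<Theta> (idx j) w" if "norm w < 1" for j w
        unfolding \<Theta>_def by (rule inner_seq_power_series_sums[OF that])
    qed
    have "1 \<le> m" using I by (simp add: m_def Suc_le_eq card_gt_0_iff)
    moreover have "m \<le> CARD('n)" unfolding m_def by (rule card_mono) auto
    moreover have "\<forall>j\<in>{1..m}. inner_function (\<Theta> (idx j))"
      unfolding \<Theta>_def by (intro ballI inner_seq_imp_inner_function \<theta>')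
    moreover have "submodule (inner_sum m idx \<Theta>)" unfolding sum by (rule submodule_imul_sum) (rule \<theta>)
    moreover have "hfun ` V = hardy_quotient (inner_sum m idx \<Theta>)"
      unfolding sum hardy_quotient_hfun VI by (simp add: orthocomp_imul_sum \<theta>)
    ultimately show "\<exists>m idx \<Theta>. 1 \<le> m \<and> m \<le> CARD('n) \<and> strict_mono_on {1..m} idx \<and>
       (\<forall>j\<in>{1..m}. inner_function (\<Theta> (idx j))) \<and>
       submodule (inner_sum m idx \<Theta>) \<and> hfun ` V = hardy_quotient (inner_sum m idx \<Theta>)"
      using mono by blast
  next
    assume "\<exists>m idx \<Theta>. 1 \<le> m \<and> m \<le> CARD('n) \<and> strict_mono_on {1..m} idx \<and>
       (\<forall>j\<in>{1..m}. inner_function (\<Theta> (idx j))) \<and>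
       submodule (inner_sum m idx \<Theta>) \<and> hfun ` V = hardy_quotient (inner_sum m idx \<Theta>)"
    then obtain m and idx :: "nat \<Rightarrow> 'n" and \<Theta> where mono: "strict_mono_on {1..m} idx"
      and inn: "\<forall>j\<in>{1..m}. inner_function (\<Theta> (idx j))"
      and VQ: "hfun ` V = hardy_quotient (inner_sum m idx \<Theta>)"
      by blast
    have "\<forall>i\<in>idx ` {1..m}. \<exists>\<theta>. inner_seq \<theta> \<and> (\<forall>w. norm w < 1 \<longrightarrow> (\<lambda>n. coord \<theta> n * w ^ n) sums \<Theta> i w)"
    proof
      fix i assume "i \<in> idx ` {1..m}"
      then have "inner_function (\<Theta> i)" using inn by auto
      then show "\<exists>\<theta>. inner_seq \<theta> \<and> (\<forall>w. norm w < 1 \<longrightarrow> (\<lambda>n. coord \<theta> n * w ^ n) sums \<Theta> i w)"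
        by (rule inner_function_imp_inner_seq) (intro exI conjI allI impI, assumption, simp)
    qed
    then obtain \<theta> where t: "\<forall>i\<in>idx ` {1..m}. inner_seq (\<theta> i) \<and> (\<forall>w. norm w < 1 \<longrightarrow> (\<lambda>n. coord (\<theta> i) n * w ^ n) sums \<Theta> i w)"
      unfolding bchoice_iff ..
    have \<theta>: "inner_seq (\<theta> i)" if "i \<in> idx ` {1..m}" for i
      using bspec[OF t that] by (rule conjunct1)
    have sums: "(\<lambda>n. coord (\<theta> (idx j)) n * w ^ n) sums \<Theta> (idx j) w" if "j \<in> {1..m}" "norm w < 1" for j w
      using bspec[OF t imageI[OF that(1)]] that(2) by simp
    have sum: "inner_sum m idx \<Theta> = hfun ` imul_sum (idx ` {1..m}) \<theta>"
      by (rule inner_sum_hfun[OF strict_mono_on_imp_inj_on[OF mono]]) (intro \<theta> imageI sums; assumption)+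
    have "orthocomp (imul_sum (idx ` {1..m}) \<theta>) = wave_perps (idx ` {1..m}) \<theta>"
      by (rule orthocomp_imul_sum) (rule \<theta>)
    then have "hfun ` V = hfun ` wave_perps (idx ` {1..m}) \<theta>"
      unfolding VQ sum hardy_quotient_hfun by (rule arg_cong)
    then have V': "V = wave_perps (idx ` {1..m}) \<theta>"
      by (subst (asm) inj_image_eq_iff) (auto simp: inj_def inj_hfun)
    show "defect_orthogonal V" unfolding V' by (rule wave_perps_defect_orthogonal) (rule \<theta>)
  qed
qed

end
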